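(* Let $H$ be any fixed hypergraph with at least one edge, and write $m_H=\min\{|e|:e\in E(H)\}$. There exist constants $C,C_1,C_2>0$ and $n_0\in\mathbb N$ depending only on $H$ such that for all $n\ge n_0$ and all $p\in(0,1)$, in the homogeneous model $\mathbb H(n,p)$, $$d_{W/K}(\widetilde Z_H^n,\mathcal N)\le C\Big((1-p)\min_{F\subseteq H:\,e_F\ge1}p^{e_F}n^{v_F}\Big)^{-1/2}$$ and $$C_1\,R_n\le\Big((1-p)\min_{F\subseteq H:\,e_F\ge1}p^{e_F}n^{v_F}\Big)^{-1/2}\le C_2\,R_n,\qquad R_n:=\Big|\mathbf E\big[(\widetilde Z_H^n)^4\big]-3\Big|^{1/2}+n^{-m_H/2}.$$ Additionally, there exist $\delta\in(0,1/2)$, $C_3,C_4>0$ and $n_1\in\mathbb N$, depending only on $H$, such that for all $n\ge n_1$ and all $p\in(0,\delta)\cup(1-\delta,1)$, $$C_3\Big(\mathbf E\big[(\widetilde Z_H^n)^4\big]-3\Big)\le\Big((1-p)\min_{F\subseteq H:\,e_F\ge1}p^{e_F}n^{v_F}\Big)^{-1}\le C_4\Big(\mathbf E\big[(\widetilde Z_H^n)^4\big]-3\Big).$$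
   Context: A hypergraph $H$ consists of a finite vertex set $V(H)$ and a set $E(H)$ of non-empty subsets of $V(H)$ (edges, of arbitrary sizes; size $1$ is allowed). $v_H=|V(H)|$, $e_H=|E(H)|$, and $|e|$ is the size of the edge $e$. $F\subseteq H$ means $V(F)\subseteq V(H)$ and $E(F)\subseteq E(H)$; $\simeq$ denotes hypergraph isomorphism. $[n]=\{1,\dots,n\}$ and $K_n^*=([n],2^{[n]}\setminus\{\emptyset\})$ is the complete hypergraph on $[n]$. For $p\in(0,1)$, the homogeneous random hypergraph $\mathbb H(n,p)$ has vertex set $[n]$, and each non-empty $e\subseteq[n]$ is an edge independently with the same probability $p$. $Z_H^n$ is the number of hypergraphs $H'\subseteq K_n^*$ with $H'\simeq H$ and $H'\subseteq\mathbb H(n,p)$, and $\widetilde Z_H^n=(Z_H^n-\mathbf E[Z_H^n])/\sqrt{\mathrm{Var}[Z_H^n]}$ (defined for $n\ge v_H$). $\mathcal N$ is a standard normal random variable. $d_W(X,\mathcal N)=\sup_{\mathrm{Lip}(h)\le1}|\mathbf E[h(X)-h(\mathcal N)]|$ (supremum over $h:\mathbb R\to\mathbb R$ with Lipschitz constant at most $1$), $d_K(X,\mathcal N)=\sup_{t\in\mathbb R}|\mathbf P(X\le t)-\mathbf P(\mathcal N\le t)|$, $d_{W/K}=\max\{d_W,d_K\}$. *)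

theory Defs
  imports "HOL-Probability.Probability"
begin

datatype 'a hypergraph = Hypergraph (verts: "'a set") (edges: "'a set set")

definition wf_hypergraph :: "'a hypergraph \<Rightarrow> bool" where
  "wf_hypergraph H \<longleftrightarrow> finite (verts H) \<and> edges H \<subseteq> Pow (verts H) - {{}}"

(* F need not be induced or spanning, but it must itself be a hypergraph:
   its edges have to lie inside its own vertex set. *)
definition subhypergraph :: "'a hypergraph \<Rightarrow> 'a hypergraph \<Rightarrow> bool" where
  "subhypergraph F H \<longleftrightarrow>
     wf_hypergraph F \<and> wf_hypergraph H \<and> verts F \<subseteq> verts H \<and> edges F \<subseteq> edges H"

definition isomorphic :: "'a hypergraph \<Rightarrow> 'b hypergraph \<Rightarrow> bool" where
  "isomorphic G H \<longleftrightarrow>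
     (\<exists>f. bij_betw f (verts G) (verts H) \<and>
          (\<forall>e. e \<subseteq> verts G \<longrightarrow> (e \<in> edges G \<longleftrightarrow> f ` e \<in> edges H)))"

definition complete_hypergraph :: "nat \<Rightarrow> nat hypergraph" where
  "complete_hypergraph n = Hypergraph {1..n} (Pow {1..n} - {{}})"

(* The random function drawn from Pi_pmf is the indicator of the random edge set. *)
definition homogeneous_random_hypergraph :: "nat \<Rightarrow> real \<Rightarrow> nat hypergraph pmf" where
  "homogeneous_random_hypergraph n p =
     map_pmf (\<lambda>\<omega>. Hypergraph {1..n} {e \<in> edges (complete_hypergraph n). \<omega> e})
       (Pi_pmf (edges (complete_hypergraph n)) False (\<lambda>_. bernoulli_pmf p))"

(* Copies are unlabelled: each subhypergraph isomorphic to H counts once, and its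
   vertex set is part of its identity, also when H has isolated vertices. *)
definition copies :: "'a hypergraph \<Rightarrow> nat \<Rightarrow> nat hypergraph \<Rightarrow> real" where
  "copies H n G = real (card {H'. subhypergraph H' (complete_hypergraph n) \<and>
                                  isomorphic H' H \<and> subhypergraph H' G})"

(* Junk value 0 when the variance vanishes, in particular when n < card (verts H). *)
definition std_copies :: "'a hypergraph \<Rightarrow> nat \<Rightarrow> real \<Rightarrow> nat hypergraph \<Rightarrow> real" where
  "std_copies H n p G =
     (copies H n G - measure_pmf.expectation (homogeneous_random_hypergraph n p) (copies H n)) /
     sqrt (measure_pmf.variance (homogeneous_random_hypergraph n p) (copies H n))"

definition fourth_moment :: "'a hypergraph \<Rightarrow> nat \<Rightarrow> real \<Rightarrow> real" where
  "fourth_moment H n p =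
     measure_pmf.expectation (homogeneous_random_hypergraph n p) (\<lambda>G. std_copies H n p G ^ 4)"

definition std_copies_distr :: "'a hypergraph \<Rightarrow> nat \<Rightarrow> real \<Rightarrow> real measure" where
  "std_copies_distr H n p =
     distr (measure_pmf (homogeneous_random_hypergraph n p)) borel (std_copies H n p)"

(* The distances take values in ereal, so that the suprema are genuine without any
   boundedness side condition.  The Wasserstein distance is meant for laws with a
   finite first moment, for which all the integrals below exist. *)
definition dist_W :: "real measure \<Rightarrow> real measure \<Rightarrow> ereal" where
  "dist_W M N = (SUP h \<in> {h :: real \<Rightarrow> real. 1-lipschitz_on UNIV h}.
                   ereal \<bar>(\<integral>x. h x \<partial>M) - (\<integral>x. h x \<partial>N)\<bar>)"

definition dist_K :: "real measure \<Rightarrow> real measure \<Rightarrow> ereal" where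
  "dist_K M N = (SUP t. ereal \<bar>cdf M t - cdf N t\<bar>)"

definition dist_WK :: "real measure \<Rightarrow> real measure \<Rightarrow> ereal" where
  "dist_WK M N = max (dist_W M N) (dist_K M N)"

definition min_sub :: "'a hypergraph \<Rightarrow> nat \<Rightarrow> real \<Rightarrow> real" where
  "min_sub H n p =
     Min ((\<lambda>F. p ^ card (edges F) * real n ^ card (verts F)) `
            {F. subhypergraph F H \<and> card (edges F) \<ge> 1})"

definition min_edge_size :: "'a hypergraph \<Rightarrow> nat" where
  "min_edge_size H = Min (card ` edges H)"

lemma finite_subhypergraphs: "finite {F. subhypergraph F H}"
proof (cases "wf_hypergraph H")
  case True
  have "{F. subhypergraph F H} \<subseteq>
      (\<lambda>(V, E). Hypergraph V E) ` (Pow (verts H) \<times> Pow (edges H))"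
  proof
    fix F assume "F \<in> {F. subhypergraph F H}"
    then show "F \<in> (\<lambda>(V, E). Hypergraph V E) ` (Pow (verts H) \<times> Pow (edges H))"
      by (cases F) (auto simp: subhypergraph_def)
  qed
  moreover have "finite (verts H)" "finite (edges H)"
    using True by (auto simp: wf_hypergraph_def intro: finite_subset)
  ultimately show ?thesis
    by (meson finite_Pow_iff finite_SigmaI finite_imageI finite_subset)
qed (simp add: subhypergraph_def)

end

theory Submission
  imports Defs
begin

text \<open>Write \<open>N\<close> for the number of copies, \<open>q = 1 - p\<close>, \<open>s2\<close> for the variance of \<open>N\<close>, \<open>W\<close> for the
standardised count, and \<open>Psi\<close> for the minimum of \<open>p ^ e_F * n ^ v_F\<close> over the subhypergraphs with an edge.
\<open>N\<close> is the sum, over all copies, of the indicator that the edges of that copy are all present. All three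
assertions come down to one quantity: the sum \<open>Q\<close> of \<open>p ^ card (A \<union> B \<union> C \<union> D)\<close> over the
quadruples of copies whose edge sets \<open>A, B, C, D\<close> are linked, that is, cannot be divided into two
groups without a common edge.

Counting. A copy that shares an edge with a given bounded set of edges meets it in a copy of some
subhypergraph \<open>F\<close>, so that choosing it costs a factor of order at most \<open>X / Psi\<close> instead of
\<open>X = n ^ v_H * p ^ e_H\<close>. Building linked quadruples one copy after the other gives
\<open>Q \<le> const * X ^ 4 / Psi ^ 3\<close>, and pairs give \<open>s2 \<le> const * q * X\<^sup>2 / Psi\<close>. Both orders are attained: pick
inside each copy a copy of a minimiser \<open>F\<close>; there are few possible values of this choice, so by the power mean
inequality many pairs and quadruples of copies share it. Hence \<open>q * Q / s2\<^sup>2\<close> is of the exact order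
\<open>1 / (q * Psi)\<close>, the square of the rate.

Fourth moment. \<open>E W ^ 4 - 3\<close> is the fourth cumulant of \<open>N\<close> divided by \<open>s2\<^sup>2\<close>, and this cumulant is the sum of
the joint cumulants of all quadruples of indicators. A joint cumulant vanishes unless the quadruple is
linked, and it is at most a constant times \<open>q * p ^ card (A \<union> B \<union> C \<union> D)\<close>. This is the upper bound. For small \<open>p\<close>
the joint cumulant of a linked quadruple is dominated by its first term \<open>p ^ card (A \<union> B \<union> C \<union> D)\<close>, and for
\<open>p\<close> near 1 it is \<open>q * card (A \<inter> B \<inter> C \<inter> D)\<close> up to terms of order \<open>q\<^sup>2\<close>; both
regimes yield a matching lower bound. For \<open>p\<close> in between the rate has the order \<open>n\<close> to the power
\<open>- m_H / 2\<close>, the second summand of \<open>R_n\<close>.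

Normal approximation. Since \<open>N\<close> is increasing in every edge variable \<open>x_i\<close>, it can be written as
\<open>N - E N = (\<Sum>i. (x_i - p) * g_i)\<close> with \<open>g_i \<ge> 0\<close> independent of \<open>x_i\<close>, and also its increments \<open>d_i\<close> are
nonnegative. Integration by parts in the variables \<open>x_i\<close> turns the expectation of \<open>W * f W\<close> in Stein's equation into
one of increments of \<open>f\<close>. The linear part of the increments contributes through the fluctuation of
\<open>V = p * q * (\<Sum>i. g_i * d_i)\<close> around its mean \<open>s2\<close>. The remainder is bounded by increments of a
monotone function \<open>G\<close>, and because everything in sight is nonnegative these can be integrated
back by parts: what is left is the expectation of \<open>T * G W\<close> with \<open>T = (\<Sum>i. (x_i - p) * (g_i * d_i))\<close>. This use of monotonicity, which for
exchangeable pairs goes back to Shao and Zhang, works for half lines as well as for Lipschitz functions and gives the same rate for both distances. The variance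
of \<open>V\<close> and the second moment of \<open>T\<close> are again sums over linked quadruples, at most a constant times \<open>q * Q\<close>.\<close>

section \<open>The standard normal distribution\<close>

abbreviation gphi :: "real \<Rightarrow> real" where "gphi \<equiv> std_normal_density"

lemma gphi_pos: "gphi x > 0"
  by (rule normal_density_pos) simp

lemma gphi_has_derivative: "(gphi has_real_derivative (- x * gphi x)) (at x)"
  unfolding std_normal_density_def by (auto intro!: derivative_eq_intros simp: field_simps)

lemma isCont_gphi: "isCont gphi x"
  using gphi_has_derivative DERIV_isCont by blast

lemma continuous_on_gphi: "continuous_on A gphi"
  using isCont_gphi continuous_at_imp_continuous_on by blast

lemma gphi_tendsto_0: "(gphi \<longlongrightarrow> 0) at_top" "(gphi \<longlongrightarrow> 0) at_bot"
proof -
  have *: "(gphi \<longlongrightarrow> 0) F" if "filterlim (\<lambda>x::real. x\<^sup>2) at_top F" for F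
  proof -
    have "filterlim (\<lambda>x::real. (1 / 2) * x\<^sup>2) at_top F"
      by (rule filterlim_tendsto_pos_mult_at_top[OF tendsto_const _ that]) simp
    then have "filterlim (\<lambda>x::real. - ((1 / 2) * x\<^sup>2)) at_bot F"
      by (simp only: filterlim_uminus_at_bot minus_minus)
    then have "((\<lambda>x::real. exp (- ((1 / 2) * x\<^sup>2))) \<longlongrightarrow> 0) F"
      by (rule filterlim_compose[OF exp_at_bot])
    then have "((\<lambda>x::real. (1 / sqrt (2 * pi)) * exp (- ((1 / 2) * x\<^sup>2))) \<longlongrightarrow> (1 / sqrt (2 * pi)) * 0) F"
      by (rule tendsto_mult_left)
    then show ?thesis by (simp add: std_normal_density_def[abs_def])
  qed
  show "(gphi \<longlongrightarrow> 0) at_top"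
    by (rule *, rule filterlim_pow_at_top[OF _ filterlim_ident]) simp
  show "(gphi \<longlongrightarrow> 0) at_bot"
    by (rule *, rule filterlim_pow_at_bot_even[OF _ filterlim_ident]) simp_all
qed

text \<open>Both the distribution function and the solution of Stein's equation for a Lipschitz function are
primitives of an integrable continuous function that vanish at minus infinity.\<close>

definition below_integral :: "(real \<Rightarrow> real) \<Rightarrow> real \<Rightarrow> real" where
  "below_integral g w = (\<integral>x. indicator {..w} x * g x \<partial>lborel)"

lemma below_integral_integrable:
  fixes g :: "real \<Rightarrow> real"
  assumes "integrable lborel g"
  shows "integrable lborel (\<lambda>x. indicator {..w} x * g x)"
  using integrable_mult_indicator[OF _ assms, of "{..w}"] by simp

lemma below_integral_at_top:
  assumes "integrable lborel g"
  shows "(below_integral g \<longlongrightarrow> (\<integral>x. g x \<partial>lborel)) at_top"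
  using tendsto_integral_at_top[OF _ assms] by (simp add: below_integral_def[abs_def])

lemma below_integral_at_bot:
  assumes g: "integrable lborel g"
  shows "(below_integral g \<longlongrightarrow> 0) at_bot"
proof -
  have g': "integrable lborel (\<lambda>x. g (- x))"
    using lborel_integrable_real_affine[OF g, of "-1" 0] by simp
  have eq: "below_integral g (- t) = (\<integral>x. g (-x) \<partial>lborel) - below_integral (\<lambda>x. g (- x)) t" for t
  proof -
    have i: "integrable lborel (\<lambda>x. indicator {t..} x * g (-x))"
      using integrable_mult_indicator[OF _ g', of "{t..}"] by simp
    have "below_integral g (- t) = (\<integral>x. indicator {..-t} (-x) * g (-x) \<partial>lborel)"
      unfolding below_integral_def
      using lborel_integral_real_affine[of "-1" "\<lambda>x. indicator {..-t} x * g x" 0] by simp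
    also have "\<dots> = (\<integral>x. indicator {t..} x * g (-x) \<partial>lborel)"
      by (intro Bochner_Integration.integral_cong) (auto simp: indicator_def)
    also have "\<dots> = (\<integral>x. g (-x) - indicator {..t} x * g (-x) \<partial>lborel)"
    proof (rule integral_cong_AE)
      show "(\<lambda>x. indicator {t..} x * g (-x)) \<in> borel_measurable lborel"
        using i by (rule borel_measurable_integrable)
      show "(\<lambda>x. g (-x) - indicator {..t} x * g (-x)) \<in> borel_measurable lborel"
        using g' below_integral_integrable[OF g'] by (intro borel_measurable_diff borel_measurable_integrable) auto
      show "AE x in lborel. indicator {t..} x * g (-x) = g (-x) - indicator {..t} x * g (-x)"
        using AE_lborel_singleton[of t] by eventually_elim (auto simp: indicator_def)
    qed
    also have "\<dots> = (\<integral>x. g (-x) \<partial>lborel) - below_integral (\<lambda>x. g (- x)) t"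
      unfolding below_integral_def using g' below_integral_integrable[OF g']
      by (intro Bochner_Integration.integral_diff) auto
    finally show ?thesis .
  qed
  have "((\<lambda>t. (\<integral>x. g (-x) \<partial>lborel) - below_integral (\<lambda>x. g (- x)) t) \<longlongrightarrow>
      (\<integral>x. g (-x) \<partial>lborel) - (\<integral>x. g (-x) \<partial>lborel)) at_top"
    by (intro tendsto_intros below_integral_at_top g')
  then have "((\<lambda>t. below_integral g (- t)) \<longlongrightarrow> 0) at_top"
    by (simp add: eq)
  then show ?thesis
    by (simp add: filterlim_at_bot_mirror)
qed

lemma below_integral_has_derivative:
  assumes g: "integrable lborel g" and c: "continuous_on UNIV g"
  shows "(below_integral g has_real_derivative g w) (at w)"
proof -
  let ?a = "w - 1"
  have eq: "below_integral g u = below_integral g ?a + integral {?a..u} g" if "u \<in> {?a<..<w+1}" for u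
  proof -
    have i: "integrable lborel (\<lambda>x. indicator {?a..u} x *\<^sub>R g x)"
      using integrable_mult_indicator[OF _ g, of "{?a..u}"] by simp
    have "below_integral g u = (\<integral>x. indicator {..?a} x * g x + indicator {?a..u} x *\<^sub>R g x \<partial>lborel)"
      unfolding below_integral_def
    proof (rule integral_cong_AE)
      show "(\<lambda>x. indicator {..u} x * g x) \<in> borel_measurable lborel"
        using below_integral_integrable[OF g] by (rule borel_measurable_integrable)
      show "(\<lambda>x. indicator {..?a} x * g x + indicator {?a..u} x *\<^sub>R g x) \<in> borel_measurable lborel"
        using i below_integral_integrable[OF g] by (intro borel_measurable_add borel_measurable_integrable) auto
      show "AE x in lborel. indicator {..u} x * g x = indicator {..?a} x * g x + indicator {?a..u} x *\<^sub>R g x"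
        by (rule eventually_mono[OF AE_lborel_singleton[of ?a]]) (use that in \<open>auto simp: indicator_def\<close>)
    qed
    also have "\<dots> = below_integral g ?a + (\<integral>x. indicator {?a..u} x *\<^sub>R g x \<partial>lborel)"
      unfolding below_integral_def using i below_integral_integrable[OF g]
      by (intro Bochner_Integration.integral_add) auto
    also have "(\<integral>x. indicator {?a..u} x *\<^sub>R g x \<partial>lborel) = integral {?a..u} g"
      using set_borel_integral_eq_integral(2)[of "{?a..u}" g] i
      by (simp add: set_integrable_def set_lebesgue_integral_def)
    finally show ?thesis .
  qed
  have "((\<lambda>u. integral {?a..u} g) has_real_derivative g w) (at w within {?a..w+1})"
    by (rule integral_has_real_derivative) (auto intro: continuous_on_subset[OF c])
  then have "((\<lambda>u. integral {?a..u} g) has_real_derivative g w) (at w)"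
    by (simp add: at_within_Icc_at)
  then have d: "((\<lambda>u. below_integral g ?a + integral {?a..u} g) has_real_derivative g w) (at w)"
    by (auto intro!: derivative_eq_intros)
  show ?thesis
    by (rule has_field_derivative_transform_within_open[OF d, of "{?a<..<w+1}"])
      (use eq in auto)
qed

abbreviation gPhi :: "real \<Rightarrow> real" where "gPhi \<equiv> cdf std_normal_distribution"

lemma gphi_integrable: "integrable lborel gphi"
  using integrable_std_normal_moment[of 0] by simp

lemma integral_gphi: "(\<integral>x. gphi x \<partial>lborel) = 1"
  using integral_std_normal_moment_even[of 0] by simp

lemma gPhi_eq: "gPhi = below_integral gphi"
proof
  fix w
  have "emeasure std_normal_distribution {..w} = (\<integral>\<^sup>+x. ennreal (gphi x) * indicator {..w} x \<partial>lborel)"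
    by (subst emeasure_density) auto
  also have "\<dots> = (\<integral>\<^sup>+x. ennreal (indicator {..w} x * gphi x) \<partial>lborel)"
    by (intro nn_integral_cong) (auto simp: indicator_def)
  also have "\<dots> = ennreal (below_integral gphi w)"
    unfolding below_integral_def
    by (rule nn_integral_eq_integral[OF below_integral_integrable[OF gphi_integrable]]) auto
  finally have "emeasure std_normal_distribution {..w} = ennreal (below_integral gphi w)" .
  moreover have "below_integral gphi w \<ge> 0"
    unfolding below_integral_def by (intro integral_nonneg_AE) auto
  ultimately show "gPhi w = below_integral gphi w"
    by (simp add: cdf_def measure_def)
qed

lemma gPhi_has_derivative: "(gPhi has_real_derivative gphi w) (at w)"
  unfolding gPhi_eq by (rule below_integral_has_derivative[OF gphi_integrable continuous_on_gphi])

lemma gPhi_lim: "(gPhi \<longlongrightarrow> 1) at_top" "(gPhi \<longlongrightarrow> 0) at_bot"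
  unfolding gPhi_eq using below_integral_at_top[OF gphi_integrable] below_integral_at_bot[OF gphi_integrable]
  by (simp_all add: integral_gphi)

lemma gPhi_mono: "a \<le> b \<Longrightarrow> gPhi a \<le> gPhi b"
proof (erule DERIV_nonneg_imp_nondecreasing)
  show "\<exists>y. (gPhi has_real_derivative y) (at x) \<and> 0 \<le> y" for x
    using gPhi_has_derivative[of x] gphi_pos[of x] by (intro exI[of _ "gphi x"]) simp
qed

lemma gPhi_nonneg: "gPhi w \<ge> 0"
  by (simp add: cdf_def)

lemma gPhi_le_1: "gPhi w \<le> 1"
  using prob_space.prob_le_1[OF prob_space_normal_density[of 1 0]] by (simp add: cdf_def)

text \<open>The estimates for Gaussian tails below all have this proof: the difference of the two sides is
monotone and tends to 0 at infinity.\<close>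

lemma antimono_limit_0_nonneg:
  fixes F :: "real \<Rightarrow> real"
  assumes d: "\<And>x. x \<ge> w \<Longrightarrow> \<exists>y. (F has_real_derivative y) (at x) \<and> y \<le> 0"
    and l: "(F \<longlongrightarrow> 0) at_top"
  shows "F w \<ge> 0"
proof -
  have "eventually (\<lambda>x. F x \<le> F w) at_top"
    using eventually_ge_at_top[of w]
  proof eventually_elim
    case (elim x)
    show ?case
      by (rule DERIV_nonpos_imp_nonincreasing[OF elim]) (use d in blast)
  qed
  then show ?thesis
    using tendsto_upperbound[OF l] by auto
qed

lemma gPhi_minus: "gPhi (- w) = 1 - gPhi w"
proof -
  let ?F = "\<lambda>x. gPhi (- x) + gPhi x - 1"
  have d: "(?F has_real_derivative 0) (at x)" for x
  proof -
    have "((\<lambda>x. gPhi (- x)) has_real_derivative gphi (-x) * (-1)) (at x)"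
      by (rule DERIV_chain2[OF gPhi_has_derivative]) (auto intro!: derivative_eq_intros)
    moreover have "gphi (-x) = gphi x" by (simp add: std_normal_density_def)
    ultimately show ?thesis
      by (auto intro!: derivative_eq_intros gPhi_has_derivative)
  qed
  have "((\<lambda>x. gPhi (- x)) \<longlongrightarrow> 0) at_top"
    using gPhi_lim(2) by (simp add: filterlim_at_bot_mirror)
  then have l: "(?F \<longlongrightarrow> 0 + 1 - 1) at_top"
    by (intro tendsto_intros gPhi_lim)
  have "?F w \<ge> 0"
  proof (rule antimono_limit_0_nonneg[where F = ?F])
    show "(?F \<longlongrightarrow> 0) at_top" using l by simp
    show "\<exists>y. (?F has_real_derivative y) (at x) \<and> y \<le> 0" for x
      using d[of x] by (intro exI[of _ 0]) simp
  qed
  moreover have "- ?F w \<ge> 0"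
  proof (rule antimono_limit_0_nonneg[where F = "\<lambda>x. - ?F x"])
    show "((\<lambda>x. - ?F x) \<longlongrightarrow> 0) at_top" using tendsto_minus[OF l] by simp
    show "\<exists>y. ((\<lambda>x. - ?F x) has_real_derivative y) (at x) \<and> y \<le> 0" for x
      using DERIV_minus[OF d[of x]] by (intro exI[of _ 0]) simp
  qed
  ultimately show ?thesis by linarith
qed

text \<open>The Mills ratio. Reflected, it is the quotient of the lower tail and the density.\<close>

definition mills :: "real \<Rightarrow> real" where
  "mills w = (1 - gPhi w) / gphi w"

lemma gphi_minus [simp]: "gphi (- x) = gphi x"
  by (simp add: std_normal_density_def)

lemma mills_minus: "mills (- w) = gPhi w / gphi w"
  by (simp add: mills_def gPhi_minus)

lemma mills_nonneg: "mills w \<ge> 0"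
  unfolding mills_def using gPhi_le_1[of w] by (simp add: less_imp_le)

lemma mills_has_derivative: "(mills has_real_derivative (w * mills w - 1)) (at w)"
  unfolding mills_def[abs_def]
  using gphi_pos[of w]
  by (auto intro!: derivative_eq_intros gPhi_has_derivative gphi_has_derivative simp: field_simps)

text \<open>Gordon's inequality. Multiplied by \<open>gphi w / (1 + w\<^sup>2)\<close>, the difference of both sides has the derivative
\<open>- 2 * gphi x / (1 + x\<^sup>2)\<^sup>2\<close>.\<close>

lemma mills_lower: "w \<le> (1 + w\<^sup>2) * mills w"
proof -
  let ?F = "\<lambda>w. (1 - gPhi w) - w / (1 + w\<^sup>2) * gphi w"
  have d: "(?F has_real_derivative (- 2 * gphi x / (1 + x\<^sup>2)\<^sup>2)) (at x)" for x
  proof -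
    have nz: "1 + x\<^sup>2 \<noteq> 0" by (metis add_pos_nonneg less_numeral_extra(1) order_less_irrefl zero_le_power2)
    have "((\<lambda>x. x / (1 + x\<^sup>2)) has_real_derivative (1 * (1 + x\<^sup>2) - x * (2 * x)) / ((1 + x\<^sup>2) * (1 + x\<^sup>2))) (at x)"
      by (rule DERIV_divide) (auto intro!: derivative_eq_intros simp: nz)
    then have "(?F has_real_derivative (0 - gphi x) - ((1 * (1 + x\<^sup>2) - x * (2 * x)) / ((1 + x\<^sup>2) * (1+x\<^sup>2)) * gphi x + (- x * gphi x) * (x / (1+x\<^sup>2)))) (at x)"
      by (intro DERIV_diff DERIV_mult gPhi_has_derivative gphi_has_derivative DERIV_const)
    moreover have "(0 - gphi x) - ((1 * (1 + x\<^sup>2) - x * (2 * x)) / ((1 + x\<^sup>2) * (1+x\<^sup>2)) * gphi x + (- x * gphi x) * (x / (1+x\<^sup>2))) = - 2 * gphi x / (1 + x\<^sup>2)\<^sup>2"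
      using nz by (simp add: divide_simps power2_eq_square) (simp add: algebra_simps)
    ultimately show ?thesis by simp
  qed
  have inv: "((\<lambda>w::real. 1 / w) \<longlongrightarrow> 0) at_top"
    using tendsto_inverse_0_at_top[OF filterlim_ident] by (simp add: inverse_eq_divide)
  have "((\<lambda>w::real. w / (1 + w\<^sup>2)) \<longlongrightarrow> 0) at_top"
  proof (rule tendsto_sandwich[OF _ _ tendsto_const inv])
    show "eventually (\<lambda>w::real. 0 \<le> w / (1 + w\<^sup>2)) at_top"
      using eventually_ge_at_top[of 0] by eventually_elim simp
    show "eventually (\<lambda>w::real. w / (1 + w\<^sup>2) \<le> 1 / w) at_top"
      using eventually_gt_at_top[of 0] by eventually_elim (simp add: divide_simps power2_eq_square add_pos_pos)
  qed
  then have "(?F \<longlongrightarrow> (1 - 1) - 0 * 0) at_top"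
    by (intro tendsto_intros gPhi_lim gphi_tendsto_0)
  then have l: "(?F \<longlongrightarrow> 0) at_top" by simp
  have "?F w \<ge> 0"
  proof (rule antimono_limit_0_nonneg[OF _ l])
    fix x
    have "- 2 * gphi x / (1 + x\<^sup>2)\<^sup>2 \<le> 0" by (simp add: divide_nonpos_nonneg less_imp_le)
    then show "\<exists>y. (?F has_real_derivative y) (at x) \<and> y \<le> 0" using d by blast
  qed
  moreover have "1 + w\<^sup>2 > 0" by (simp add: add_pos_nonneg)
  ultimately show ?thesis
    unfolding mills_def using gphi_pos[of w] by (simp add: field_simps)
qed

lemma mills_upper: "w * mills w \<le> 1"
proof (cases "w > 0")
  case True
  let ?F = "\<lambda>w. gphi w / w - (1 - gPhi w)"
  have d: "(?F has_real_derivative (- gphi x / x\<^sup>2)) (at x)" if "x > 0" for x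
    using that by (auto intro!: derivative_eq_intros gPhi_has_derivative gphi_has_derivative simp: field_simps power2_eq_square)
  have "((\<lambda>w. gphi w * (1/w)) \<longlongrightarrow> 0 * 0) at_top"
    using tendsto_mult[OF gphi_tendsto_0(1) tendsto_inverse_0_at_top[OF filterlim_ident]] by (simp add: inverse_eq_divide)
  then have "((\<lambda>w. gphi w / w) \<longlongrightarrow> 0) at_top" by simp
  then have "(?F \<longlongrightarrow> 0 - (1 - 1)) at_top"
    by (intro tendsto_intros gPhi_lim gphi_tendsto_0)
  then have l: "(?F \<longlongrightarrow> 0) at_top" by simp
  have "?F w \<ge> 0"
  proof (rule antimono_limit_0_nonneg[OF _ l])
    fix x assume "x \<ge> w"
    with True have "x > 0" by simp
    moreover have "- gphi x / x\<^sup>2 \<le> 0" by (simp add: divide_nonpos_nonneg less_imp_le)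
    ultimately show "\<exists>y. (?F has_real_derivative y) (at x) \<and> y \<le> 0" using d by blast
  qed
  then show ?thesis
    unfolding mills_def using gphi_pos[of w] True by (simp add: field_simps)
next
  case False
  then show ?thesis using mills_nonneg[of w] by (smt (verit) mult_nonpos_nonneg)
qed

text \<open>The derivative is the difference of the two sides of Gordon's inequality.\<close>

lemma mult_mills_mono:
  assumes "a \<le> b" shows "a * mills a \<le> b * mills b"
proof (rule DERIV_nonneg_imp_nondecreasing[OF assms])
  fix x
  have "((\<lambda>x. x * mills x) has_real_derivative ((1 + x\<^sup>2) * mills x - x)) (at x)"
    by (auto intro!: derivative_eq_intros mills_has_derivative simp: algebra_simps power2_eq_square)
  then show "\<exists>y. ((\<lambda>x. x * mills x) has_real_derivative y) (at x) \<and> 0 \<le> y"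
    using mills_lower[of x] by auto
qed


section \<open>Solutions of Stein's equation\<close>

text \<open>The exceptional point is the kink of the solution for a half line; it also spares the derivative of
\<open>x * \<bar>x\<bar>\<close> at 0.\<close>

lemma nondecreasing_except:
  fixes f :: "real \<Rightarrow> real"
  assumes ab: "a \<le> b" and c: "continuous_on {a..b} f"
    and d: "\<And>u. a < u \<Longrightarrow> u < b \<Longrightarrow> u \<noteq> z \<Longrightarrow> \<exists>y. (f has_real_derivative y) (at u) \<and> 0 \<le> y"
  shows "f a \<le> f b"
proof -
  have *: "f x \<le> f y" if "a \<le> x" "x \<le> y" "y \<le> b" "z \<notin> {x<..<y}" for x y
  proof (cases "x = y")
    case False
    with that have "x < y" by simp
    have "continuous_on {x..y} f" by (rule continuous_on_subset[OF c]) (use that in auto)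
    moreover have "\<exists>y. (f has_real_derivative y) (at u) \<and> 0 \<le> y" if "x < u" "u < y" for u
      using d[of u] that \<open>a \<le> x\<close> \<open>y \<le> b\<close> \<open>z \<notin> {x<..<y}\<close> by auto
    ultimately show ?thesis
      using DERIV_nonneg_imp_increasing_open[of x y f] \<open>x \<le> y\<close> by blast
  qed simp
  show ?thesis
  proof (cases "z \<in> {a<..<b}")
    case True
    then show ?thesis using *[of a z] *[of z b] by auto
  next
    case False
    then show ?thesis using *[of a b] ab by auto
  qed
qed

lemma increment_bounds:
  fixes f :: "real \<Rightarrow> real"
  assumes ab: "a \<le> b" and c: "continuous_on {a..b} f"
    and d: "\<And>u. a < u \<Longrightarrow> u < b \<Longrightarrow> u \<noteq> z \<Longrightarrow> (f has_real_derivative f' u) (at u)"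
    and b: "\<And>u. a < u \<Longrightarrow> u < b \<Longrightarrow> L \<le> f' u \<and> f' u \<le> U"
  shows "(b - a) * L \<le> f b - f a" "f b - f a \<le> (b - a) * U"
proof -
  have "f a - L * a \<le> f b - L * b"
  proof (rule nondecreasing_except[OF ab, where f = "\<lambda>x. f x - L * x" and z = z])
    show "\<exists>y. ((\<lambda>x. f x - L * x) has_real_derivative y) (at u) \<and> 0 \<le> y" if "a < u" "u < b" "u \<noteq> z" for u
      using d[OF that] b[OF that(1,2)] by (intro exI[of _ "f' u - L"]) (auto intro!: derivative_eq_intros)
  qed (intro continuous_intros c)
  then show "(b - a) * L \<le> f b - f a" by (simp add: algebra_simps)
  have "U * a - f a \<le> U * b - f b"
  proof (rule nondecreasing_except[OF ab, where f = "\<lambda>x. U * x - f x" and z = z])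
    show "\<exists>y. ((\<lambda>x. U * x - f x) has_real_derivative y) (at u) \<and> 0 \<le> y" if "a < u" "u < b" "u \<noteq> z" for u
      using d[OF that] b[OF that(1,2)] by (intro exI[of _ "U - f' u"]) (auto intro!: derivative_eq_intros)
  qed (intro continuous_intros c)
  then show "f b - f a \<le> (b - a) * U" by (simp add: algebra_simps)
qed

text \<open>The error of the linear approximation of \<open>f\<close>, with the slope taken at either end point, is bounded by the increment of
\<open>G\<close> times the length of the interval. This form of Taylor's bound also covers functions whose derivative \<open>f'\<close> jumps.\<close>

definition controls_increments :: "(real \<Rightarrow> real) \<Rightarrow> (real \<Rightarrow> real) \<Rightarrow> (real \<Rightarrow> real) \<Rightarrow> bool" where
  "controls_increments G f f' \<longleftrightarrow>
     (\<forall>a b. \<forall>c\<in>{a, b}. a \<le> b \<longrightarrow> \<bar>f b - f a - (b - a) * f' c\<bar> \<le> (b - a) * (G b - G a))"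

lemma mills_minus_has_derivative:
  "((\<lambda>x. mills (- x)) has_real_derivative (1 + w * mills (- w))) (at w)"
proof -
  have "((\<lambda>x. mills (- x)) has_real_derivative ((- w) * mills (- w) - 1) * (- 1)) (at w)"
    by (rule DERIV_chain2[OF mills_has_derivative]) (auto intro!: derivative_eq_intros)
  then show ?thesis by (simp add: algebra_simps)
qed

text \<open>Stein's equation for the half line up to \<open>z\<close>. Its solution is a multiple of a Mills ratio on either side of \<open>z\<close>, hence \<open>w * f w\<close> is
increasing and bounded by 1 in absolute value. By the equation, \<open>f'\<close> is an increasing function plus a decreasing one, which
yields \<open>G\<close>.\<close>

lemma Stein_solution_indicator:
  obtains f f' G where
    "\<And>w. f' w - w * f w = of_bool (w \<le> z) - gPhi z"
    "controls_increments G f f'" "\<And>w. \<bar>f' w\<bar> \<le> 2" "\<And>w. \<bar>G w\<bar> \<le> 2"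
proof
  define f where "f w = (if w \<le> z then mills (- w) * (1 - gPhi z) else mills w * gPhi z)" for w
  define f' where "f' w = w * f w + of_bool (w \<le> z) - gPhi z" for w
  define G where "G w = w * f w - of_bool (w \<le> z)" for w
  have f2: "f w = mills w * gPhi z" if "z \<le> w" for w
    using that unfolding f_def by (auto simp: mills_def gPhi_minus)
  have f1: "f w = mills (- w) * (1 - gPhi z)" if "w \<le> z" for w
    using that unfolding f_def by auto
  show "f' w - w * f w = of_bool (w \<le> z) - gPhi z" for w
    by (simp add: f'_def)
  have h_mono: "a * f a \<le> b * f b" if "a \<le> b" for a b
  proof -
    have 1: "a * f a \<le> b * f b" if "a \<le> b" "b \<le> z" for a b
      using mult_right_mono[OF mult_mills_mono[of "-b" "-a"], of "1 - gPhi z"] that gPhi_le_1[of z]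
      by (simp add: f1 mult.assoc)
    have 2: "a * f a \<le> b * f b" if "a \<le> b" "z \<le> a" for a b
      using mult_right_mono[OF mult_mills_mono[of "a" "b"], of "gPhi z"] that gPhi_nonneg[of z]
      by (simp add: f2 mult.assoc)
    show ?thesis
      using 1[of a b] 2[of a b] 1[of a z] 2[of z b] that by linarith
  qed
  have h_bd: "\<bar>w * f w\<bar> \<le> 1" for w
  proof -
    have neg: "- x * mills x * gPhi x \<le> 1" if "x \<le> 0" for x
    proof -
      have "- x * mills x * gPhi x = (1 - gPhi x) * ((- x) * mills (- x))"
        by (simp add: mills_minus) (simp add: mills_def)
      also have "\<dots> \<le> 1 * 1"
        using mills_upper[of "- x"] gPhi_nonneg[of x] gPhi_le_1[of x] mills_nonneg[of "-x"] that
        by (intro mult_mono) (auto intro!: mult_nonneg_nonneg mult_nonpos_nonneg)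
      finally show ?thesis by simp
    qed
    consider "w \<le> z" "w \<le> 0" | "w \<le> z" "0 < w" | "z < w" "w \<le> 0" | "z < w" "0 < w" by linarith
    then show ?thesis
    proof cases
      case 1
      have "(- w) * mills (- w) * (1 - gPhi z) \<le> 1 * 1"
        using mills_upper[of "- w"] gPhi_nonneg[of z] gPhi_le_1[of z] mills_nonneg[of "-w"] 1
        by (intro mult_mono) auto
      moreover have "(- w) * mills (- w) * (1 - gPhi z) \<ge> 0"
        using 1 gPhi_le_1[of z] mills_nonneg[of "-w"] by (intro mult_nonneg_nonneg) auto
      ultimately show ?thesis using 1 by (simp add: f1 mult.assoc)
    next
      case 2
      have "w * mills (- w) * (1 - gPhi z) \<le> w * mills (- w) * (1 - gPhi w)"
        using gPhi_mono[OF 2(1)] 2 mills_nonneg[of "- w"] by (intro mult_left_mono) auto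
      also have "\<dots> \<le> 1" using neg[of "- w"] 2 by (simp add: gPhi_minus)
      finally have "w * mills (- w) * (1 - gPhi z) \<le> 1" .
      moreover have "w * mills (- w) * (1 - gPhi z) \<ge> 0"
        using 2 gPhi_le_1[of z] mills_nonneg[of "-w"] by (intro mult_nonneg_nonneg) auto
      ultimately show ?thesis using 2 by (simp add: f1 mult.assoc)
    next
      case 3
      have "- w * mills w * gPhi z \<le> - w * mills w * gPhi w"
        using gPhi_mono[of z w] 3 mills_nonneg[of "w"] by (intro mult_left_mono) (auto intro: mult_nonpos_nonneg)
      also have "\<dots> \<le> 1" using neg[of "w"] 3 by simp
      finally have "- w * mills w * gPhi z \<le> 1" .
      moreover have "- w * mills w * gPhi z \<ge> 0"
        using 3 gPhi_nonneg[of z] mills_nonneg[of "w"] by (intro mult_nonneg_nonneg) auto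
      ultimately show ?thesis using 3 by (simp add: f2 mult.assoc)
    next
      case 4
      have "w * mills w * gPhi z \<le> 1 * 1"
        using mills_upper[of "w"] gPhi_nonneg[of z] gPhi_le_1[of z] mills_nonneg[of "w"] 4
        by (intro mult_mono) auto
      moreover have "w * mills w * gPhi z \<ge> 0"
        using 4 gPhi_nonneg[of z] mills_nonneg[of "w"] by (intro mult_nonneg_nonneg) auto
      ultimately show ?thesis using 4 by (simp add: f2 mult.assoc)
    qed
  qed
  show "\<bar>f' w\<bar> \<le> 2" for w
    using h_bd[of w] gPhi_nonneg[of z] gPhi_le_1[of z] unfolding f'_def by (auto simp: of_bool_def)
  show "\<bar>G w\<bar> \<le> 2" for w
    using h_bd[of w] unfolding G_def by (auto simp: of_bool_def)
  have d1: "((\<lambda>w. mills (- w) * (1 - gPhi z)) has_real_derivative (1 + w * mills (- w)) * (1 - gPhi z)) (at w)" for w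
    by (intro DERIV_cmult_right mills_minus_has_derivative)
  have d2: "((\<lambda>w. mills w * gPhi z) has_real_derivative (w * mills w - 1) * gPhi z) (at w)" for w
    by (intro DERIV_cmult_right mills_has_derivative)
  have deriv: "(f has_real_derivative f' w) (at w)" if "w \<noteq> z" for w
  proof (cases "w < z")
    case True
    have "(f has_real_derivative (1 + w * mills (- w)) * (1 - gPhi z)) (at w)"
      by (rule has_field_derivative_transform_within_open[OF d1, of "{..<z}"]) (use True f1 in auto)
    moreover have "(1 + w * mills (- w)) * (1 - gPhi z) = f' w"
      using True by (simp add: f'_def f1 algebra_simps)
    ultimately show ?thesis by simp
  next
    case False
    with that have "w > z" by simp
    have "(f has_real_derivative (w * mills w - 1) * gPhi z) (at w)"
      by (rule has_field_derivative_transform_within_open[OF d2, of "{z<..}"]) (use \<open>w > z\<close> f2 in auto)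
    moreover have "(w * mills w - 1) * gPhi z = f' w"
      using \<open>w > z\<close> by (simp add: f'_def f2 algebra_simps)
    ultimately show ?thesis by simp
  qed
  have cont: "continuous_on UNIV f"
  proof -
    have "continuous_on ({..z} \<union> {z..}) (\<lambda>w. if w \<le> z then mills (- w) * (1 - gPhi z) else mills w * gPhi z)"
    proof (rule continuous_on_If)
      show "continuous_on {..z} (\<lambda>w. mills (- w) * (1 - gPhi z))"
        by (rule DERIV_continuous_on[OF has_field_derivative_at_within[OF d1]])
      show "continuous_on {z..} (\<lambda>w. mills w * gPhi z)"
        by (rule DERIV_continuous_on[OF has_field_derivative_at_within[OF d2]])
    qed (auto simp: mills_def gPhi_minus)
    moreover have "{..z} \<union> {z..} = UNIV" by auto
    ultimately show ?thesis by (simp add: f_def[abs_def])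
  qed
  show "controls_increments G f f'"
    unfolding controls_increments_def
  proof (intro allI ballI impI)
    fix a b c :: real assume c: "c \<in> {a, b}" and ab: "a \<le> b"
    \<comment> \<open>By the equation, the derivative lies between L and U on the whole interval, with U - L = G b - G a.\<close>
    define L where "L = a * f a + of_bool (b \<le> z) - gPhi z"
    define U where "U = b * f b + of_bool (a \<le> z) - gPhi z"
    have LU: "L \<le> f' u \<and> f' u \<le> U" if "a \<le> u" "u \<le> b" for u
      using h_mono[OF that(1)] h_mono[OF that(2)] that unfolding f'_def L_def U_def
      by (auto simp: of_bool_def)
    have c1: "continuous_on {a..b} f" using continuous_on_subset[OF cont] by blast
    have inc: "(b - a) * L \<le> f b - f a" "f b - f a \<le> (b - a) * U"
      using increment_bounds[OF ab c1, of z f' L U] deriv LU by auto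
    have "(b - a) * L \<le> (b - a) * f' c" "(b - a) * f' c \<le> (b - a) * U"
      using LU[of c] c ab by (auto intro!: mult_left_mono)
    moreover have "(b - a) * (G b - G a) = (b - a) * U - (b - a) * L"
      unfolding G_def U_def L_def by (simp add: algebra_simps)
    ultimately show "\<bar>f b - f a - (b - a) * f' c\<bar> \<le> (b - a) * (G b - G a)"
      using inc by linarith
  qed
qed

text \<open>\<open>F w + r w * (1 - gPhi w)\<close> is minus the integral of \<open>r x - r w\<close> over the tail, which is
compared with the integral of \<open>x - w\<close>.\<close>

lemma tail_integral_bound:
  assumes d: "\<And>x. (F has_real_derivative r x * gphi x) (at x)" and l: "(F \<longlongrightarrow> 0) at_top"
    and lip: "\<And>x y. \<bar>r x - r y\<bar> \<le> \<bar>x - y\<bar>"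
  shows "\<bar>F w + r w * (1 - gPhi w)\<bar> \<le> gphi w - w * (1 - gPhi w)"
proof -
  have "0 \<le> gphi w - w * (1 - gPhi w) + s * (F w + r w * (1 - gPhi w))" if s: "s = 1 \<or> s = -1" for s :: real
  proof (rule antimono_limit_0_nonneg[where F = "\<lambda>t. gphi t - w * (1 - gPhi t) + s * (F t + r w * (1 - gPhi t))"])
    fix x assume x: "w \<le> x"
    let ?y = "(- x * gphi x) - w * (0 - gphi x) + s * (r x * gphi x + r w * (0 - gphi x))"
    have "((\<lambda>t. gphi t - w * (1 - gPhi t) + s * (F t + r w * (1 - gPhi t))) has_real_derivative ?y) (at x)"
      by (intro DERIV_add DERIV_diff DERIV_cmult DERIV_const gphi_has_derivative gPhi_has_derivative d)
    moreover have "?y = gphi x * (s * (r x - r w) - (x - w))" by (simp add: algebra_simps)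
    moreover have "s * (r x - r w) \<le> x - w" using lip[of x w] x s by auto
    then have "gphi x * (s * (r x - r w) - (x - w)) \<le> 0"
      using gphi_pos[of x] by (simp add: mult_le_0_iff)
    ultimately show "\<exists>y. ((\<lambda>t. gphi t - w * (1 - gPhi t) + s * (F t + r w * (1 - gPhi t))) has_real_derivative y) (at x) \<and> y \<le> 0"
      by (intro exI[of _ ?y] conjI) simp_all
  next
    have "((\<lambda>t. gphi t - w * (1 - gPhi t) + s * (F t + r w * (1 - gPhi t))) \<longlongrightarrow> 0 - w * (1 - 1) + s * (0 + r w * (1 - 1))) at_top"
      by (intro tendsto_intros gphi_tendsto_0 gPhi_lim l)
    then show "((\<lambda>t. gphi t - w * (1 - gPhi t) + s * (F t + r w * (1 - gPhi t))) \<longlongrightarrow> 0) at_top" by simp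
  qed
  from this[of 1] this[of "-1"] show ?thesis by auto
qed

lemma mills_le_2: "0 \<le> w \<Longrightarrow> mills w \<le> 2"
proof -
  assume w: "0 \<le> w"
  have "mills w \<le> mills 0"
  proof (rule DERIV_nonpos_imp_nonincreasing[OF w])
    show "\<exists>y. (mills has_real_derivative y) (at x) \<and> y \<le> 0" for x
      using mills_has_derivative[of x] mills_upper[of x] by (intro exI[of _ "x * mills x - 1"]) auto
  qed
  also have "mills 0 \<le> 2"
  proof -
    have "gPhi 0 = 1 / 2" using gPhi_minus[of 0] by simp
    then have "mills 0 = sqrt (2 * pi) / 2" by (simp add: mills_def std_normal_density_def)
    also have "\<dots> \<le> sqrt 16 / 2" using pi_less_4 by (intro divide_right_mono real_sqrt_le_mono) auto
    also have "sqrt 16 = sqrt (4\<^sup>2)" by simp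
    finally show ?thesis by (simp del: real_sqrt_pow2)
  qed
  finally show ?thesis .
qed

text \<open>Up to \<open>1 - w * mills w\<close>, the quotient equals \<open>- r w * mills w\<close>. Gordon's inequality bounds
\<open>1 - w * mills w\<close> by \<open>1 / (1 + w\<^sup>2)\<close>, enough to absorb the linear growth of \<open>r\<close> and a factor \<open>w\<close>.\<close>

lemma Stein_quotient_bounds:
  assumes d: "\<And>x. (F has_real_derivative r x * gphi x) (at x)" and l: "(F \<longlongrightarrow> 0) at_top"
    and lip: "\<And>x y. \<bar>r x - r y\<bar> \<le> \<bar>x - y\<bar>" and r: "\<bar>r w\<bar> \<le> w + 1" and w: "0 \<le> w"
  shows "\<bar>F w / gphi w\<bar> \<le> 3" "\<bar>w * (F w / gphi w) + r w\<bar> \<le> 2"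
proof -
  define f where "f = F w / gphi w"
  have "\<bar>F w + r w * (1 - gPhi w)\<bar> / gphi w \<le> (gphi w - w * (1 - gPhi w)) / gphi w"
    by (intro divide_right_mono tail_integral_bound[OF d l lip]) (simp add: less_imp_le)
  moreover have "\<bar>F w + r w * (1 - gPhi w)\<bar> / gphi w = \<bar>f + r w * mills w\<bar>"
  proof -
    have "f + r w * mills w = (F w + r w * (1 - gPhi w)) / gphi w"
      by (simp add: f_def mills_def add_divide_distrib)
    then show ?thesis using gphi_pos[of w] by (simp add: abs_divide)
  qed
  moreover have "(gphi w - w * (1 - gPhi w)) / gphi w = 1 - w * mills w"
    using gphi_pos[of w] by (simp add: mills_def field_simps)
  ultimately have b: "\<bar>f + r w * mills w\<bar> \<le> 1 - w * mills w" by simp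
  have m: "0 \<le> mills w" "mills w \<le> 2" using mills_nonneg mills_le_2 w by auto
  have "\<bar>r w * mills w\<bar> \<le> (w + 1) * mills w"
    using r m by (simp add: abs_mult mult_right_mono)
  then have "\<bar>f\<bar> \<le> 1 + mills w" using b by (simp add: algebra_simps)
  with m show "\<bar>F w / gphi w\<bar> \<le> 3" by (simp add: f_def)
  have u: "(1 - w * mills w) * (1 + w\<^sup>2) \<le> 1"
    using mult_left_mono[OF mills_lower[of w] w] by (simp add: algebra_simps power2_eq_square)
  have u0: "0 \<le> 1 - w * mills w" using mills_upper[of w] by simp
  have "w * f + r w = w * (f + r w * mills w) + r w * (1 - w * mills w)" by (simp add: algebra_simps)
  also have "\<bar>\<dots>\<bar> \<le> \<bar>w * (f + r w * mills w)\<bar> + \<bar>r w * (1 - w * mills w)\<bar>" by simp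
  also have "\<dots> \<le> w * (1 - w * mills w) + (w + 1) * (1 - w * mills w)"
    using b w r u0 by (intro add_mono) (auto simp: abs_mult intro!: mult_left_mono mult_right_mono)
  also have "\<dots> = (2 * w + 1) * (1 - w * mills w)" by (simp add: algebra_simps)
  also have "\<dots> \<le> (2 * (1 + w\<^sup>2)) * (1 - w * mills w)"
  proof (rule mult_right_mono[OF _ u0])
    have "(w - 1)\<^sup>2 + w\<^sup>2 \<ge> 0" by simp
    then show "2 * w + 1 \<le> 2 * (1 + w\<^sup>2)" by (simp add: power2_eq_square algebra_simps)
  qed
  also have "\<dots> \<le> 2" using u by (simp add: algebra_simps)
  finally show "\<bar>w * (F w / gphi w) + r w\<bar> \<le> 2" by (simp add: f_def)
qed

lemma Lipschitz_gphi_integrable: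
  assumes h: "1-lipschitz_on UNIV (h :: real \<Rightarrow> real)"
  shows "integrable lborel (\<lambda>x. h x * gphi x)"
    and "integrable std_normal_distribution h"
    and "(\<integral>x. h x \<partial>std_normal_distribution) = (\<integral>x. h x * gphi x \<partial>lborel)"
    and "\<bar>(\<integral>x. h x * gphi x \<partial>lborel) - h 0\<bar> \<le> 1"
proof -
  have hc: "continuous_on UNIV h" using h by (rule lipschitz_on_continuous_on)
  then have hm [measurable]: "h \<in> borel_measurable borel" by (rule borel_measurable_continuous_onI)
  have lip: "\<bar>h x - h y\<bar> \<le> \<bar>x - y\<bar>" for x y
    using lipschitz_onD[OF h, of x y] by (simp add: dist_real_def)
  have i1: "integrable lborel (\<lambda>x. gphi x * \<bar>x\<bar>)"
    using integrable_std_normal_moment_abs[of 1] by simp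
  have i2: "integrable lborel (\<lambda>x. (h x - h 0) * gphi x)"
  proof (rule Bochner_Integration.integrable_bound[OF i1])
    show "(\<lambda>x. (h x - h 0) * gphi x) \<in> borel_measurable lborel" by simp
    show "AE x in lborel. norm ((h x - h 0) * gphi x) \<le> norm (gphi x * \<bar>x\<bar>)"
    proof (rule AE_I2)
      fix x
      show "norm ((h x - h 0) * gphi x) \<le> norm (gphi x * \<bar>x\<bar>)"
        using mult_left_mono[OF lip[of x 0], of "gphi x"] gphi_pos[of x] by (simp add: abs_mult mult.commute)
    qed
  qed
  have i3: "integrable lborel (\<lambda>x. h 0 * gphi x)" using gphi_integrable by simp
  show i: "integrable lborel (\<lambda>x. h x * gphi x)"
    using Bochner_Integration.integrable_add[OF i2 i3] by (simp add: algebra_simps)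
  then show "integrable std_normal_distribution h"
    by (subst integrable_density) (auto simp: mult.commute)
  show "(\<integral>x. h x \<partial>std_normal_distribution) = (\<integral>x. h x * gphi x \<partial>lborel)"
    by (subst integral_density) (auto simp: mult.commute)
  have "(\<integral>x. h x * gphi x \<partial>lborel) - h 0 = (\<integral>x. h x * gphi x \<partial>lborel) - (\<integral>x. h 0 * gphi x \<partial>lborel)"
    by (simp add: integral_gphi)
  also have "\<dots> = (\<integral>x. (h x - h 0) * gphi x \<partial>lborel)"
    using i i3 by (subst Bochner_Integration.integral_diff[symmetric]) (auto simp: algebra_simps)
  also have "\<bar>\<dots>\<bar> \<le> (\<integral>x. norm ((h x - h 0) * gphi x) \<partial>lborel)"
    using integral_norm_bound[of lborel "\<lambda>x. (h x - h 0) * gphi x"] by simp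
  also have "\<dots> \<le> (\<integral>x. gphi x * \<bar>x\<bar> \<partial>lborel)"
  proof (rule integral_mono[OF integrable_norm[OF i2] i1])
    fix x
    show "norm ((h x - h 0) * gphi x) \<le> gphi x * \<bar>x\<bar>"
      using mult_left_mono[OF lip[of x 0], of "gphi x"] gphi_pos[of x] by (simp add: abs_mult mult.commute)
  qed
  also have "\<dots> = sqrt (2 / pi)" using integral_std_normal_moment_abs_odd[of 0] by simp
  also have "\<dots> \<le> 1" using pi_ge_two by simp
  finally show "\<bar>(\<integral>x. h x * gphi x \<partial>lborel) - h 0\<bar> \<le> 1" .
qed

text \<open>Here \<open>f\<close> and \<open>f'\<close> are bounded, and Stein's equation makes \<open>f'\<close> locally Lipschitz
with a constant of linear growth. This gives a majorant \<open>G\<close> of quadratic growth, so that only a fourth moment is needed later.\<close>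

lemma Stein_solution_Lipschitz:
  assumes h: "1-lipschitz_on UNIV (h :: real \<Rightarrow> real)"
  obtains f f' G where
    "\<And>w. f' w - w * f w = h w - (\<integral>x. h x \<partial>std_normal_distribution)"
    "controls_increments G f f'" "\<And>w. \<bar>f' w\<bar> \<le> 2" "\<And>w. \<bar>G w\<bar> \<le> 3 * (1 + w\<^sup>2)"
proof
  define c where "c = (\<integral>x. h x * gphi x \<partial>lborel)"
  define r where "r w = h w - c" for w
  define F where "F = below_integral (\<lambda>x. r x * gphi x)"
  define f where "f w = F w / gphi w" for w
  define f' where "f' w = w * f w + r w" for w
  \<comment> \<open>The derivative of x * f x is at most 3 + 2 * |x|, and r contributes slope 1.\<close>
  define G where "G w = 4 * w + w * \<bar>w\<bar>" for w :: real
  note hi = Lipschitz_gphi_integrable[OF h]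
  have hc: "continuous_on UNIV h" using h by (rule lipschitz_on_continuous_on)
  have lip: "\<bar>r x - r y\<bar> \<le> \<bar>x - y\<bar>" for x y
    using lipschitz_onD[OF h, of x y] by (simp add: dist_real_def r_def)
  have r: "\<bar>r w\<bar> \<le> \<bar>w\<bar> + 1" for w
    using lip[of w 0] hi(4) unfolding r_def c_def by linarith
  have ri: "integrable lborel (\<lambda>x. r x * gphi x)"
    using hi(1) gphi_integrable unfolding r_def by (simp add: left_diff_distrib)
  have "(\<integral>x. r x * gphi x \<partial>lborel) = (\<integral>x. h x * gphi x \<partial>lborel) - (\<integral>x. c * gphi x \<partial>lborel)"
    unfolding r_def using hi(1) gphi_integrable
    by (subst Bochner_Integration.integral_diff[symmetric]) (auto simp: left_diff_distrib)
  then have r0: "(\<integral>x. r x * gphi x \<partial>lborel) = 0" by (simp add: c_def integral_gphi)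
  have Fd: "(F has_real_derivative r x * gphi x) (at x)" for x
    unfolding F_def r_def
    by (rule below_integral_has_derivative[OF ri[unfolded r_def]])
      (intro continuous_intros hc continuous_on_gphi)
  have Ft: "(F \<longlongrightarrow> 0) at_top" using below_integral_at_top[OF ri] by (simp add: F_def r0)
  have Fb: "(F \<longlongrightarrow> 0) at_bot" using below_integral_at_bot[OF ri] by (simp add: F_def)
  have bounds: "\<bar>f w\<bar> \<le> 3 \<and> \<bar>f' w\<bar> \<le> 2" for w
  proof (cases "0 \<le> w")
    case True
    then show ?thesis using Stein_quotient_bounds[OF Fd Ft lip, of w] r[of w] by (simp add: f_def f'_def)
  next
    case False
    have d: "((\<lambda>x. - F (- x)) has_real_derivative r (- x) * gphi x) (at x)" for x
    proof -
      have "((\<lambda>x. F (- x)) has_real_derivative (r (- x) * gphi (- x)) * (- 1)) (at x)"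
        by (rule DERIV_chain2[OF Fd]) (auto intro!: derivative_eq_intros)
      from DERIV_minus[OF this] show ?thesis by simp
    qed
    have l: "((\<lambda>x. - F (- x)) \<longlongrightarrow> 0) at_top"
      using tendsto_minus[of "\<lambda>x. F (- x)" 0 at_top] Fb by (simp add: filterlim_at_bot_mirror)
    have lip': "\<bar>r (- x) - r (- y)\<bar> \<le> \<bar>x - y\<bar>" for x y using lip[of "-x" "-y"] by simp
    show ?thesis
      using Stein_quotient_bounds[OF d l lip', of "- w"] r[of w] False by (simp add: f_def f'_def)
  qed
  show "f' w - w * f w = h w - (\<integral>x. h x \<partial>std_normal_distribution)" for w
    by (simp add: f'_def r_def c_def hi(3))
  show "\<bar>f' w\<bar> \<le> 2" for w using bounds by blast
  show "\<bar>G w\<bar> \<le> 3 * (1 + w\<^sup>2)" for w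
  proof -
    have "\<bar>G w\<bar> \<le> 4 * \<bar>w\<bar> + \<bar>w\<bar> * \<bar>w\<bar>" unfolding G_def by (simp add: abs_mult abs_triangle_ineq[THEN order_trans])
    also have "\<dots> \<le> 3 * (1 + \<bar>w\<bar>\<^sup>2)"
      using zero_le_power2[of "\<bar>w\<bar> - 1"] unfolding power2_eq_square by (simp add: algebra_simps del: abs_mult_self_eq)
    finally show ?thesis by simp
  qed
  have fd: "(f has_real_derivative f' x) (at x)" for x
  proof -
    have "(f has_real_derivative (r x * gphi x * gphi x - F x * (- x * gphi x)) / (gphi x * gphi x)) (at x)"
      unfolding f_def[abs_def] by (rule DERIV_divide[OF Fd gphi_has_derivative]) (use gphi_pos[of x] in simp)
    moreover have "(r x * gphi x * gphi x - F x * (- x * gphi x)) / (gphi x * gphi x) = f' x"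
      using gphi_pos[of x] by (simp add: f'_def f_def field_simps)
    ultimately show ?thesis by simp
  qed
  have fc: "continuous_on A f" for A
    by (rule DERIV_continuous_on[OF has_field_derivative_at_within[OF fd]])
  have f'G: "\<bar>f' t - f' s\<bar> \<le> G t - G s" if "s \<le> t" for s t
  proof -
    have "3 * s + s * \<bar>s\<bar> + e * (s * f s) \<le> 3 * t + t * \<bar>t\<bar> + e * (t * f t)" if e: "e = 1 \<or> e = -1" for e
    proof (rule nondecreasing_except[OF \<open>s \<le> t\<close>, where z = 0 and f = "\<lambda>x. 3 * x + x * \<bar>x\<bar> + e * (x * f x)"])
      show "continuous_on {s..t} (\<lambda>x. 3 * x + x * \<bar>x\<bar> + e * (x * f x))"
        by (intro continuous_intros fc)
    next
      fix u :: real assume "u \<noteq> 0"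
      have "((\<lambda>x. x * \<bar>x\<bar>) has_real_derivative 2 * \<bar>u\<bar>) (at u)"
      proof (cases "u > 0")
        case True
        have "((\<lambda>x. x * x) has_real_derivative 2 * \<bar>u\<bar>) (at u)"
          using True by (auto intro!: derivative_eq_intros)
        then show ?thesis
          by (rule has_field_derivative_transform_within_open[where S = "{0<..}"]) (use True in auto)
      next
        case False
        have "((\<lambda>x. - (x * x)) has_real_derivative 2 * \<bar>u\<bar>) (at u)"
          using False by (auto intro!: derivative_eq_intros)
        then show ?thesis
          by (rule has_field_derivative_transform_within_open[where S = "{..<0}"]) (use False \<open>u \<noteq> 0\<close> in auto)
      qed
      moreover have "((\<lambda>x. 3 * x + e * (x * f x)) has_real_derivative 3 + e * (f u + u * f' u)) (at u)"
        by (auto intro!: derivative_eq_intros fd)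
      ultimately have "((\<lambda>x. x * \<bar>x\<bar> + (3 * x + e * (x * f x))) has_real_derivative 2 * \<bar>u\<bar> + (3 + e * (f u + u * f' u))) (at u)"
        by (rule DERIV_add)
      then have "((\<lambda>x. 3 * x + x * \<bar>x\<bar> + e * (x * f x)) has_real_derivative 3 + 2 * \<bar>u\<bar> + e * (f u + u * f' u)) (at u)"
        by (simp add: ac_simps)
      moreover have "\<bar>u * f' u\<bar> \<le> 2 * \<bar>u\<bar>"
        using mult_left_mono[of "\<bar>f' u\<bar>" 2 "\<bar>u\<bar>"] bounds[of u] by (simp add: abs_mult)
      then have "0 \<le> 3 + 2 * \<bar>u\<bar> + e * (f u + u * f' u)"
        using bounds[of u] e by auto
      ultimately show "\<exists>y. ((\<lambda>x. 3 * x + x * \<bar>x\<bar> + e * (x * f x)) has_real_derivative y) (at u) \<and> 0 \<le> y"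
        by blast
    qed
    from this[of 1] this[of "-1"] lip[of s t] that show ?thesis
      unfolding f'_def G_def by auto
  qed
  show "controls_increments G f f'"
    unfolding controls_increments_def
  proof (intro allI ballI impI)
    fix a b c :: real assume c: "c \<in> {a, b}" and ab: "a \<le> b"
    have LU: "f' c - (G b - G a) \<le> f' u \<and> f' u \<le> f' c + (G b - G a)" if "a < u" "u < b" for u
      using f'G[of a u] f'G[of u b] that c by auto
    have "(b - a) * (f' c - (G b - G a)) \<le> f b - f a" "f b - f a \<le> (b - a) * (f' c + (G b - G a))"
      using increment_bounds[OF ab fc fd LU] by auto
    then show "\<bar>f b - f a - (b - a) * f' c\<bar> \<le> (b - a) * (G b - G a)"
      unfolding abs_le_iff by (simp add: algebra_simps)
  qed
qed

section \<open>Independent Bernoulli variables\<close>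

text \<open>Expectation with respect to a random subset of the finite set \<open>S\<close> that contains each element independently with probability \<open>p\<close>.\<close>

definition bexp :: "'s set \<Rightarrow> real \<Rightarrow> ('s set \<Rightarrow> real) \<Rightarrow> real" where
  "bexp S p \<phi> = (\<Sum>\<omega>\<in>Pow S. p ^ card \<omega> * (1 - p) ^ card (S - \<omega>) * \<phi> \<omega>)"

definition incl :: "'s set \<Rightarrow> 's set \<Rightarrow> real" where
  "incl A \<omega> = of_bool (A \<subseteq> \<omega>)"

lemma incl_mult: "incl A \<omega> * incl B \<omega> = incl (A \<union> B) \<omega>"
  by (auto simp: incl_def)

lemma incl_nonneg [simp]: "0 \<le> incl A \<omega>"
  by (simp add: incl_def)

lemma bexp_insert:
  assumes "finite S" "i \<notin> S"
  shows "bexp (insert i S) p \<phi> = p * bexp S p (\<lambda>\<omega>. \<phi> (insert i \<omega>)) + (1 - p) * bexp S p \<phi>"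
proof -
  let ?f = "\<lambda>\<omega>. p ^ card \<omega> * (1 - p) ^ card (insert i S - \<omega>) * \<phi> \<omega>"
  have inj: "inj_on (insert i) (Pow S)"
    using assms(2) by (auto simp: inj_on_def)
  have "bexp (insert i S) p \<phi> = sum ?f (Pow S) + sum ?f (insert i ` Pow S)"
    unfolding bexp_def Pow_insert using assms
    by (subst sum.union_disjoint) auto
  also have "sum ?f (insert i ` Pow S) = p * bexp S p (\<lambda>\<omega>. \<phi> (insert i \<omega>))"
    unfolding bexp_def sum.reindex[OF inj] sum_distrib_left o_def
  proof (rule sum.cong)
    fix \<omega> assume w: "\<omega> \<in> Pow S"
    then have "i \<notin> \<omega>" "finite \<omega>" using assms by (auto intro: finite_subset)
    moreover have "insert i S - insert i \<omega> = S - \<omega>" using assms(2) by auto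
    ultimately show "p ^ card (insert i \<omega>) * (1 - p) ^ card (insert i S - insert i \<omega>) * \<phi> (insert i \<omega>) =
        p * (p ^ card \<omega> * (1 - p) ^ card (S - \<omega>) * \<phi> (insert i \<omega>))"
      by simp
  qed simp
  also have "sum ?f (Pow S) = (1 - p) * bexp S p \<phi>"
    unfolding bexp_def sum_distrib_left
  proof (rule sum.cong)
    fix \<omega> assume w: "\<omega> \<in> Pow S"
    have "insert i S - \<omega> = insert i (S - \<omega>)" using w assms(2) by auto
    then show "p ^ card \<omega> * (1 - p) ^ card (insert i S - \<omega>) * \<phi> \<omega> =
        (1 - p) * (p ^ card \<omega> * (1 - p) ^ card (S - \<omega>) * \<phi> \<omega>)"
      using assms by simp
  qed simp
  finally show ?thesis by simp
qed

lemma bexp_add: "bexp S p (\<lambda>\<omega>. f \<omega> + g \<omega>) = bexp S p f + bexp S p g"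
  by (simp add: bexp_def algebra_simps sum.distrib)

lemma bexp_cmult: "bexp S p (\<lambda>\<omega>. c * f \<omega>) = c * bexp S p f"
  by (simp add: bexp_def sum_distrib_left mult.left_commute)

lemma bexp_diff: "bexp S p (\<lambda>\<omega>. f \<omega> - g \<omega>) = bexp S p f - bexp S p g"
  by (simp add: bexp_def algebra_simps sum_subtractf)

lemma bexp_sum: "bexp S p (\<lambda>\<omega>. \<Sum>a\<in>I. f a \<omega>) = (\<Sum>a\<in>I. bexp S p (f a))"
  unfolding bexp_def by (subst sum.swap) (simp add: sum_distrib_left)

lemma bexp_cong: "(\<And>\<omega>. \<omega> \<subseteq> S \<Longrightarrow> f \<omega> = g \<omega>) \<Longrightarrow> bexp S p f = bexp S p g"
  unfolding bexp_def by (intro sum.cong) auto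

lemma bexp_mono:
  "0 \<le> p \<Longrightarrow> p \<le> 1 \<Longrightarrow> (\<And>\<omega>. \<omega> \<subseteq> S \<Longrightarrow> f \<omega> \<le> g \<omega>) \<Longrightarrow> bexp S p f \<le> bexp S p g"
  unfolding bexp_def by (intro sum_mono mult_left_mono) auto

lemma bexp_nonneg:
  "0 \<le> p \<Longrightarrow> p \<le> 1 \<Longrightarrow> (\<And>\<omega>. \<omega> \<subseteq> S \<Longrightarrow> 0 \<le> f \<omega>) \<Longrightarrow> 0 \<le> bexp S p f"
  unfolding bexp_def by (intro sum_nonneg mult_nonneg_nonneg) auto

lemma bexp_abs: "0 \<le> p \<Longrightarrow> p \<le> 1 \<Longrightarrow> \<bar>bexp S p f\<bar> \<le> bexp S p (\<lambda>\<omega>. \<bar>f \<omega>\<bar>)"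
  unfolding bexp_def by (rule order_trans[OF sum_abs]) (simp add: abs_mult)

lemma bexp_incl:
  assumes "finite S" "A \<subseteq> S"
  shows "bexp S p (incl A) = p ^ card A"
  using assms
proof (induction S arbitrary: A rule: finite_induct)
  case empty
  then show ?case by (simp add: bexp_def incl_def)
next
  case (insert i S)
  show ?case
  proof (cases "i \<in> A")
    case True
    have "bexp S p (\<lambda>\<omega>. incl A (insert i \<omega>)) = bexp S p (incl (A - {i}))"
      by (intro bexp_cong) (auto simp: incl_def)
    moreover have "bexp S p (incl A) = bexp S p (\<lambda>\<omega>. 0 * incl A \<omega>)"
      using True insert.hyps by (intro bexp_cong) (auto simp: incl_def)
    then have "bexp S p (incl A) = 0" unfolding bexp_cmult by simp
    moreover have "finite A" using insert.prems insert.hyps by (auto intro: finite_subset)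
    then have "p * p ^ card (A - {i}) = p ^ card A"
      using card.remove[OF _ True] by simp
    moreover have "A - {i} \<subseteq> S" using insert.prems by auto
    ultimately show ?thesis
      using bexp_insert[OF insert.hyps(1,2), of p "incl A"] insert.IH[of "A - {i}"] by (simp add: bexp_cmult)
  next
    case False
    have "bexp S p (\<lambda>\<omega>. incl A (insert i \<omega>)) = bexp S p (incl A)"
      using False by (intro bexp_cong) (auto simp: incl_def)
    moreover have "A \<subseteq> S" using insert.prems False by auto
    ultimately show ?thesis
      using insert.hyps insert.IH[of A] by (simp add: bexp_insert algebra_simps)
  qed
qed

lemma bexp_const: "finite S \<Longrightarrow> bexp S p (\<lambda>\<omega>. c) = c"
  using bexp_incl[of S "{}" p] bexp_cmult[of S p c "incl {}"] by (simp add: incl_def)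

text \<open>Conditionally on the other elements, the centred indicator of \<open>i\<close> has covariance \<open>p * (1 - p)\<close> times the increment with any function.\<close>

lemma bexp_integration_by_parts:
  assumes "finite S" "i \<in> S"
  shows "bexp S p (\<lambda>\<omega>. (incl {i} \<omega> - p) * \<phi> \<omega>) = p * (1 - p) * bexp S p (\<lambda>\<omega>. \<phi> (insert i \<omega>) - \<phi> (\<omega> - {i}))"
proof -
  define S' where "S' = S - {i}"
  have S: "S = insert i S'" "i \<notin> S'" "finite S'" using assms by (auto simp: S'_def)
  have a: "bexp S' p (\<lambda>\<omega>. (incl {i} (insert i \<omega>) - p) * \<phi> (insert i \<omega>)) = (1 - p) * bexp S' p (\<lambda>\<omega>. \<phi> (insert i \<omega>))"
    unfolding bexp_cmult[symmetric] by (simp add: incl_def)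
  have b: "bexp S' p (\<lambda>\<omega>. (incl {i} \<omega> - p) * \<phi> \<omega>) = - p * bexp S' p \<phi>"
    unfolding bexp_cmult[symmetric] using S by (intro bexp_cong) (auto simp: incl_def)
  have c: "bexp S' p (\<lambda>\<omega>. \<phi> (insert i \<omega>) - \<phi> (\<omega> - {i})) = bexp S' p (\<lambda>\<omega>. \<phi> (insert i \<omega>)) - bexp S' p \<phi>"
    unfolding bexp_diff[symmetric] using S(2) by (intro bexp_cong) (metis Diff_empty Diff_insert0 subsetD)
  have d: "bexp S' p (\<lambda>\<omega>. \<phi> (insert i (insert i \<omega>)) - \<phi> (insert i \<omega> - {i})) = bexp S' p (\<lambda>\<omega>. \<phi> (insert i \<omega>)) - bexp S' p \<phi>"
    unfolding bexp_diff[symmetric] using S(2) by (intro bexp_cong) (simp add: subset_iff, metis Diff_empty Diff_insert0)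
  show ?thesis
    unfolding S(1) bexp_insert[OF S(3,2)] a b c d by (simp add: algebra_simps)
qed

lemma bexp_Cauchy_Schwarz:
  assumes "0 \<le> p" "p \<le> 1"
  shows "(bexp S p (\<lambda>\<omega>. f \<omega> * g \<omega>))\<^sup>2 \<le> bexp S p (\<lambda>\<omega>. (f \<omega>)\<^sup>2) * bexp S p (\<lambda>\<omega>. (g \<omega>)\<^sup>2)"
proof -
  let ?w = "\<lambda>\<omega>. p ^ card \<omega> * (1 - p) ^ card (S - \<omega>)"
  have w: "sqrt (?w \<omega>) * sqrt (?w \<omega>) = ?w \<omega>" for \<omega> using assms by simp
  have "(\<Sum>\<omega>\<in>Pow S. (sqrt (?w \<omega>) * f \<omega>) * (sqrt (?w \<omega>) * g \<omega>))\<^sup>2 \<le>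
    (\<Sum>\<omega>\<in>Pow S. (sqrt (?w \<omega>) * f \<omega>)\<^sup>2) * (\<Sum>\<omega>\<in>Pow S. (sqrt (?w \<omega>) * g \<omega>)\<^sup>2)"
    by (rule Cauchy_Schwarz_ineq_sum)
  moreover have "(sqrt (?w \<omega>) * f \<omega>) * (sqrt (?w \<omega>) * g \<omega>) = ?w \<omega> * (f \<omega> * g \<omega>)" for \<omega>
  proof -
    have "(sqrt (?w \<omega>) * f \<omega>) * (sqrt (?w \<omega>) * g \<omega>) = (sqrt (?w \<omega>) * sqrt (?w \<omega>)) * (f \<omega> * g \<omega>)"
      by (simp only: ac_simps)
    then show ?thesis by (simp only: w)
  qed
  moreover have "(sqrt (?w \<omega>) * f \<omega>)\<^sup>2 = ?w \<omega> * (f \<omega>)\<^sup>2" for f :: "_ \<Rightarrow> real" and \<omega>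
  proof -
    have "(sqrt (?w \<omega>) * f \<omega>)\<^sup>2 = (sqrt (?w \<omega>) * sqrt (?w \<omega>)) * (f \<omega>)\<^sup>2"
      by (simp only: power2_eq_square ac_simps)
    then show ?thesis by (simp only: w)
  qed
  ultimately show ?thesis by (simp only: bexp_def)
qed

lemma bexp_abs_mult_le:
  assumes "0 \<le> p" "p \<le> 1"
  shows "bexp S p (\<lambda>\<omega>. \<bar>f \<omega> * g \<omega>\<bar>) \<le> sqrt (bexp S p (\<lambda>\<omega>. (f \<omega>)\<^sup>2)) * sqrt (bexp S p (\<lambda>\<omega>. (g \<omega>)\<^sup>2))"
  using real_le_rsqrt[OF bexp_Cauchy_Schwarz[OF assms, where f = "\<lambda>\<omega>. \<bar>f \<omega>\<bar>" and g = "\<lambda>\<omega>. \<bar>g \<omega>\<bar>"]]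
  by (simp add: abs_mult real_sqrt_mult)

text \<open>Replace the factors of the product \<open>incl A\<close> by their mean \<open>p\<close> one after the other; \<open>P i\<close> is the set of the elements that come before
\<open>i\<close> in this process. The order is chosen for each \<open>A\<close> separately.\<close>

lemma telescoping_exists:
  assumes "finite A"
  shows "\<exists>P. (\<forall>i\<in>A. P i \<subseteq> A - {i}) \<and>
    (\<forall>p \<omega>. incl A \<omega> - p ^ card A = (\<Sum>i\<in>A. (incl {i} \<omega> - p) * (p ^ card (A - {i} - P i) * incl (P i) \<omega>)))"
  using assms
proof (induction A rule: finite_induct)
  case empty
  then show ?case by (simp add: incl_def)
next
  case (insert a A)
  then obtain P where P: "\<And>i. i \<in> A \<Longrightarrow> P i \<subseteq> A - {i}"
    and eq: "\<And>p \<omega>. incl A \<omega> - p ^ card A = (\<Sum>i\<in>A. (incl {i} \<omega> - p) * (p ^ card (A - {i} - P i) * incl (P i) \<omega>))"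
    by blast
  let ?P = "P(a := A)"
  show ?case
  proof (intro exI[of _ ?P] conjI allI ballI)
    show "?P i \<subseteq> insert a A - {i}" if "i \<in> insert a A" for i
      using P[of i] that insert.hyps by auto
  next
    fix p \<omega>
    have c: "card (insert a A - {i} - ?P i) = Suc (card (A - {i} - P i))" if "i \<in> A" for i
    proof -
      have "insert a A - {i} - ?P i = insert a (A - {i} - P i)"
        using P[of i] that insert.hyps by auto
      then show ?thesis using insert.hyps by simp
    qed
    have "(\<Sum>i\<in>insert a A. (incl {i} \<omega> - p) * (p ^ card (insert a A - {i} - ?P i) * incl (?P i) \<omega>)) =
      (incl {a} \<omega> - p) * incl A \<omega> + (\<Sum>i\<in>A. (incl {i} \<omega> - p) * (p ^ card (insert a A - {i} - ?P i) * incl (?P i) \<omega>))"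
    proof -
      have "insert a A - {a} - ?P a = {}" by auto
      then show ?thesis using insert.hyps by (subst sum.insert) auto
    qed
    also have "(\<Sum>i\<in>A. (incl {i} \<omega> - p) * (p ^ card (insert a A - {i} - ?P i) * incl (?P i) \<omega>)) =
      (\<Sum>i\<in>A. p * ((incl {i} \<omega> - p) * (p ^ card (A - {i} - P i) * incl (P i) \<omega>)))"
    proof (rule sum.cong)
      fix i assume i: "i \<in> A"
      with insert.hyps have "?P i = P i" by auto
      then show "(incl {i} \<omega> - p) * (p ^ card (insert a A - {i} - ?P i) * incl (?P i) \<omega>) =
          p * ((incl {i} \<omega> - p) * (p ^ card (A - {i} - P i) * incl (P i) \<omega>))"
        unfolding c[OF i] by simp
    qed simp
    also have "\<dots> = p * (incl A \<omega> - p ^ card A)"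
      by (simp add: sum_distrib_left[symmetric] eq)
    also have "(incl {a} \<omega> - p) * incl A \<omega> + p * (incl A \<omega> - p ^ card A) = incl (insert a A) \<omega> - p ^ card (insert a A)"
      using insert.hyps by (auto simp: incl_def algebra_simps)
    finally show "incl (insert a A) \<omega> - p ^ card (insert a A) =
      (\<Sum>i\<in>insert a A. (incl {i} \<omega> - p) * (p ^ card (insert a A - {i} - ?P i) * incl (?P i) \<omega>))" by simp
  qed
qed

definition earlier :: "'s set \<Rightarrow> 's \<Rightarrow> 's set" where
  "earlier A = (SOME P. (\<forall>i\<in>A. P i \<subseteq> A - {i}) \<and>
    (\<forall>p \<omega>. incl A \<omega> - p ^ card A = (\<Sum>i\<in>A. (incl {i} \<omega> - p) * (p ^ card (A - {i} - P i) * incl (P i) \<omega>))))"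

lemma earlier:
  assumes "finite A"
  shows "i \<in> A \<Longrightarrow> earlier A i \<subseteq> A - {i}"
    and "incl A \<omega> - p ^ card A = (\<Sum>i\<in>A. (incl {i} \<omega> - p) * (p ^ card (A - {i} - earlier A i) * incl (earlier A i) \<omega>))"
  using someI_ex[OF telescoping_exists[OF assms], folded earlier_def] by blast+

text \<open>No partition of the four sets into two nonempty groups has disjoint unions: the first four clauses exclude the partitions into one set and three
sets, the others those into two pairs.\<close>

definition linked :: "'s set \<Rightarrow> 's set \<Rightarrow> 's set \<Rightarrow> 's set \<Rightarrow> bool" where
  "linked A B C D \<longleftrightarrow>
     A \<inter> (B \<union> C \<union> D) \<noteq> {} \<and> B \<inter> (A \<union> C \<union> D) \<noteq> {} \<and> C \<inter> (A \<union> B \<union> D) \<noteq> {} \<and> D \<inter> (A \<union> B \<union> C) \<noteq> {} \<and>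
     (A \<union> B) \<inter> (C \<union> D) \<noteq> {} \<and> (A \<union> C) \<inter> (B \<union> D) \<noteq> {} \<and> (A \<union> D) \<inter> (B \<union> C) \<noteq> {}"

section \<open>Stein's method for sums of products of Bernoulli variables\<close>

text \<open>For the copies of a hypergraph, \<open>K\<close> is the set of all copies and \<open>E k\<close> the edge set of the copy \<open>k\<close>. Copies that differ only in
isolated vertices have the same edge set, hence the sum is indexed by \<open>K\<close> and not by the sets themselves.\<close>

locale indicator_sum =
  fixes S :: "'s set" and p :: real and K :: "'k set" and E :: "'k \<Rightarrow> 's set" and e :: nat
  assumes finite_S: "finite S" and p_pos: "0 < p" and p_less_1: "p < 1"
    and finite_K: "finite K" and E_subset: "k \<in> K \<Longrightarrow> E k \<subseteq> S" and card_E: "k \<in> K \<Longrightarrow> card (E k) = e"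
begin

lemma p_bounds: "0 \<le> p" "p \<le> 1" "0 \<le> 1 - p" using p_pos p_less_1 by auto

lemma finite_E: "k \<in> K \<Longrightarrow> finite (E k)"
  using E_subset finite_S finite_subset by blast

abbreviation Ex where "Ex \<equiv> bexp S p"

definition N where "N \<omega> = (\<Sum>k\<in>K. incl (E k) \<omega>)"

definition mu where "mu = real (card K) * p ^ e"

text \<open>The variance of \<open>N\<close>.\<close>

definition s2 where "s2 = Ex (\<lambda>\<omega>. (N \<omega> - mu)\<^sup>2)"

lemma Ex_N: "Ex N = mu"
  unfolding N_def[abs_def] bexp_sum mu_def
  using bexp_incl[OF finite_S E_subset] card_E by simp

text \<open>\<open>N - mu\<close> is the sum of \<open>(incl {i} \<omega> - p) * g i \<omega>\<close> by telescoping each term of \<open>N\<close>. Any such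
representation leads to a Stein identity; this one has nonnegative coefficients \<open>g i\<close> that do not depend on \<open>i \<in> \<omega>\<close>.\<close>

definition g where
  "g i \<omega> = (\<Sum>k\<in>K. of_bool (i \<in> E k) * (p ^ card (E k - {i} - earlier (E k) i) * incl (earlier (E k) i) \<omega>))"

text \<open>The increment of \<open>N\<close> in direction \<open>i\<close>.\<close>

definition d where
  "d i \<omega> = (\<Sum>k\<in>K. of_bool (i \<in> E k) * incl (E k - {i}) \<omega>)"

lemma g_nonneg: "0 \<le> g i \<omega>"
  unfolding g_def using p_bounds by (intro sum_nonneg) auto

lemma d_nonneg: "0 \<le> d i \<omega>"
  unfolding d_def by (intro sum_nonneg) auto

lemma g_insert: "g i (insert i \<omega>) = g i \<omega>" and g_remove: "g i (\<omega> - {i}) = g i \<omega>"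
proof -
  have *: "i \<notin> earlier (E k) i" if "k \<in> K" "i \<in> E k" for k
    using earlier(1)[OF finite_E[OF that(1)] that(2)] by auto
  show "g i (insert i \<omega>) = g i \<omega>" "g i (\<omega> - {i}) = g i \<omega>"
    unfolding g_def using * by (intro sum.cong refl; force simp: incl_def)+
qed

lemma d_insert: "d i (insert i \<omega>) = d i \<omega>" and d_remove: "d i (\<omega> - {i}) = d i \<omega>"
  unfolding d_def by (intro sum.cong refl; auto simp: incl_def)+

lemma N_increment: "N (insert i \<omega>) - N (\<omega> - {i}) = d i \<omega>"
  unfolding N_def d_def sum_subtractf[symmetric]
  by (intro sum.cong refl) (auto simp: incl_def)

lemma N_centred: "N \<omega> - mu = (\<Sum>i\<in>S. (incl {i} \<omega> - p) * g i \<omega>)"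
proof -
  have "(\<Sum>i\<in>S. (incl {i} \<omega> - p) * g i \<omega>) =
    (\<Sum>k\<in>K. \<Sum>i\<in>S. of_bool (i \<in> E k) * ((incl {i} \<omega> - p) * (p ^ card (E k - {i} - earlier (E k) i) * incl (earlier (E k) i) \<omega>)))"
    unfolding g_def sum_distrib_left by (subst sum.swap) (simp add: algebra_simps)
  also have "\<dots> = (\<Sum>k\<in>K. incl (E k) \<omega> - p ^ card (E k))"
  proof (rule sum.cong)
    fix k assume k: "k \<in> K"
    have "(\<Sum>i\<in>S. of_bool (i \<in> E k) * ((incl {i} \<omega> - p) * (p ^ card (E k - {i} - earlier (E k) i) * incl (earlier (E k) i) \<omega>)))
      = (\<Sum>i\<in>E k. ((incl {i} \<omega> - p) * (p ^ card (E k - {i} - earlier (E k) i) * incl (earlier (E k) i) \<omega>)))"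
      using E_subset[OF k] finite_S by (intro sum.mono_neutral_cong_right) auto
    then show "(\<Sum>i\<in>S. of_bool (i \<in> E k) * ((incl {i} \<omega> - p) * (p ^ card (E k - {i} - earlier (E k) i) * incl (earlier (E k) i) \<omega>)))
      = incl (E k) \<omega> - p ^ card (E k)"
      using earlier(2)[OF finite_E[OF k]] by simp
  qed simp
  also have "\<dots> = N \<omega> - mu"
    unfolding N_def mu_def by (simp add: sum_subtractf card_E)
  finally show ?thesis by simp
qed

lemma Stein_identity:
  "Ex (\<lambda>\<omega>. (N \<omega> - mu) * \<phi> \<omega>) = p * (1 - p) * (\<Sum>i\<in>S. Ex (\<lambda>\<omega>. g i \<omega> * (\<phi> (insert i \<omega>) - \<phi> (\<omega> - {i}))))"
proof -
  have "Ex (\<lambda>\<omega>. (N \<omega> - mu) * \<phi> \<omega>) = (\<Sum>i\<in>S. Ex (\<lambda>\<omega>. (incl {i} \<omega> - p) * (g i \<omega> * \<phi> \<omega>)))"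
    unfolding N_centred sum_distrib_right bexp_sum by (simp add: mult.assoc)
  also have "\<dots> = (\<Sum>i\<in>S. p * (1 - p) * Ex (\<lambda>\<omega>. g i \<omega> * (\<phi> (insert i \<omega>) - \<phi> (\<omega> - {i}))))"
    by (intro sum.cong refl)
      (simp add: bexp_integration_by_parts[OF finite_S] g_insert g_remove right_diff_distrib)
  finally show ?thesis by (simp add: sum_distrib_left)
qed

text \<open>\<open>V\<close> plays the part of a random variance with mean \<open>s2\<close>; \<open>T\<close> is its centred counterpart, which arises when the remainder is integrated back by parts.\<close>

definition V where "V \<omega> = p * (1 - p) * (\<Sum>i\<in>S. g i \<omega> * d i \<omega>)"

definition T where "T \<omega> = (\<Sum>i\<in>S. (incl {i} \<omega> - p) * (g i \<omega> * d i \<omega>))"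

lemma Ex_V: "Ex V = s2"
proof -
  have "s2 = Ex (\<lambda>\<omega>. (N \<omega> - mu) * (N \<omega> - mu))" by (simp add: s2_def power2_eq_square)
  also have "\<dots> = p * (1 - p) * (\<Sum>i\<in>S. Ex (\<lambda>\<omega>. g i \<omega> * d i \<omega>))"
    unfolding Stein_identity by (simp add: N_increment)
  finally show ?thesis
    unfolding V_def[abs_def] bexp_cmult bexp_sum by simp
qed

text \<open>Monotonicity does the work: the linearisation error of \<open>f\<close> in direction \<open>i\<close> is at most \<open>d i\<close> times the
increment of \<open>G\<close>, and as the weights \<open>g i * d i\<close> are nonnegative and do not depend on \<open>i \<in> \<omega>\<close>, integration by parts turns the weighted sum of these increments
into the expectation of \<open>T * G W\<close> exactly.\<close>

lemma Stein_bound: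
  assumes s: "s2 > 0" and ctrl: "controls_increments G f f'"
  defines "W \<equiv> \<lambda>\<omega>. (N \<omega> - mu) / sqrt s2"
  shows "\<bar>Ex (\<lambda>\<omega>. f' (W \<omega>) - W \<omega> * f (W \<omega>))\<bar> \<le>
    (Ex (\<lambda>\<omega>. \<bar>f' (W \<omega>) * (V \<omega> - s2)\<bar>) + Ex (\<lambda>\<omega>. T \<omega> * G (W \<omega>))) / s2"
proof -
  define \<sigma> where "\<sigma> = sqrt s2"
  have \<sigma>: "\<sigma> > 0" "\<sigma> * \<sigma> = s2" using s by (auto simp: \<sigma>_def)
  define pq where "pq = p * (1 - p)"
  have pq: "pq \<ge> 0" using p_bounds by (simp add: pq_def)
  have W_inc: "W (insert i \<omega>) - W (\<omega> - {i}) = d i \<omega> / \<sigma>" for i \<omega>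
    using N_increment[of i \<omega>] by (simp add: W_def \<sigma>_def diff_divide_distrib[symmetric])
  \<comment> \<open>One of the two end points of the increment is the current value, where the slope is taken.\<close>
  have Wcase: "W \<omega> \<in> {W (\<omega> - {i}), W (insert i \<omega>)}" for \<omega> i
    by (cases "i \<in> \<omega>") (auto simp: insert_absorb)
  have inc: "\<bar>f (W (insert i \<omega>)) - f (W (\<omega> - {i})) - d i \<omega> / \<sigma> * f' (W \<omega>)\<bar>
      \<le> d i \<omega> / \<sigma> * (G (W (insert i \<omega>)) - G (W (\<omega> - {i})))" for i \<omega>
  proof -
    have "W (\<omega> - {i}) \<le> W (insert i \<omega>)"
      using W_inc[of i \<omega>] divide_nonneg_pos[OF d_nonneg[of i \<omega>] \<sigma>(1)] by linarith
    then show ?thesis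
      using ctrl[unfolded controls_increments_def, rule_format, OF Wcase[of \<omega> i]] by (simp only: W_inc)
  qed
  have pt: "\<bar>g i \<omega> * (f (W (insert i \<omega>)) - f (W (\<omega> - {i})) - d i \<omega> / \<sigma> * f' (W \<omega>))\<bar>
          \<le> g i \<omega> * (d i \<omega> / \<sigma> * (G (W (insert i \<omega>)) - G (W (\<omega> - {i}))))" for i \<omega>
    using mult_left_mono[OF inc[of i \<omega>] g_nonneg[of i \<omega>]] abs_of_nonneg[OF g_nonneg[of i \<omega>]]
    by (simp only: abs_mult)
  have 1: "Ex (\<lambda>\<omega>. W \<omega> * f (W \<omega>)) = pq / \<sigma> * (\<Sum>i\<in>S. Ex (\<lambda>\<omega>. g i \<omega> * (f (W (insert i \<omega>)) - f (W (\<omega> - {i})))))"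
  proof -
    have "Ex (\<lambda>\<omega>. W \<omega> * f (W \<omega>)) = Ex (\<lambda>\<omega>. (1 / \<sigma>) * ((N \<omega> - mu) * f (W \<omega>)))"
      by (simp add: W_def \<sigma>_def)
    then show ?thesis unfolding bexp_cmult Stein_identity pq_def by simp
  qed
  have 2: "Ex (\<lambda>\<omega>. V \<omega> / s2 * f' (W \<omega>)) = pq / \<sigma> * (\<Sum>i\<in>S. Ex (\<lambda>\<omega>. g i \<omega> * (d i \<omega> / \<sigma> * f' (W \<omega>))))"
  proof -
    have "V \<omega> / s2 * f' (W \<omega>) = pq / \<sigma> * (\<Sum>i\<in>S. g i \<omega> * (d i \<omega> / \<sigma> * f' (W \<omega>)))" for \<omega>
      unfolding V_def pq_def \<sigma>(2)[symmetric] sum_distrib_left sum_distrib_right sum_divide_distrib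
      by (simp add: mult_ac)
    then show ?thesis by (simp only: bexp_cmult bexp_sum)
  qed
  have 3: "Ex (\<lambda>\<omega>. T \<omega> * G (W \<omega>)) / s2 = pq / \<sigma> * (\<Sum>i\<in>S. Ex (\<lambda>\<omega>. g i \<omega> * (d i \<omega> / \<sigma> * (G (W (insert i \<omega>)) - G (W (\<omega> - {i}))))))"
  proof -
    have "Ex (\<lambda>\<omega>. T \<omega> * G (W \<omega>)) = (\<Sum>i\<in>S. Ex (\<lambda>\<omega>. (incl {i} \<omega> - p) * (g i \<omega> * d i \<omega> * G (W \<omega>))))"
      unfolding T_def sum_distrib_right bexp_sum by (simp add: mult_ac)
    also have "\<dots> = (\<Sum>i\<in>S. pq * Ex (\<lambda>\<omega>. \<sigma> * (g i \<omega> * (d i \<omega> / \<sigma> * (G (W (insert i \<omega>)) - G (W (\<omega> - {i})))))))"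
    proof (rule sum.cong)
      fix i
      have "\<sigma> * (g i \<omega> * (d i \<omega> / \<sigma> * (G (W (insert i \<omega>)) - G (W (\<omega> - {i}))))) =
          g i \<omega> * d i \<omega> * G (W (insert i \<omega>)) - g i \<omega> * d i \<omega> * G (W (\<omega> - {i}))" for \<omega>
        using \<sigma>(1) by (simp add: right_diff_distrib mult.assoc)
      moreover assume "i \<in> S"
      ultimately show "Ex (\<lambda>\<omega>. (incl {i} \<omega> - p) * (g i \<omega> * d i \<omega> * G (W \<omega>))) =
        pq * Ex (\<lambda>\<omega>. \<sigma> * (g i \<omega> * (d i \<omega> / \<sigma> * (G (W (insert i \<omega>)) - G (W (\<omega> - {i}))))))"
        by (simp only: bexp_integration_by_parts[OF finite_S] g_insert g_remove d_insert d_remove pq_def)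
    qed simp
    finally show ?thesis
      unfolding bexp_cmult sum_distrib_left[symmetric] \<sigma>(2)[symmetric] using \<sigma>(1) by simp
  qed
  have 4: "\<bar>Ex (\<lambda>\<omega>. W \<omega> * f (W \<omega>)) - Ex (\<lambda>\<omega>. V \<omega> / s2 * f' (W \<omega>))\<bar> \<le> Ex (\<lambda>\<omega>. T \<omega> * G (W \<omega>)) / s2"
  proof -
    have diff: "Ex (\<lambda>\<omega>. W \<omega> * f (W \<omega>)) - Ex (\<lambda>\<omega>. V \<omega> / s2 * f' (W \<omega>)) =
      pq / \<sigma> * (\<Sum>i\<in>S. Ex (\<lambda>\<omega>. g i \<omega> * (f (W (insert i \<omega>)) - f (W (\<omega> - {i})) - d i \<omega> / \<sigma> * f' (W \<omega>))))"
      by (simp only: 1 2 right_diff_distrib bexp_diff sum_subtractf)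
    have "\<bar>Ex (\<lambda>\<omega>. W \<omega> * f (W \<omega>)) - Ex (\<lambda>\<omega>. V \<omega> / s2 * f' (W \<omega>))\<bar> = pq / \<sigma> * \<bar>\<Sum>i\<in>S. Ex (\<lambda>\<omega>. g i \<omega> * (f (W (insert i \<omega>)) - f (W (\<omega> - {i})) - d i \<omega> / \<sigma> * f' (W \<omega>)))\<bar>"
      unfolding diff using divide_nonneg_pos[OF pq \<sigma>(1)] by (simp only: abs_mult abs_of_nonneg)
    also have "\<dots> \<le> pq / \<sigma> * (\<Sum>i\<in>S. Ex (\<lambda>\<omega>. g i \<omega> * (d i \<omega> / \<sigma> * (G (W (insert i \<omega>)) - G (W (\<omega> - {i}))))))"
    proof (rule mult_left_mono)
      have "\<bar>Ex (\<lambda>\<omega>. g i \<omega> * (f (W (insert i \<omega>)) - f (W (\<omega> - {i})) - d i \<omega> / \<sigma> * f' (W \<omega>)))\<bar>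
          \<le> Ex (\<lambda>\<omega>. g i \<omega> * (d i \<omega> / \<sigma> * (G (W (insert i \<omega>)) - G (W (\<omega> - {i})))))" for i
      proof -
        have "\<bar>Ex (\<lambda>\<omega>. g i \<omega> * (f (W (insert i \<omega>)) - f (W (\<omega> - {i})) - d i \<omega> / \<sigma> * f' (W \<omega>)))\<bar>
          \<le> Ex (\<lambda>\<omega>. \<bar>g i \<omega> * (f (W (insert i \<omega>)) - f (W (\<omega> - {i})) - d i \<omega> / \<sigma> * f' (W \<omega>))\<bar>)"
          by (rule bexp_abs[OF p_bounds(1,2)])
        also have "\<dots> \<le> Ex (\<lambda>\<omega>. g i \<omega> * (d i \<omega> / \<sigma> * (G (W (insert i \<omega>)) - G (W (\<omega> - {i})))))"
          by (rule bexp_mono[OF p_bounds(1,2) pt])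
        finally show ?thesis .
      qed
      then show "\<bar>\<Sum>i\<in>S. Ex (\<lambda>\<omega>. g i \<omega> * (f (W (insert i \<omega>)) - f (W (\<omega> - {i})) - d i \<omega> / \<sigma> * f' (W \<omega>)))\<bar>
        \<le> (\<Sum>i\<in>S. Ex (\<lambda>\<omega>. g i \<omega> * (d i \<omega> / \<sigma> * (G (W (insert i \<omega>)) - G (W (\<omega> - {i}))))))"
        by (rule order_trans[OF sum_abs sum_mono])
      show "0 \<le> pq / \<sigma>" using pq \<sigma>(1) by simp
    qed
    finally show ?thesis unfolding 3 .
  qed
  have 5: "\<bar>Ex (\<lambda>\<omega>. f' (W \<omega>)) - Ex (\<lambda>\<omega>. V \<omega> / s2 * f' (W \<omega>))\<bar> \<le> Ex (\<lambda>\<omega>. \<bar>f' (W \<omega>) * (V \<omega> - s2)\<bar>) / s2"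
  proof -
    have "Ex (\<lambda>\<omega>. f' (W \<omega>)) - Ex (\<lambda>\<omega>. V \<omega> / s2 * f' (W \<omega>)) = Ex (\<lambda>\<omega>. (- 1 / s2) * (f' (W \<omega>) * (V \<omega> - s2)))"
    proof -
      have "f' (W \<omega>) - V \<omega> / s2 * f' (W \<omega>) = (- 1 / s2) * (f' (W \<omega>) * (V \<omega> - s2))" for \<omega>
        using s by (simp add: field_simps)
      then show ?thesis unfolding bexp_diff[symmetric] by (simp only:)
    qed
    also have "\<bar>\<dots>\<bar> = \<bar>Ex (\<lambda>\<omega>. f' (W \<omega>) * (V \<omega> - s2))\<bar> / s2"
      unfolding bexp_cmult using s by (simp add: abs_mult)
    also have "\<dots> \<le> Ex (\<lambda>\<omega>. \<bar>f' (W \<omega>) * (V \<omega> - s2)\<bar>) / s2"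
      using s p_bounds by (intro divide_right_mono bexp_abs) auto
    finally show ?thesis .
  qed
  have triangle: "\<bar>a - b\<bar> \<le> x + y" if "\<bar>b - v\<bar> \<le> y" "\<bar>a - v\<bar> \<le> x" for a b v x y :: real
    using that by linarith
  show ?thesis unfolding bexp_diff add_divide_distrib by (rule triangle[OF 4 5])
qed

end

section \<open>Second moments of the Stein remainders\<close>

lemma bexp_incl_diff_square:
  assumes "finite S" "i \<in> S" "i \<notin> M" "M \<subseteq> S"
  shows "bexp S p (\<lambda>\<omega>. (incl {i} \<omega> - p) * ((incl {i} \<omega> - p) * incl M \<omega>)) = p * (1 - p) * p ^ card M"
proof -
  have "(incl {i} (insert i \<omega>) - p) * incl M (insert i \<omega>) - (incl {i} (\<omega> - {i}) - p) * incl M (\<omega> - {i}) = incl M \<omega>" for \<omega>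
    using assms(3) by (auto simp: incl_def)
  then show ?thesis
    unfolding bexp_integration_by_parts[OF assms(1,2)] using bexp_incl[OF assms(1,4)] by simp
qed

lemma bexp_incl_diff_vanish:
  assumes "finite S" "i \<in> S" "i \<notin> M" "i \<noteq> j"
  shows "bexp S p (\<lambda>\<omega>. (incl {i} \<omega> - p) * ((incl {j} \<omega> - p) * incl M \<omega>)) = 0"
proof -
  have "(incl {j} (insert i \<omega>) - p) * incl M (insert i \<omega>) - (incl {j} (\<omega> - {i}) - p) * incl M (\<omega> - {i}) = 0" for \<omega>
    using assms(3,4) by (auto simp: incl_def)
  then show ?thesis
    unfolding bexp_integration_by_parts[OF assms(1,2)] by (simp add: bexp_const assms)
qed

lemma bexp_incl_diff_both:
  assumes "finite S" "i \<in> M" "j \<in> M" "M \<subseteq> S"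
  shows "bexp S p (\<lambda>\<omega>. (incl {i} \<omega> - p) * ((incl {j} \<omega> - p) * incl M \<omega>)) = (1 - p)\<^sup>2 * p ^ card M"
proof -
  have "(incl {i} \<omega> - p) * ((incl {j} \<omega> - p) * incl M \<omega>) = (1 - p)\<^sup>2 * incl M \<omega>" for \<omega>
    using assms(2,3) by (auto simp: incl_def power2_eq_square subset_iff)
  then show ?thesis
    by (simp only: bexp_cmult bexp_incl[OF assms(1,4)])
qed

lemma one_minus_power_le: "0 \<le> p \<Longrightarrow> p \<le> 1 \<Longrightarrow> 1 - p ^ m \<le> real m * (1 - p)"
  using Bernoulli_inequality[of "p - 1" m] by (simp add: algebra_simps)

lemma card_Un4_le: "card (A \<union> B \<union> C \<union> D) \<le> card A + card B + card C + card D"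
  using card_Un_le[of "A \<union> B \<union> C" D] card_Un_le[of "A \<union> B" C] card_Un_le[of A B] by linarith

context indicator_sum
begin

lemma bexp_incl_centred_mult:
  assumes "A \<subseteq> S" "B \<subseteq> S"
  shows "Ex (\<lambda>\<omega>. (incl A \<omega> - p ^ card A) * (incl B \<omega> - p ^ card B)) = p ^ card (A \<union> B) - p ^ (card A + card B)"
proof -
  have "(\<lambda>\<omega>. (incl A \<omega> - p ^ card A) * (incl B \<omega> - p ^ card B)) =
    (\<lambda>\<omega>. (incl (A \<union> B) \<omega> - p ^ card B * incl A \<omega>) - (p ^ card A * incl B \<omega> - p ^ card A * p ^ card B))"
    by (rule ext) (simp add: incl_mult[symmetric] algebra_simps)
  then show ?thesis
    using assms by (simp add: bexp_diff bexp_cmult bexp_const finite_S bexp_incl power_add)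
qed

text \<open>By Bernoulli's inequality \<open>1 - p ^ m \<le> m * (1 - p)\<close>, with \<open>m = card (A \<inter> B)\<close>.\<close>

lemma covariance_le:
  assumes "A \<subseteq> S" "B \<subseteq> S"
  shows "p ^ card (A \<union> B) - p ^ (card A + card B) \<le> of_bool (A \<inter> B \<noteq> {}) * (real (card A) * (1 - p) * p ^ card (A \<union> B))"
proof -
  have fin: "finite A" "finite B" using assms finite_S finite_subset by auto
  have c: "card A + card B = card (A \<union> B) + card (A \<inter> B)" using card_Un_Int[OF fin] .
  show ?thesis
  proof (cases "A \<inter> B = {}")
    case True
    then show ?thesis using c by simp
  next
    case False
    have "p ^ card (A \<union> B) - p ^ (card A + card B) = p ^ card (A \<union> B) * (1 - p ^ card (A \<inter> B))"
      by (simp add: c power_add right_diff_distrib)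
    also have "\<dots> \<le> p ^ card (A \<union> B) * (real (card A) * (1 - p))"
    proof (rule mult_left_mono)
      have "1 - p ^ card (A \<inter> B) \<le> real (card (A \<inter> B)) * (1 - p)"
        using one_minus_power_le p_bounds by auto
      also have "\<dots> \<le> real (card A) * (1 - p)"
        using fin p_bounds by (intro mult_right_mono) (auto intro!: card_mono)
      finally show "1 - p ^ card (A \<inter> B) \<le> real (card A) * (1 - p)" .
    qed (use p_bounds in auto)
    finally show ?thesis using False by (simp add: mult_ac)
  qed
qed

text \<open>The sum over linked quadruples that governs all error terms.\<close>

definition Q where
  "Q = (\<Sum>(k,l)\<in>K\<times>K. \<Sum>(k',l')\<in>K\<times>K. of_bool (linked (E k) (E l) (E k') (E l')) * p ^ card (E k \<union> E l \<union> E k' \<union> E l'))"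

text \<open>The product \<open>g i * d i\<close> is a sum over pairs of terms of \<open>N\<close> that both contain \<open>i\<close>. The summand of such a triple is
a power of \<open>p\<close>, with exponent \<open>wt\<close>, times the indicator of \<open>core\<close>.\<close>

definition triples where "triples = Sigma (K \<times> K) (\<lambda>(k,l). E k \<inter> E l)"

definition core where "core = (\<lambda>((k,l),i). earlier (E k) i \<union> (E l - {i}))"

definition wt :: "('k \<times> 'k) \<times> 's \<Rightarrow> nat" where "wt = (\<lambda>((k,l),i). card (E k - {i} - earlier (E k) i))"

lemma core_facts:
  assumes "((k,l),i) \<in> triples"
  shows "k \<in> K" "l \<in> K" "i \<in> E k" "i \<in> E l" "i \<in> S" "core ((k,l),i) \<subseteq> S" "i \<notin> core ((k,l),i)"
    "core ((k,l),i) \<subseteq> E k \<union> E l" "E k \<union> E l \<subseteq> {i} \<union> (E k - {i} - earlier (E k) i) \<union> core ((k,l),i)"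
    "finite (core ((k,l),i))" "card (core ((k,l),i)) \<le> 2 * e"
proof -
  show m: "k \<in> K" "l \<in> K" "i \<in> E k" "i \<in> E l" using assms by (auto simp: triples_def)
  show "i \<in> S" using m E_subset by auto
  have P: "earlier (E k) i \<subseteq> E k - {i}" using earlier(1)[OF finite_E[OF m(1)] m(3)] .
  show c: "core ((k,l),i) \<subseteq> E k \<union> E l" "i \<notin> core ((k,l),i)"
    using P by (auto simp: core_def)
  show "core ((k,l),i) \<subseteq> S" using c E_subset[OF m(1)] E_subset[OF m(2)] by auto
  show "E k \<union> E l \<subseteq> {i} \<union> (E k - {i} - earlier (E k) i) \<union> core ((k,l),i)"
    by (auto simp: core_def)
  have fin: "finite (E k \<union> E l)" using finite_E m by auto
  show "finite (core ((k,l),i))" using c fin finite_subset by blast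
  have "card (core ((k,l),i)) \<le> card (E k \<union> E l)" using card_mono[OF fin c(1)] .
  also have "\<dots> \<le> card (E k) + card (E l)" by (rule card_Un_le)
  finally show "card (core ((k,l),i)) \<le> 2 * e" using m card_E by simp
qed

lemma g_d_eq: 
  assumes "i \<in> S"
  shows "g i \<omega> * d i \<omega> = (\<Sum>(k,l)\<in>K\<times>K. of_bool (i \<in> E k \<inter> E l) * (p ^ wt ((k,l),i) * incl (core ((k,l),i)) \<omega>))"
  unfolding g_def d_def sum_product sum.cartesian_product
  by (intro sum.cong refl) (auto simp: wt_def core_def incl_mult[symmetric])

lemma sum_S_g_d: "(\<Sum>i\<in>S. c i * (g i \<omega> * d i \<omega>)) = (\<Sum>t\<in>triples. c (snd t) * (p ^ wt t * incl (core t) \<omega>))"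
proof -
  have "(\<Sum>i\<in>S. c i * (g i \<omega> * d i \<omega>)) =
    (\<Sum>x\<in>K\<times>K. \<Sum>i\<in>S. of_bool (i \<in> E (fst x) \<inter> E (snd x)) * (c i * (p ^ wt (x,i) * incl (core (x,i)) \<omega>)))"
  proof -
    have "c i * (g i \<omega> * d i \<omega>) =
      (\<Sum>x\<in>K\<times>K. of_bool (i \<in> E (fst x) \<inter> E (snd x)) * (c i * (p ^ wt (x,i) * incl (core (x,i)) \<omega>)))" if "i \<in> S" for i
      unfolding g_d_eq[OF that] sum_distrib_left by (intro sum.cong refl) (auto simp: mult_ac)
    then show ?thesis by (subst sum.swap) (simp cong: sum.cong)
  qed
  also have "\<dots> = (\<Sum>x\<in>K\<times>K. \<Sum>i\<in>E (fst x) \<inter> E (snd x). c i * (p ^ wt (x,i) * incl (core (x,i)) \<omega>))"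
  proof (rule sum.cong)
    fix x assume x: "x \<in> K \<times> K"
    have "E (fst x) \<inter> E (snd x) \<subseteq> S" using x E_subset[of "fst x"] by auto
    then show "(\<Sum>i\<in>S. of_bool (i \<in> E (fst x) \<inter> E (snd x)) * (c i * (p ^ wt (x,i) * incl (core (x,i)) \<omega>))) =
      (\<Sum>i\<in>E (fst x) \<inter> E (snd x). c i * (p ^ wt (x,i) * incl (core (x,i)) \<omega>))"
      using finite_S by (intro sum.mono_neutral_cong_right) auto
  qed simp
  also have "\<dots> = (\<Sum>t\<in>triples. c (snd t) * (p ^ wt t * incl (core t) \<omega>))"
    unfolding triples_def
    by (subst sum.Sigma) (use finite_K finite_E in \<open>auto simp: case_prod_unfold\<close>)
  finally show ?thesis .
qed

text \<open>For given indices of the four sets there are at most \<open>e\<^sup>2\<close> choices of the two elements \<open>i\<close> and \<open>j\<close>.\<close>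

lemma sum_triples_le:
  assumes "\<And>k l i k' l' j. ((k,l),i) \<in> triples \<Longrightarrow> ((k',l'),j) \<in> triples \<Longrightarrow>
      F ((k,l),i) ((k',l'),j) \<le> c * (of_bool (linked (E k) (E l) (E k') (E l')) * p ^ card (E k \<union> E l \<union> E k' \<union> E l'))"
    and "c \<ge> 0"
  shows "(\<Sum>s\<in>triples. \<Sum>t\<in>triples. F s t) \<le> c * real e ^ 2 * Q"
proof -
  define B where "B = (\<lambda>(k,l) (k',l'). of_bool (linked (E k) (E l) (E k') (E l')) * p ^ card (E k \<union> E l \<union> E k' \<union> E l'))"
  have B0: "B x y \<ge> 0" for x y using p_bounds by (auto simp: B_def split: prod.splits)
  have fK: "finite (K \<times> K)" using finite_K by simp
  have collapse: "(\<Sum>t\<in>triples. f (fst t)) \<le> real e * (\<Sum>x\<in>K\<times>K. f x)" if f: "\<And>x. f x \<ge> 0" for f :: "_ \<Rightarrow> real"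
  proof -
    have "(\<Sum>t\<in>triples. f (fst t)) = (\<Sum>x\<in>K\<times>K. \<Sum>i\<in>E (fst x) \<inter> E (snd x). f x)"
      unfolding triples_def by (subst sum.Sigma) (use finite_K finite_E in \<open>auto simp: case_prod_unfold\<close>)
    also have "\<dots> \<le> (\<Sum>x\<in>K\<times>K. real e * f x)"
    proof (rule sum_mono)
      fix x assume x: "x \<in> K \<times> K"
      have "card (E (fst x) \<inter> E (snd x)) \<le> card (E (fst x))"
        using x finite_E by (intro card_mono) auto
      then have "card (E (fst x) \<inter> E (snd x)) \<le> e" using x card_E by auto
      then show "(\<Sum>i\<in>E (fst x) \<inter> E (snd x). f x) \<le> real e * f x"
        using f[of x] by (simp add: mult_right_mono)
    qed
    finally show ?thesis by (simp add: sum_distrib_left)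
  qed
  have "(\<Sum>s\<in>triples. \<Sum>t\<in>triples. F s t) \<le> (\<Sum>s\<in>triples. \<Sum>t\<in>triples. c * B (fst s) (fst t))"
    by (intro sum_mono) (use assms(1) in \<open>auto simp: B_def\<close>)
  also have "\<dots> \<le> (\<Sum>s\<in>triples. real e * (\<Sum>y\<in>K\<times>K. c * B (fst s) y))"
    by (intro sum_mono collapse) (use B0 assms(2) in auto)
  also have "\<dots> \<le> real e * (\<Sum>x\<in>K\<times>K. real e * (\<Sum>y\<in>K\<times>K. c * B x y))"
    by (rule collapse) (use B0 assms(2) in \<open>auto intro!: mult_nonneg_nonneg sum_nonneg\<close>)
  also have "\<dots> = c * real e ^ 2 * Q"
    unfolding Q_def B_def by (simp add: sum_distrib_left case_prod_unfold power2_eq_square mult_ac)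
  finally show ?thesis .
qed

text \<open>Expanding the variance leaves pairs of triples whose cores meet; then the four sets are linked. The powers of \<open>p\<close> from the two
factors \<open>p * (1 - p)\<close>, the weights and the covariance together account for every element of the union of the four sets.\<close>

lemma Var_V: "Ex (\<lambda>\<omega>. (V \<omega> - s2)\<^sup>2) \<le> 2 * real e ^ 3 * (1 - p) ^ 3 * Q"
proof -
  define pq where "pq = p * (1 - p)"
  define a where "a t = pq * p ^ wt t" for t
  have V: "V \<omega> = (\<Sum>t\<in>triples. a t * incl (core t) \<omega>)" for \<omega>
    using sum_S_g_d[of "\<lambda>_. 1" \<omega>] by (simp add: V_def a_def pq_def sum_distrib_left mult.assoc)
  have core_S: "core t \<subseteq> S" if "t \<in> triples" for t using core_facts(6) that by (cases t) auto
  have s2: "s2 = (\<Sum>t\<in>triples. a t * p ^ card (core t))"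
    unfolding Ex_V[symmetric] V[abs_def] bexp_sum bexp_cmult
    by (intro sum.cong refl) (simp add: bexp_incl[OF finite_S core_S])
  have "V \<omega> - s2 = (\<Sum>t\<in>triples. a t * (incl (core t) \<omega> - p ^ card (core t)))" for \<omega>
    unfolding V s2 by (simp add: sum_subtractf right_diff_distrib)
  then have "Ex (\<lambda>\<omega>. (V \<omega> - s2)\<^sup>2) = (\<Sum>s\<in>triples. \<Sum>t\<in>triples. a s * a t * Ex (\<lambda>\<omega>. (incl (core s) \<omega> - p ^ card (core s)) * (incl (core t) \<omega> - p ^ card (core t))))"
    by (simp add: power2_eq_square sum_product bexp_sum bexp_cmult[symmetric] mult_ac)
  also have "\<dots> = (\<Sum>s\<in>triples. \<Sum>t\<in>triples. a s * a t * (p ^ card (core s \<union> core t) - p ^ (card (core s) + card (core t))))"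
    by (intro sum.cong refl) (simp add: bexp_incl_centred_mult core_S)
  also have "\<dots> \<le> 2 * real e * (1 - p) ^ 3 * real e ^ 2 * Q"
  proof (rule sum_triples_le)
    fix k l i k' l' j
    assume s: "((k,l),i) \<in> triples" and t: "((k',l'),j) \<in> triples"
    let ?s = "((k,l),i)" and ?t = "((k',l'),j)"
    let ?U = "E k \<union> E l \<union> E k' \<union> E l'"
    note cs = core_facts[OF s] and ct = core_facts[OF t]
    have a0: "0 \<le> a ?s * a ?t" using p_bounds by (auto simp: a_def pq_def)
    have "a ?s * a ?t * (p ^ card (core ?s \<union> core ?t) - p ^ (card (core ?s) + card (core ?t))) \<le>
        a ?s * a ?t * (of_bool (core ?s \<inter> core ?t \<noteq> {}) * (real (card (core ?s)) * (1 - p) * p ^ card (core ?s \<union> core ?t)))"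
      by (intro mult_left_mono[OF _ a0] covariance_le cs ct)
    also have "\<dots> \<le> 2 * real e * (1 - p) ^ 3 * (of_bool (linked (E k) (E l) (E k') (E l')) * p ^ card ?U)"
    proof (cases "core ?s \<inter> core ?t = {}")
      case False
      then have L: "linked (E k) (E l) (E k') (E l')"
        using cs(3,4,8) ct(3,4,8) unfolding linked_def by blast
      have sub: "?U \<subseteq> ({i} \<union> {j}) \<union> (E k - {i} - earlier (E k) i) \<union> (E k' - {j} - earlier (E k') j) \<union> (core ?s \<union> core ?t)"
        using cs(9) ct(9) by blast
      have "card ?U \<le> card (({i} \<union> {j}) \<union> (E k - {i} - earlier (E k) i) \<union> (E k' - {j} - earlier (E k') j) \<union> (core ?s \<union> core ?t))"
        using cs(1,10) ct(1,10) finite_E by (intro card_mono sub) auto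
      also have "\<dots> \<le> 1 + 1 + wt ?s + wt ?t + card (core ?s \<union> core ?t)"
        using card_Un4_le[of "{i} \<union> {j}" "E k - {i} - earlier (E k) i" "E k' - {j} - earlier (E k') j" "core ?s \<union> core ?t"] card_Un_le[of "{i}" "{j}"] by (simp add: wt_def)
      finally have "p ^ (1 + 1 + wt ?s + wt ?t + card (core ?s \<union> core ?t)) \<le> p ^ card ?U"
        by (rule power_decreasing[OF _ p_bounds(1,2)])
      moreover have "real (card (core ?s)) \<le> 2 * real e" using cs(11) by linarith
      ultimately have "(real (card (core ?s)) * (1-p)^3) * p ^ (1 + 1 + wt ?s + wt ?t + card (core ?s \<union> core ?t)) \<le> (2 * real e * (1-p)^3) * p ^ card ?U"
        using p_bounds by (intro mult_mono) auto
      then show ?thesis using False L by (simp add: a_def pq_def power_add mult_ac power3_eq_cube)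
    qed (use p_bounds in simp)
    finally show "a ?s * a ?t * (p ^ card (core ?s \<union> core ?t) - p ^ (card (core ?s) + card (core ?t))) \<le>
      2 * real e * (1 - p) ^ 3 * (of_bool (linked (E k) (E l) (E k') (E l')) * p ^ card ?U)" .
  qed (use p_bounds in auto)
  finally show ?thesis by (simp add: mult_ac power2_eq_square power3_eq_cube)
qed

text \<open>In the expansion of the square, a factor \<open>incl {i} \<omega> - p\<close> that meets no other occurrence of \<open>i\<close> has mean 0. So either
both triples have the same element, or the element of each lies in the core of the other; in both cases
the four sets are linked.\<close>

lemma second_moment_T: "Ex (\<lambda>\<omega>. (T \<omega>)\<^sup>2) \<le> (1 - p) * real e ^ 2 * Q"
proof -
  have T: "T \<omega> = (\<Sum>t\<in>triples. (incl {snd t} \<omega> - p) * (p ^ wt t * incl (core t) \<omega>))" for \<omega>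
    unfolding T_def by (rule sum_S_g_d)
  have eq: "((incl {i} \<omega> - p) * (p ^ m * incl A \<omega>)) * ((incl {j} \<omega> - p) * (p ^ n * incl B \<omega>)) =
     p ^ (m + n) * ((incl {i} \<omega> - p) * ((incl {j} \<omega> - p) * incl (A \<union> B) \<omega>))" for i m A j n B \<omega>
    by (simp add: incl_mult[symmetric] power_add mult_ac)
  have "Ex (\<lambda>\<omega>. (T \<omega>)\<^sup>2) = (\<Sum>s\<in>triples. \<Sum>t\<in>triples. p ^ (wt s + wt t) *
      Ex (\<lambda>\<omega>. (incl {snd s} \<omega> - p) * ((incl {snd t} \<omega> - p) * incl (core s \<union> core t) \<omega>)))"
    unfolding T power2_eq_square sum_product eq bexp_sum bexp_cmult ..
  also have "\<dots> \<le> (1 - p) * real e ^ 2 * Q"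
  proof (rule sum_triples_le)
    fix k l i k' l' j
    assume s: "((k,l),i) \<in> triples" and t: "((k',l'),j) \<in> triples"
    let ?s = "((k,l),i)" and ?t = "((k',l'),j)"
    let ?U = "E k \<union> E l \<union> E k' \<union> E l'" and ?M = "core ?s \<union> core ?t"
    note cs = core_facts[OF s] and ct = core_facts[OF t]
    have MS: "?M \<subseteq> S" using cs(6) ct(6) by blast
    have sub: "?U \<subseteq> ({i} \<union> {j}) \<union> (E k - {i} - earlier (E k) i) \<union> (E k' - {j} - earlier (E k') j) \<union> ?M"
      using cs(9) ct(9) by blast
    have fin: "finite (E k - {i} - earlier (E k) i)" "finite (E k' - {j} - earlier (E k') j)" "finite ?M"
      using cs(1,10) ct(1,10) finite_E by auto
    let ?X = "Ex (\<lambda>\<omega>. (incl {i} \<omega> - p) * ((incl {j} \<omega> - p) * incl ?M \<omega>))"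
    consider "i = j" | "i \<noteq> j" "i \<notin> ?M" | "i \<noteq> j" "j \<notin> ?M" | "i \<noteq> j" "i \<in> ?M" "j \<in> ?M" by blast
    then have "p ^ (wt ?s + wt ?t) * ?X \<le> (1 - p) * (of_bool (linked (E k) (E l) (E k') (E l')) * p ^ card ?U)"
    proof cases
      case 1
      then have X: "?X = p * (1 - p) * p ^ card ?M"
        using bexp_incl_diff_square[OF finite_S cs(5) _ MS] cs(7) ct(7) by auto
      have L: "linked (E k) (E l) (E k') (E l')"
        using cs(3,4) ct(3,4) 1 unfolding linked_def by blast
      have "?U \<subseteq> {i} \<union> (E k - {i} - earlier (E k) i) \<union> (E k' - {j} - earlier (E k') j) \<union> ?M" using sub 1 by blast
      then have "card ?U \<le> card ({i} \<union> (E k - {i} - earlier (E k) i) \<union> (E k' - {j} - earlier (E k') j) \<union> ?M)"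
        using fin by (intro card_mono) auto
      also have "\<dots> \<le> 1 + wt ?s + wt ?t + card ?M"
        using card_Un4_le[of "{i}" "E k - {i} - earlier (E k) i" "E k' - {j} - earlier (E k') j" ?M] by (simp add: wt_def)
      finally have "p ^ (1 + wt ?s + wt ?t + card ?M) \<le> p ^ card ?U"
        by (rule power_decreasing[OF _ p_bounds(1,2)])
      from mult_left_mono[OF this p_bounds(3)] show ?thesis
        unfolding X using L by (simp add: power_add mult_ac)
    next
      case 2
      then have "?X = 0" using bexp_incl_diff_vanish[OF finite_S cs(5)] by blast
      then show ?thesis using p_bounds by simp
    next
      case 3
      then have "?X = 0"
        using bexp_incl_diff_vanish[OF finite_S ct(5), of ?M i] by (simp add: mult.left_commute)
      then show ?thesis using p_bounds by simp
    next
      case 4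
      have X: "?X = (1 - p)\<^sup>2 * p ^ card ?M"
        by (rule bexp_incl_diff_both[OF finite_S 4(2,3) MS])
      have "i \<in> E k' \<union> E l'" using 4 cs(7) ct(8) by blast
      moreover have "j \<in> E k \<union> E l" using 4 ct(7) cs(8) by blast
      ultimately have L: "linked (E k) (E l) (E k') (E l')"
        using cs(3,4) ct(3,4) unfolding linked_def by blast
      have "?U \<subseteq> (E k - {i} - earlier (E k) i) \<union> (E k' - {j} - earlier (E k') j) \<union> ?M" using sub 4 by blast
      then have "card ?U \<le> card ((E k - {i} - earlier (E k) i) \<union> (E k' - {j} - earlier (E k') j) \<union> ?M)"
        using fin by (intro card_mono) auto
      also have "\<dots> \<le> wt ?s + wt ?t + card ?M"
        using card_Un4_le[of "{}" "E k - {i} - earlier (E k) i" "E k' - {j} - earlier (E k') j" ?M] by (simp add: wt_def)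
      finally have "p ^ (wt ?s + wt ?t + card ?M) \<le> p ^ card ?U"
        by (rule power_decreasing[OF _ p_bounds(1,2)])
      moreover have "(1 - p)\<^sup>2 \<le> 1 - p"
        using mult_left_mono[of "1 - p" 1 "1 - p"] p_bounds by (simp add: power2_eq_square)
      ultimately have "(1 - p)\<^sup>2 * p ^ (wt ?s + wt ?t + card ?M) \<le> (1 - p) * p ^ card ?U"
        using p_bounds by (intro mult_mono) auto
      then show ?thesis
        unfolding X using L by (simp add: power_add mult_ac)
    qed
    then show "p ^ (wt ?s + wt ?t) * Ex (\<lambda>\<omega>. (incl {snd ?s} \<omega> - p) * ((incl {snd ?t} \<omega> - p) * incl ?M \<omega>))
       \<le> (1 - p) * (of_bool (linked (E k) (E l) (E k') (E l')) * p ^ card ?U)" by simp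
  qed (use p_bounds in auto)
  finally show ?thesis .
qed

end

section \<open>Joint fourth cumulants of indicators\<close>

text \<open>The joint cumulant of the indicators of \<open>A\<close>, \<open>B\<close>, \<open>C\<close> and \<open>D\<close>: the sum over all partitions of the four
indices, where a partition into \<open>b\<close> blocks has the coefficient \<open>(- 1) ^ (b - 1) * fact (b - 1)\<close> and the product of the moments of its blocks. The 15 partitions
have one block, blocks of sizes 1 and 3 or 2 and 2, blocks of sizes 1, 1 and 2, or four blocks.\<close>

definition joint_cumulant :: "real \<Rightarrow> 's set \<Rightarrow> 's set \<Rightarrow> 's set \<Rightarrow> 's set \<Rightarrow> real" where
  "joint_cumulant p A B C D =
     p ^ card (A \<union> B \<union> C \<union> D)
     - (p ^ (card A + card (B \<union> C \<union> D)) + p ^ (card B + card (A \<union> C \<union> D))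
        + p ^ (card C + card (A \<union> B \<union> D)) + p ^ (card D + card (A \<union> B \<union> C)))
     - (p ^ (card (A \<union> B) + card (C \<union> D)) + p ^ (card (A \<union> C) + card (B \<union> D)) + p ^ (card (A \<union> D) + card (B \<union> C)))
     + 2 * (p ^ (card A + card B + card (C \<union> D)) + p ^ (card A + card C + card (B \<union> D))
        + p ^ (card A + card D + card (B \<union> C)) + p ^ (card B + card C + card (A \<union> D))
        + p ^ (card B + card D + card (A \<union> C)) + p ^ (card C + card D + card (A \<union> B)))
     - 6 * p ^ (card A + card B + card C + card D)"

lemma joint_cumulant_swap12: "joint_cumulant p A B C D = joint_cumulant p B A C D"
  and joint_cumulant_swap23: "joint_cumulant p A B C D = joint_cumulant p A C B D"
  and joint_cumulant_swap34: "joint_cumulant p A B C D = joint_cumulant p A B D C"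
  unfolding joint_cumulant_def by (simp_all only: Un_ac add_ac)

text \<open>If one of the four sets is disjoint from the others, the moments factorise and all terms cancel.\<close>

lemma joint_cumulant_split1:
  assumes fin: "finite A" "finite B" "finite C" "finite D" and dis: "A \<inter> (B \<union> C \<union> D) = {}"
  shows "joint_cumulant p A B C D = 0"
proof -
  have c: "card (A \<union> X) = card A + card X" if "X \<subseteq> B \<union> C \<union> D" for X
  proof (rule card_Un_disjoint)
    show "finite A" by (rule fin)
    show "finite X" by (rule finite_subset[OF that]) (simp add: fin)
    show "A \<inter> X = {}" using that dis by blast
  qed
  have "card (A \<union> B \<union> C \<union> D) = card A + card (B \<union> C \<union> D)" "card (A \<union> C \<union> D) = card A + card (C \<union> D)"
    "card (A \<union> B \<union> D) = card A + card (B \<union> D)" "card (A \<union> B \<union> C) = card A + card (B \<union> C)"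
    using c[of "B \<union> C \<union> D"] c[of "C \<union> D"] c[of "B \<union> D"] c[of "B \<union> C"] by (auto simp: Un_assoc)
  moreover have "card (A \<union> B) = card A + card B" "card (A \<union> C) = card A + card C" "card (A \<union> D) = card A + card D"
    by (auto intro!: c)
  ultimately show ?thesis unfolding joint_cumulant_def by (simp add: power_add algebra_simps)
qed

lemma joint_cumulant_split2:
  assumes fin: "finite A" "finite B" "finite C" "finite D" and dis: "(A \<union> B) \<inter> (C \<union> D) = {}"
  shows "joint_cumulant p A B C D = 0"
proof -
  have c: "card (Y \<union> X) = card Y + card X" if "Y \<subseteq> A \<union> B" "X \<subseteq> C \<union> D" for X Y
  proof (rule card_Un_disjoint)
    show "finite Y" by (rule finite_subset[OF that(1)]) (simp add: fin)
    show "finite X" by (rule finite_subset[OF that(2)]) (simp add: fin)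
    show "Y \<inter> X = {}" using that dis by blast
  qed
  have "card (A \<union> B \<union> C \<union> D) = card (A \<union> B) + card (C \<union> D)" "card (A \<union> C \<union> D) = card A + card (C \<union> D)"
    "card (B \<union> C \<union> D) = card B + card (C \<union> D)"
    using c[of "A \<union> B" "C \<union> D"] c[of A "C \<union> D"] c[of B "C \<union> D"] by (auto simp: Un_assoc)
  moreover have "card (A \<union> B \<union> D) = card (A \<union> B) + card D" "card (A \<union> B \<union> C) = card (A \<union> B) + card C"
    "card (A \<union> C) = card A + card C" "card (A \<union> D) = card A + card D"
    "card (B \<union> C) = card B + card C" "card (B \<union> D) = card B + card D"
    by (auto intro!: c)
  ultimately show ?thesis unfolding joint_cumulant_def by (simp add: power_add algebra_simps)
qed

lemma joint_cumulant_unlinked: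
  assumes fin: "finite A" "finite B" "finite C" "finite D" and nl: "\<not> linked A B C D"
  shows "joint_cumulant p A B C D = 0"
proof -
  note s12 = joint_cumulant_swap12[of p] and s23 = joint_cumulant_swap23[of p] and s34 = joint_cumulant_swap34[of p]
  consider "A \<inter> (B \<union> C \<union> D) = {}" | "B \<inter> (A \<union> C \<union> D) = {}" | "C \<inter> (A \<union> B \<union> D) = {}" | "D \<inter> (A \<union> B \<union> C) = {}"
    | "(A \<union> B) \<inter> (C \<union> D) = {}" | "(A \<union> C) \<inter> (B \<union> D) = {}" | "(A \<union> D) \<inter> (B \<union> C) = {}"
    using nl unfolding linked_def by argo
  then show ?thesis
  proof cases
    case 1
    show ?thesis by (rule joint_cumulant_split1[OF fin 1])
  next
    case 2
    show ?thesis unfolding s12[of A B C D] by (rule joint_cumulant_split1[OF fin(2,1,3,4) 2])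
  next
    case 3
    show ?thesis unfolding s23[of A B C D] s12[of A C B D] by (rule joint_cumulant_split1[OF fin(3,1,2,4) 3])
  next
    case 4
    show ?thesis unfolding s34[of A B C D] s23[of A B D C] s12[of A D B C]
      by (rule joint_cumulant_split1[OF fin(4,1,2,3) 4])
  next
    case 5
    show ?thesis by (rule joint_cumulant_split2[OF fin 5])
  next
    case 6
    show ?thesis unfolding s23[of A B C D] by (rule joint_cumulant_split2[OF fin(1,3,2,4) 6])
  next
    case 7
    show ?thesis unfolding s34[of A B C D] s23[of A B D C] by (rule joint_cumulant_split2[OF fin(1,4,2,3) 7])
  qed
qed

lemma power_near_one_upper:
  assumes "0 \<le> q" "q \<le> (1::real)"
  shows "(1 - q) ^ m \<le> 1 - real m * q + (real m * q)\<^sup>2"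
proof (induction m)
  case (Suc m)
  have "(1 - q) ^ Suc m \<le> (1 - q) * (1 - real m * q + (real m * q)\<^sup>2)"
    using Suc assms by (simp add: mult_left_mono)
  also have "\<dots> = 1 - real (Suc m) * q + (real m + (real m)\<^sup>2) * q\<^sup>2 - (real m)\<^sup>2 * q ^ 3"
    by (simp add: algebra_simps power2_eq_square power3_eq_cube)
  also have "\<dots> \<le> 1 - real (Suc m) * q + (real (Suc m))\<^sup>2 * q\<^sup>2"
  proof -
    have "(real m + (real m)\<^sup>2) * q\<^sup>2 \<le> (real (Suc m))\<^sup>2 * q\<^sup>2"
      by (intro mult_right_mono) (auto simp: power2_eq_square algebra_simps)
    moreover have "0 \<le> (real m)\<^sup>2 * q ^ 3" using assms by simp
    ultimately show ?thesis by linarith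
  qed
  finally show ?case by (simp add: power_mult_distrib)
qed simp

text \<open>This combination of sizes is the first order coefficient of the cumulant in \<open>1 - p\<close>.\<close>

lemma inclusion_exclusion4:
  assumes fin: "finite A" "finite B" "finite C" "finite D"
  shows "real (card (A \<inter> B \<inter> C \<inter> D)) = real (card A) + real (card B) + real (card C) + real (card D)
     - (real (card (A \<union> B)) + real (card (A \<union> C)) + real (card (A \<union> D)) + real (card (B \<union> C)) + real (card (B \<union> D)) + real (card (C \<union> D)))
     + (real (card (A \<union> B \<union> C)) + real (card (A \<union> B \<union> D)) + real (card (A \<union> C \<union> D)) + real (card (B \<union> C \<union> D)))
     - real (card (A \<union> B \<union> C \<union> D))"
proof -
  let ?U = "A \<union> B \<union> C \<union> D"
  have c: "real (card X) = (\<Sum>x\<in>?U. of_bool (x \<in> X))" if "X \<subseteq> ?U" for X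
    using that fin by (simp add: sum_of_bool_eq Int_absorb1)
  have eqs: "real (card A) = (\<Sum>x\<in>?U. of_bool (x \<in> A))" "real (card B) = (\<Sum>x\<in>?U. of_bool (x \<in> B))"
    "real (card C) = (\<Sum>x\<in>?U. of_bool (x \<in> C))" "real (card D) = (\<Sum>x\<in>?U. of_bool (x \<in> D))"
    "real (card (A \<union> B \<union> C)) = (\<Sum>x\<in>?U. of_bool (x \<in> A \<union> B \<union> C))"
    "real (card (A \<union> B \<union> D)) = (\<Sum>x\<in>?U. of_bool (x \<in> A \<union> B \<union> D))"
    "real (card (A \<union> C \<union> D)) = (\<Sum>x\<in>?U. of_bool (x \<in> A \<union> C \<union> D))"
    "real (card (B \<union> C \<union> D)) = (\<Sum>x\<in>?U. of_bool (x \<in> B \<union> C \<union> D))"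
    "real (card (A \<union> B)) = (\<Sum>x\<in>?U. of_bool (x \<in> A \<union> B))"
    "real (card (A \<union> C)) = (\<Sum>x\<in>?U. of_bool (x \<in> A \<union> C))"
    "real (card (A \<union> D)) = (\<Sum>x\<in>?U. of_bool (x \<in> A \<union> D))"
    "real (card (B \<union> C)) = (\<Sum>x\<in>?U. of_bool (x \<in> B \<union> C))"
    "real (card (B \<union> D)) = (\<Sum>x\<in>?U. of_bool (x \<in> B \<union> D))"
    "real (card (C \<union> D)) = (\<Sum>x\<in>?U. of_bool (x \<in> C \<union> D))"
    "real (card (A \<union> B \<union> C \<union> D)) = (\<Sum>x\<in>?U. of_bool (x \<in> A \<union> B \<union> C \<union> D))"
    "real (card (A \<inter> B \<inter> C \<inter> D)) = (\<Sum>x\<in>?U. of_bool (x \<in> A \<inter> B \<inter> C \<inter> D))"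
    by (rule c; blast)+
  show ?thesis
    unfolding eqs sum.distrib[symmetric] sum_subtractf[symmetric]
  proof (rule sum.cong)
    fix x
    show "of_bool (x \<in> A \<inter> B \<inter> C \<inter> D) = (of_bool (x \<in> A) + of_bool (x \<in> B) + of_bool (x \<in> C) + of_bool (x \<in> D)
         - (of_bool (x \<in> A \<union> B) + of_bool (x \<in> A \<union> C) + of_bool (x \<in> A \<union> D) + of_bool (x \<in> B \<union> C) + of_bool (x \<in> B \<union> D) + of_bool (x \<in> C \<union> D))
         + (of_bool (x \<in> A \<union> B \<union> C) + of_bool (x \<in> A \<union> B \<union> D) + of_bool (x \<in> A \<union> C \<union> D) + of_bool (x \<in> B \<union> C \<union> D))
         - of_bool (x \<in> A \<union> B \<union> C \<union> D) :: real)"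
      by (cases "x \<in> A"; cases "x \<in> B"; cases "x \<in> C"; cases "x \<in> D"; simp)
  qed simp
qed

lemma card_Un_less_sum:
  assumes "finite X" "finite Y" "X \<inter> Y \<noteq> {}"
  shows "card (X \<union> Y) + 1 \<le> card X + card Y"
proof -
  have "card (X \<inter> Y) \<noteq> 0" using assms by simp
  then show ?thesis using card_Un_Int[OF assms(1,2)] by linarith
qed

text \<open>The coefficients of the 15 partitions, separated from the moments, so that estimates of the single
moments can be inserted by monotonicity: the partitions with two or four blocks enter with a negative sign.\<close>

definition cumulant_combination :: "real \<Rightarrow> real \<Rightarrow> real \<Rightarrow> real \<Rightarrow> real \<Rightarrow> real \<Rightarrow> real \<Rightarrow> real \<Rightarrow> real \<Rightarrow> real \<Rightarrow> real \<Rightarrow> real \<Rightarrow> real \<Rightarrow> real \<Rightarrow> real \<Rightarrow> real" where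
  "cumulant_combination x0 x1 x2 x3 x4 x5 x6 x7 y1 y2 y3 y4 y5 y6 w =
     x0 - (x1 + x2 + x3 + x4) - (x5 + x6 + x7) + 2 * (y1 + y2 + y3 + y4 + y5 + y6) - 6 * w"

lemma cumulant_combination_mono:
  assumes "x0' \<le> x0" "x1 \<le> x1'" "x2 \<le> x2'" "x3 \<le> x3'" "x4 \<le> x4'" "x5 \<le> x5'" "x6 \<le> x6'" "x7 \<le> x7'" "y1' \<le> y1" "y2' \<le> y2" "y3' \<le> y3" "y4' \<le> y4" "y5' \<le> y5" "y6' \<le> y6" "w \<le> w'"
  shows "cumulant_combination x0' x1' x2' x3' x4' x5' x6' x7' y1' y2' y3' y4' y5' y6' w' \<le> cumulant_combination x0 x1 x2 x3 x4 x5 x6 x7 y1 y2 y3 y4 y5 y6 w"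
  unfolding cumulant_combination_def by (intro diff_mono add_mono mult_left_mono assms) simp_all

lemma cumulant_combination_near_one:
  "cumulant_combination (1 - q * x0) (1 - q * x1 + z) (1 - q * x2 + z) (1 - q * x3 + z) (1 - q * x4 + z) (1 - q * x5 + z) (1 - q * x6 + z) (1 - q * x7 + z) (1 - q * y1) (1 - q * y2) (1 - q * y3) (1 - q * y4) (1 - q * y5) (1 - q * y6) (1 - q * w + z) =
     q * (x1 + x2 + x3 + x4 + x5 + x6 + x7 - x0 - 2 * (y1 + y2 + y3 + y4 + y5 + y6) + 6 * w) - 13 * z"
  unfolding cumulant_combination_def by (simp add: algebra_simps)

lemma joint_cumulant_combination:
  "joint_cumulant p A B C D = cumulant_combination (p ^ card (A \<union> B \<union> C \<union> D))
     (p ^ (card A + card (B \<union> C \<union> D)))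
     (p ^ (card B + card (A \<union> C \<union> D)))
     (p ^ (card C + card (A \<union> B \<union> D)))
     (p ^ (card D + card (A \<union> B \<union> C)))
     (p ^ (card (A \<union> B) + card (C \<union> D)))
     (p ^ (card (A \<union> C) + card (B \<union> D)))
     (p ^ (card (A \<union> D) + card (B \<union> C)))
     (p ^ (card A + card B + card (C \<union> D)))
     (p ^ (card A + card C + card (B \<union> D)))
     (p ^ (card A + card D + card (B \<union> C)))
     (p ^ (card B + card C + card (A \<union> D)))
     (p ^ (card B + card D + card (A \<union> C)))
     (p ^ (card C + card D + card (A \<union> B)))
     (p ^ (card A + card B + card C + card D))"
  unfolding joint_cumulant_def cumulant_combination_def ..

text \<open>Every moment product has an exponent between \<open>u\<close> and \<open>r\<close>, the size of the union and a bound for the sum of the sizes.\<close>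

locale four_sets =
  fixes A B C D :: "'s set" and p :: real and r :: nat
  assumes fin: "finite A" "finite B" "finite C" "finite D"
    and p: "0 \<le> p" "p \<le> 1"
    and r: "card A + card B + card C + card D \<le> r"
begin

abbreviation u where "u \<equiv> card (A \<union> B \<union> C \<union> D)"

lemmas Un_le =
  card_Un_le[of A B] card_Un_le[of A C] card_Un_le[of A D] card_Un_le[of B C] card_Un_le[of B D] card_Un_le[of C D]
  card_Un_le[of "A \<union> B" C] card_Un_le[of "A \<union> B" D] card_Un_le[of "A \<union> C" D] card_Un_le[of "B \<union> C" D]

lemma u_le:
  "u \<le> card (A) + card (B \<union> C \<union> D)"
  "u \<le> card (B) + card (A \<union> C \<union> D)"
  "u \<le> card (C) + card (A \<union> B \<union> D)"
  "u \<le> card (D) + card (A \<union> B \<union> C)"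
  "u \<le> card (A \<union> B) + card (C \<union> D)"
  "u \<le> card (A \<union> C) + card (B \<union> D)"
  "u \<le> card (A \<union> D) + card (B \<union> C)"
proof -
  have weak: "u \<le> card X + card Y" if "X \<union> Y = A \<union> B \<union> C \<union> D" for X Y
    using card_Un_le[of X Y] that by simp
  show "u \<le> card (A) + card (B \<union> C \<union> D)" by (rule weak) blast
  show "u \<le> card (B) + card (A \<union> C \<union> D)" by (rule weak) blast
  show "u \<le> card (C) + card (A \<union> B \<union> D)" by (rule weak) blast
  show "u \<le> card (D) + card (A \<union> B \<union> C)" by (rule weak) blast
  show "u \<le> card (A \<union> B) + card (C \<union> D)" by (rule weak) blast
  show "u \<le> card (A \<union> C) + card (B \<union> D)" by (rule weak) blast
  show "u \<le> card (A \<union> D) + card (B \<union> C)" by (rule weak) blast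
qed

lemma le_block_sums:
  "u \<le> card A + card (B \<union> C \<union> D)"
  "u \<le> card B + card (A \<union> C \<union> D)"
  "u \<le> card C + card (A \<union> B \<union> D)"
  "u \<le> card D + card (A \<union> B \<union> C)"
  "u \<le> card (A \<union> B) + card (C \<union> D)"
  "u \<le> card (A \<union> C) + card (B \<union> D)"
  "u \<le> card (A \<union> D) + card (B \<union> C)"
  "u \<le> card A + card B + card (C \<union> D)"
  "u \<le> card A + card C + card (B \<union> D)"
  "u \<le> card A + card D + card (B \<union> C)"
  "u \<le> card B + card C + card (A \<union> D)"
  "u \<le> card B + card D + card (A \<union> C)"
  "u \<le> card C + card D + card (A \<union> B)"
  "u \<le> card A + card B + card C + card D"
proof -
  show "u \<le> card A + card (B \<union> C \<union> D)"
    using u_le(1) by linarith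
  show "u \<le> card B + card (A \<union> C \<union> D)"
    using u_le(2) by linarith
  show "u \<le> card C + card (A \<union> B \<union> D)"
    using u_le(3) by linarith
  show "u \<le> card D + card (A \<union> B \<union> C)"
    using u_le(4) by linarith
  show "u \<le> card (A \<union> B) + card (C \<union> D)"
    using u_le(5) by linarith
  show "u \<le> card (A \<union> C) + card (B \<union> D)"
    using u_le(6) by linarith
  show "u \<le> card (A \<union> D) + card (B \<union> C)"
    using u_le(7) by linarith
  show "u \<le> card A + card B + card (C \<union> D)"
    using u_le(5) Un_le(1) by linarith
  show "u \<le> card A + card C + card (B \<union> D)"
    using u_le(6) Un_le(2) by linarith
  show "u \<le> card A + card D + card (B \<union> C)"
    using u_le(7) Un_le(3) by linarith
  show "u \<le> card B + card C + card (A \<union> D)"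
    using u_le(7) Un_le(4) by linarith
  show "u \<le> card B + card D + card (A \<union> C)"
    using u_le(6) Un_le(5) by linarith
  show "u \<le> card C + card D + card (A \<union> B)"
    using u_le(5) Un_le(6) by linarith
  show "u \<le> card A + card B + card C + card D"
    using u_le(5) Un_le(1) Un_le(6) by linarith
qed

lemma block_sums_le:
  "card A + card (B \<union> C \<union> D) \<le> r"
  "card B + card (A \<union> C \<union> D) \<le> r"
  "card C + card (A \<union> B \<union> D) \<le> r"
  "card D + card (A \<union> B \<union> C) \<le> r"
  "card (A \<union> B) + card (C \<union> D) \<le> r"
  "card (A \<union> C) + card (B \<union> D) \<le> r"
  "card (A \<union> D) + card (B \<union> C) \<le> r"
  "card A + card B + card (C \<union> D) \<le> r"
  "card A + card C + card (B \<union> D) \<le> r"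
  "card A + card D + card (B \<union> C) \<le> r"
  "card B + card C + card (A \<union> D) \<le> r"
  "card B + card D + card (A \<union> C) \<le> r"
  "card C + card D + card (A \<union> B) \<le> r"
  "card A + card B + card C + card D \<le> r"
proof -
  show "card A + card (B \<union> C \<union> D) \<le> r"
    using Un_le(4) Un_le(10) r by linarith
  show "card B + card (A \<union> C \<union> D) \<le> r"
    using Un_le(2) Un_le(9) r by linarith
  show "card C + card (A \<union> B \<union> D) \<le> r"
    using Un_le(1) Un_le(8) r by linarith
  show "card D + card (A \<union> B \<union> C) \<le> r"
    using Un_le(1) Un_le(7) r by linarith
  show "card (A \<union> B) + card (C \<union> D) \<le> r"
    using Un_le(1) Un_le(6) r by linarith
  show "card (A \<union> C) + card (B \<union> D) \<le> r"
    using Un_le(2) Un_le(5) r by linarith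
  show "card (A \<union> D) + card (B \<union> C) \<le> r"
    using Un_le(3) Un_le(4) r by linarith
  show "card A + card B + card (C \<union> D) \<le> r"
    using Un_le(6) r by linarith
  show "card A + card C + card (B \<union> D) \<le> r"
    using Un_le(5) r by linarith
  show "card A + card D + card (B \<union> C) \<le> r"
    using Un_le(4) r by linarith
  show "card B + card C + card (A \<union> D) \<le> r"
    using Un_le(3) r by linarith
  show "card B + card D + card (A \<union> C) \<le> r"
    using Un_le(2) r by linarith
  show "card C + card D + card (A \<union> B) \<le> r"
    using Un_le(1) r by linarith
  show "card A + card B + card C + card D \<le> r"
    using  r by linarith
qed

text \<open>The coefficients sum to 0, so only the differences of the moment products matter, and two powers of \<open>p\<close> with exponents between \<open>u\<close> and \<open>r\<close> differ
by at most \<open>r * (1 - p) * p ^ u\<close>. The constant 13 is the sum of the absolute values of the negative coefficients, \<open>4 + 3 + 6\<close>.\<close>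

lemma abs_joint_cumulant_le: "\<bar>joint_cumulant p A B C D\<bar> \<le> 13 * real r * (1 - p) * p ^ u"
proof -
  define z where "z = real r * (1 - p) * p ^ u"
  have hi: "p ^ m \<le> p ^ u" and lo: "p ^ u - z \<le> p ^ m" if "u \<le> m" "m \<le> r" for m
  proof -
    show "p ^ m \<le> p ^ u" using that p by (intro power_decreasing) auto
    have "1 - p ^ (m - u) \<le> real (m - u) * (1 - p)" using one_minus_power_le p by auto
    also have "\<dots> \<le> real r * (1 - p)" using that p by (intro mult_right_mono) auto
    finally have "p ^ u * (1 - p ^ (m - u)) \<le> p ^ u * (real r * (1 - p))" using p by (intro mult_left_mono) auto
    then have "p ^ u - p ^ (u + (m - u)) \<le> z" by (simp add: power_add right_diff_distrib z_def mult_ac)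
    then show "p ^ u - z \<le> p ^ m" using that by simp
  qed
  have z: "0 \<le> z" using p by (simp add: z_def)
  have "joint_cumulant p A B C D \<le> cumulant_combination (p ^ u) (p ^ u - z) (p ^ u - z) (p ^ u - z) (p ^ u - z) (p ^ u - z) (p ^ u - z) (p ^ u - z) (p ^ u) (p ^ u) (p ^ u) (p ^ u) (p ^ u) (p ^ u) (p ^ u - z)"
    unfolding joint_cumulant_combination
    by (rule cumulant_combination_mono[OF order_refl lo[OF le_block_sums(1) block_sums_le(1)] lo[OF le_block_sums(2) block_sums_le(2)] lo[OF le_block_sums(3) block_sums_le(3)] lo[OF le_block_sums(4) block_sums_le(4)] lo[OF le_block_sums(5) block_sums_le(5)] lo[OF le_block_sums(6) block_sums_le(6)] lo[OF le_block_sums(7) block_sums_le(7)] hi[OF le_block_sums(8) block_sums_le(8)] hi[OF le_block_sums(9) block_sums_le(9)] hi[OF le_block_sums(10) block_sums_le(10)] hi[OF le_block_sums(11) block_sums_le(11)] hi[OF le_block_sums(12) block_sums_le(12)] hi[OF le_block_sums(13) block_sums_le(13)] lo[OF le_block_sums(14) block_sums_le(14)]])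
  then have "joint_cumulant p A B C D \<le> 13 * z" unfolding cumulant_combination_def by simp
  moreover have "cumulant_combination (p ^ u) (p ^ u) (p ^ u) (p ^ u) (p ^ u) (p ^ u) (p ^ u) (p ^ u) (p ^ u - z) (p ^ u - z) (p ^ u - z) (p ^ u - z) (p ^ u - z) (p ^ u - z) (p ^ u) \<le> joint_cumulant p A B C D"
    unfolding joint_cumulant_combination
    by (rule cumulant_combination_mono[OF order_refl hi[OF le_block_sums(1) block_sums_le(1)] hi[OF le_block_sums(2) block_sums_le(2)] hi[OF le_block_sums(3) block_sums_le(3)] hi[OF le_block_sums(4) block_sums_le(4)] hi[OF le_block_sums(5) block_sums_le(5)] hi[OF le_block_sums(6) block_sums_le(6)] hi[OF le_block_sums(7) block_sums_le(7)] lo[OF le_block_sums(8) block_sums_le(8)] lo[OF le_block_sums(9) block_sums_le(9)] lo[OF le_block_sums(10) block_sums_le(10)] lo[OF le_block_sums(11) block_sums_le(11)] lo[OF le_block_sums(12) block_sums_le(12)] lo[OF le_block_sums(13) block_sums_le(13)] hi[OF le_block_sums(14) block_sums_le(14)]])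
  then have "- (13 * z) \<le> joint_cumulant p A B C D" using z unfolding cumulant_combination_def by simp
  ultimately have "\<bar>joint_cumulant p A B C D\<bar> \<le> 13 * z" by linarith
  then show ?thesis by (simp add: z_def)
qed

text \<open>For a linked quadruple the sizes of the blocks of any nontrivial partition add up to more than the size of the union, so the negative
terms carry an extra factor \<open>p\<close>.\<close>

lemma joint_cumulant_ge_small_p:
  assumes "linked A B C D"
  shows "(1 - 13 * p) * p ^ u \<le> joint_cumulant p A B C D"
proof -
  have *: "0 \<le> p ^ m" for m using p by simp
  have **: "p ^ m \<le> p * p ^ u" if "u + 1 \<le> m" for m
    using power_decreasing[OF that, of p] p by simp
  have strict: "u + 1 \<le> card X + card Y" if "X \<inter> Y \<noteq> {}" "X \<union> Y = A \<union> B \<union> C \<union> D" for X Y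
  proof -
    have "finite (X \<union> Y)" unfolding that(2) using fin by simp
    then have "finite X" "finite Y" by simp_all
    then show ?thesis using card_Un_less_sum[of X Y] that by simp
  qed
  have strict1: "u + 1 \<le> card (A) + card (B \<union> C \<union> D)"
    using assms unfolding linked_def by (intro strict) (simp_all only: simp_thms Un_ac)
  have strict2: "u + 1 \<le> card (B) + card (A \<union> C \<union> D)"
    using assms unfolding linked_def by (intro strict) (simp_all only: simp_thms Un_ac)
  have strict3: "u + 1 \<le> card (C) + card (A \<union> B \<union> D)"
    using assms unfolding linked_def by (intro strict) (simp_all only: simp_thms Un_ac)
  have strict4: "u + 1 \<le> card (D) + card (A \<union> B \<union> C)"
    using assms unfolding linked_def by (intro strict) (simp_all only: simp_thms Un_ac)
  have strict5: "u + 1 \<le> card (A \<union> B) + card (C \<union> D)"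
    using assms unfolding linked_def by (intro strict) (simp_all only: simp_thms Un_ac)
  have strict6: "u + 1 \<le> card (A \<union> C) + card (B \<union> D)"
    using assms unfolding linked_def by (intro strict) (simp_all only: simp_thms Un_ac)
  have strict7: "u + 1 \<le> card (A \<union> D) + card (B \<union> C)"
    using assms unfolding linked_def by (intro strict) (simp_all only: simp_thms Un_ac)
  note 1 = strict1 strict2 strict3 strict4 strict5 strict6 strict7
  have 2: "u + 1 \<le> card A + card B + card C + card D" using 1(5) Un_le(1) Un_le(6) by linarith
  have "cumulant_combination (p ^ u) (p * p ^ u) (p * p ^ u) (p * p ^ u) (p * p ^ u) (p * p ^ u) (p * p ^ u) (p * p ^ u) (0) (0) (0) (0) (0) (0) (p * p ^ u) \<le> joint_cumulant p A B C D"
    unfolding joint_cumulant_combination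
    by (rule cumulant_combination_mono[OF order_refl **[OF 1(1)] **[OF 1(2)] **[OF 1(3)] **[OF 1(4)] **[OF 1(5)] **[OF 1(6)] **[OF 1(7)] * * * * * * **[OF 2]])
  then have "p ^ u - 13 * (p * p ^ u) \<le> joint_cumulant p A B C D" unfolding cumulant_combination_def by simp
  then show ?thesis by (simp add: left_diff_distrib)
qed

text \<open>Expand every power of \<open>p = 1 - q\<close> to first order in \<open>q\<close>; the first order terms are collected by inclusion and exclusion.\<close>

lemma joint_cumulant_ge_large_p:
  "(1 - p) * real (card (A \<inter> B \<inter> C \<inter> D)) - 13 * (real r * (1 - p))\<^sup>2 \<le> joint_cumulant p A B C D"
proof -
  define q where "q = 1 - p"
  have q: "0 \<le> q" "q \<le> 1" using p by (auto simp: q_def)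
  define z where "z = (real r * q)\<^sup>2"
  have p_eq: "p = 1 - q" by (simp add: q_def)
  have lo: "1 - q * real m \<le> p ^ m" for m
    using one_minus_power_le[OF p, of m] by (simp add: q_def mult_ac)
  have up: "p ^ m \<le> 1 - q * real m + z" if "m \<le> r" for m
  proof -
    have "p ^ m \<le> 1 - real m * q + (real m * q)\<^sup>2" using power_near_one_upper[OF q, of m] by (simp add: p_eq)
    also have "(real m * q)\<^sup>2 \<le> z" unfolding z_def using that q by (intro power_mono mult_right_mono) auto
    finally show ?thesis by (simp add: mult_ac)
  qed
  have signed_sum: "real (card A + card (B \<union> C \<union> D)) + real (card B + card (A \<union> C \<union> D)) + real (card C + card (A \<union> B \<union> D)) + real (card D + card (A \<union> B \<union> C)) + real (card (A \<union> B) + card (C \<union> D)) + real (card (A \<union> C) + card (B \<union> D)) + real (card (A \<union> D) + card (B \<union> C)) - real u - 2 * (real (card A + card B + card (C \<union> D)) + real (card A + card C + card (B \<union> D)) + real (card A + card D + card (B \<union> C)) + real (card B + card C + card (A \<union> D)) + real (card B + card D + card (A \<union> C)) + real (card C + card D + card (A \<union> B))) + 6 * real (card A + card B + card C + card D) = real (card (A \<inter> B \<inter> C \<inter> D))"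
    unfolding inclusion_exclusion4[OF fin] of_nat_add by simp
  have "cumulant_combination (1 - q * real u) (1 - q * real (card A + card (B \<union> C \<union> D)) + z) (1 - q * real (card B + card (A \<union> C \<union> D)) + z) (1 - q * real (card C + card (A \<union> B \<union> D)) + z) (1 - q * real (card D + card (A \<union> B \<union> C)) + z) (1 - q * real (card (A \<union> B) + card (C \<union> D)) + z) (1 - q * real (card (A \<union> C) + card (B \<union> D)) + z) (1 - q * real (card (A \<union> D) + card (B \<union> C)) + z) (1 - q * real (card A + card B + card (C \<union> D))) (1 - q * real (card A + card C + card (B \<union> D))) (1 - q * real (card A + card D + card (B \<union> C))) (1 - q * real (card B + card C + card (A \<union> D))) (1 - q * real (card B + card D + card (A \<union> C))) (1 - q * real (card C + card D + card (A \<union> B))) (1 - q * real (card A + card B + card C + card D) + z) \<le> joint_cumulant p A B C D"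
    unfolding joint_cumulant_combination
    by (rule cumulant_combination_mono[OF lo up[OF block_sums_le(1)] up[OF block_sums_le(2)] up[OF block_sums_le(3)] up[OF block_sums_le(4)] up[OF block_sums_le(5)] up[OF block_sums_le(6)] up[OF block_sums_le(7)] lo lo lo lo lo lo up[OF block_sums_le(14)]])
  then have "q * real (card (A \<inter> B \<inter> C \<inter> D)) - 13 * z \<le> joint_cumulant p A B C D"
    unfolding cumulant_combination_near_one signed_sum .
  then show ?thesis by (simp add: z_def q_def)
qed

end

section \<open>The fourth cumulant of a sum of indicators\<close>

context indicator_sum
begin

lemma centred_fourth_product:
  assumes S: "A \<subseteq> S" "B \<subseteq> S" "C \<subseteq> S" "D \<subseteq> S"
  defines "a \<equiv> \<lambda>A \<omega>. incl A \<omega> - p ^ card A"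
  shows "Ex (\<lambda>\<omega>. a A \<omega> * a B \<omega> * (a C \<omega> * a D \<omega>)) - Ex (\<lambda>\<omega>. a A \<omega> * a B \<omega>) * Ex (\<lambda>\<omega>. a C \<omega> * a D \<omega>)
     - Ex (\<lambda>\<omega>. a A \<omega> * a C \<omega>) * Ex (\<lambda>\<omega>. a B \<omega> * a D \<omega>) - Ex (\<lambda>\<omega>. a A \<omega> * a D \<omega>) * Ex (\<lambda>\<omega>. a B \<omega> * a C \<omega>)
     = joint_cumulant p A B C D"
proof -
  define PA PB PC PD where "PA = p ^ card A" "PB = p ^ card B" "PC = p ^ card C" "PD = p ^ card D"
  have "(\<lambda>\<omega>. a A \<omega> * a B \<omega> * (a C \<omega> * a D \<omega>)) = (\<lambda>\<omega>.
     incl (A \<union> B \<union> C \<union> D) \<omega> - PA * incl (B \<union> C \<union> D) \<omega> - PB * incl (A \<union> C \<union> D) \<omega> - PC * incl (A \<union> B \<union> D) \<omega> - PD * incl (A \<union> B \<union> C) \<omega>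
     + PA * PB * incl (C \<union> D) \<omega> + PA * PC * incl (B \<union> D) \<omega> + PA * PD * incl (B \<union> C) \<omega>
     + PB * PC * incl (A \<union> D) \<omega> + PB * PD * incl (A \<union> C) \<omega> + PC * PD * incl (A \<union> B) \<omega>
     - PB * PC * PD * incl A \<omega> - PA * PC * PD * incl B \<omega> - PA * PB * PD * incl C \<omega> - PA * PB * PC * incl D \<omega> + PA * PB * PC * PD)"
    unfolding a_def PA_PB_PC_PD_def[symmetric] by (rule ext) (simp add: incl_mult[symmetric] algebra_simps)
  then have 4: "Ex (\<lambda>\<omega>. a A \<omega> * a B \<omega> * (a C \<omega> * a D \<omega>)) =
     p ^ card (A \<union> B \<union> C \<union> D) - PA * p ^ card (B \<union> C \<union> D) - PB * p ^ card (A \<union> C \<union> D) - PC * p ^ card (A \<union> B \<union> D) - PD * p ^ card (A \<union> B \<union> C)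
     + PA * PB * p ^ card (C \<union> D) + PA * PC * p ^ card (B \<union> D) + PA * PD * p ^ card (B \<union> C)
     + PB * PC * p ^ card (A \<union> D) + PB * PD * p ^ card (A \<union> C) + PC * PD * p ^ card (A \<union> B)
     - PB * PC * PD * PA - PA * PC * PD * PB - PA * PB * PD * PC - PA * PB * PC * PD + PA * PB * PC * PD"
    using S by (simp only: bexp_add bexp_diff bexp_cmult bexp_const[OF finite_S] bexp_incl[OF finite_S] Un_subset_iff PA_PB_PC_PD_def)
  have 2: "Ex (\<lambda>\<omega>. a X \<omega> * a Y \<omega>) = p ^ card (X \<union> Y) - p ^ card X * p ^ card Y" if "X \<subseteq> S" "Y \<subseteq> S" for X Y
    unfolding a_def bexp_incl_centred_mult[OF that] by (simp add: power_add)
  show ?thesis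
    unfolding 4 2[OF S(1,2)] 2[OF S(1,3)] 2[OF S(1,4)] 2[OF S(3,4)] 2[OF S(2,4)] 2[OF S(2,3)] joint_cumulant_def power_add PA_PB_PC_PD_def[symmetric]
    by (simp add: algebra_simps)
qed

lemma N_centred_sum: "N \<omega> - mu = (\<Sum>k\<in>K. incl (E k) \<omega> - p ^ card (E k))"
  unfolding N_def mu_def by (simp add: sum_subtractf card_E)

lemma s2_eq: "s2 = (\<Sum>k\<in>K. \<Sum>l\<in>K. p ^ card (E k \<union> E l) - p ^ (card (E k) + card (E l)))"
proof -
  have "s2 = (\<Sum>k\<in>K. \<Sum>l\<in>K. Ex (\<lambda>\<omega>. (incl (E k) \<omega> - p ^ card (E k)) * (incl (E l) \<omega> - p ^ card (E l))))"
    unfolding s2_def N_centred_sum power2_eq_square sum_product bexp_sum ..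
  also have "\<dots> = (\<Sum>k\<in>K. \<Sum>l\<in>K. p ^ card (E k \<union> E l) - p ^ (card (E k) + card (E l)))"
    by (intro sum.cong refl bexp_incl_centred_mult E_subset)
  finally show ?thesis .
qed

lemma double_sum_product:
  "(\<Sum>k\<in>K. \<Sum>l\<in>K. f k l) * (\<Sum>k\<in>K. \<Sum>l\<in>K. h k l) = (\<Sum>k\<in>K. \<Sum>l\<in>K. \<Sum>k'\<in>K. \<Sum>l'\<in>K. f k l * (h k' l' :: real))"
  by (simp only: sum_distrib_right, simp only: sum_distrib_left)

text \<open>Fourth cumulants are multilinear. The three pairings of the indices give the same total \<open>s2\<^sup>2\<close>.\<close>

lemma fourth_cumulant:
  "Ex (\<lambda>\<omega>. (N \<omega> - mu) ^ 4) - 3 * s2\<^sup>2 = (\<Sum>k\<in>K. \<Sum>l\<in>K. \<Sum>k'\<in>K. \<Sum>l'\<in>K. joint_cumulant p (E k) (E l) (E k') (E l'))"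
proof -
  define a where "a k \<omega> = incl (E k) \<omega> - p ^ card (E k)" for k \<omega>
  define c where "c k l = Ex (\<lambda>\<omega>. a k \<omega> * a l \<omega>)" for k l
  have N: "N \<omega> - mu = (\<Sum>k\<in>K. a k \<omega>)" for \<omega> unfolding N_centred_sum a_def ..
  have s: "s2 = (\<Sum>k\<in>K. \<Sum>l\<in>K. c k l)"
    unfolding s2_def N power2_eq_square sum_product bexp_sum c_def ..
  have 4: "Ex (\<lambda>\<omega>. (N \<omega> - mu) ^ 4) = (\<Sum>k\<in>K. \<Sum>l\<in>K. \<Sum>k'\<in>K. \<Sum>l'\<in>K. Ex (\<lambda>\<omega>. a k \<omega> * a l \<omega> * (a k' \<omega> * a l' \<omega>)))"
  proof -
    have x4: "x ^ 4 = (x * x) * (x * x)" for x :: real by (simp add: power4_eq_xxxx)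
    have "(N \<omega> - mu) ^ 4 = (\<Sum>k\<in>K. \<Sum>l\<in>K. \<Sum>k'\<in>K. \<Sum>l'\<in>K. a k \<omega> * a l \<omega> * (a k' \<omega> * a l' \<omega>))" for \<omega>
      unfolding N x4 sum_product[of "\<lambda>k. a k \<omega>" K "\<lambda>k. a k \<omega>" K] by (rule double_sum_product)
    then show ?thesis by (simp only: bexp_sum)
  qed
  have s1: "s2\<^sup>2 = (\<Sum>k\<in>K. \<Sum>l\<in>K. \<Sum>k'\<in>K. \<Sum>l'\<in>K. c k l * c k' l')"
    unfolding s power2_eq_square by (rule double_sum_product)
  have s2': "s2\<^sup>2 = (\<Sum>k\<in>K. \<Sum>l\<in>K. \<Sum>k'\<in>K. \<Sum>l'\<in>K. c k k' * c l l')"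
    unfolding s1 by (rule sum.cong[OF refl]) (rule sum.swap)
  have s3: "s2\<^sup>2 = (\<Sum>k\<in>K. \<Sum>l\<in>K. \<Sum>k'\<in>K. \<Sum>l'\<in>K. c k l' * c l k')"
    unfolding s2' by (rule sum.cong[OF refl], rule sum.cong[OF refl]) (rule sum.swap)
  have three: "3 * x = a + b + c" if "x = a" "x = b" "x = c" for a b c x :: real
    using that by simp
  have "Ex (\<lambda>\<omega>. (N \<omega> - mu) ^ 4) - 3 * s2\<^sup>2 = (\<Sum>k\<in>K. \<Sum>l\<in>K. \<Sum>k'\<in>K. \<Sum>l'\<in>K. Ex (\<lambda>\<omega>. a k \<omega> * a l \<omega> * (a k' \<omega> * a l' \<omega>)))
      - ((\<Sum>k\<in>K. \<Sum>l\<in>K. \<Sum>k'\<in>K. \<Sum>l'\<in>K. c k l * c k' l') + (\<Sum>k\<in>K. \<Sum>l\<in>K. \<Sum>k'\<in>K. \<Sum>l'\<in>K. c k k' * c l l') + (\<Sum>k\<in>K. \<Sum>l\<in>K. \<Sum>k'\<in>K. \<Sum>l'\<in>K. c k l' * c l k'))"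
    unfolding 4 three[OF s1 s2' s3] ..
  also have "\<dots> = (\<Sum>k\<in>K. \<Sum>l\<in>K. \<Sum>k'\<in>K. \<Sum>l'\<in>K.
      Ex (\<lambda>\<omega>. a k \<omega> * a l \<omega> * (a k' \<omega> * a l' \<omega>)) - c k l * c k' l' - c k k' * c l l' - c k l' * c l k')"
    by (simp only: sum_subtractf sum.distrib diff_diff_eq)
  also have "\<dots> = (\<Sum>k\<in>K. \<Sum>l\<in>K. \<Sum>k'\<in>K. \<Sum>l'\<in>K. joint_cumulant p (E k) (E l) (E k') (E l'))"
    unfolding c_def a_def by (intro sum.cong refl centred_fourth_product E_subset)
  finally show ?thesis .
qed

lemma Q_eq: "Q = (\<Sum>k\<in>K. \<Sum>l\<in>K. \<Sum>k'\<in>K. \<Sum>l'\<in>K. of_bool (linked (E k) (E l) (E k') (E l')) * p ^ card (E k \<union> E l \<union> E k' \<union> E l'))"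
  unfolding Q_def sum.cartesian_product[symmetric] ..

lemma four_sets: "k \<in> K \<Longrightarrow> l \<in> K \<Longrightarrow> k' \<in> K \<Longrightarrow> l' \<in> K \<Longrightarrow> four_sets (E k) (E l) (E k') (E l') p (4 * e)"
  using finite_E card_E p_bounds by unfold_locales auto

lemma abs_sum4:
  "\<bar>\<Sum>k\<in>K. \<Sum>l\<in>K. \<Sum>k'\<in>K. \<Sum>l'\<in>K. f k l k' l'\<bar> \<le> (\<Sum>k\<in>K. \<Sum>l\<in>K. \<Sum>k'\<in>K. \<Sum>l'\<in>K. \<bar>f k l k' l' :: real\<bar>)"
proof -
  have 2: "\<bar>\<Sum>k'\<in>K. \<Sum>l'\<in>K. f k l k' l'\<bar> \<le> (\<Sum>k'\<in>K. \<Sum>l'\<in>K. \<bar>f k l k' l'\<bar>)" for k l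
    by (rule order_trans[OF sum_abs sum_mono[OF sum_abs]])
  have 3: "\<bar>\<Sum>l\<in>K. \<Sum>k'\<in>K. \<Sum>l'\<in>K. f k l k' l'\<bar> \<le> (\<Sum>l\<in>K. \<Sum>k'\<in>K. \<Sum>l'\<in>K. \<bar>f k l k' l'\<bar>)" for k
    by (rule order_trans[OF sum_abs sum_mono[OF 2]])
  show ?thesis by (rule order_trans[OF sum_abs sum_mono[OF 3]])
qed

lemma joint_cumulant_0:
  assumes "k \<in> K" "l \<in> K" "k' \<in> K" "l' \<in> K" "\<not> linked (E k) (E l) (E k') (E l')"
  shows "joint_cumulant p (E k) (E l) (E k') (E l') = 0"
  by (rule joint_cumulant_unlinked) (use assms finite_E in auto)

lemma abs_fourth_cumulant_le: "\<bar>Ex (\<lambda>\<omega>. (N \<omega> - mu) ^ 4) - 3 * s2\<^sup>2\<bar> \<le> 52 * real e * (1 - p) * Q"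
proof -
  have "\<bar>Ex (\<lambda>\<omega>. (N \<omega> - mu) ^ 4) - 3 * s2\<^sup>2\<bar> \<le> (\<Sum>k\<in>K. \<Sum>l\<in>K. \<Sum>k'\<in>K. \<Sum>l'\<in>K. \<bar>joint_cumulant p (E k) (E l) (E k') (E l')\<bar>)"
    unfolding fourth_cumulant by (rule abs_sum4)
  also have "\<dots> \<le> (\<Sum>k\<in>K. \<Sum>l\<in>K. \<Sum>k'\<in>K. \<Sum>l'\<in>K. 52 * real e * (1 - p) * (of_bool (linked (E k) (E l) (E k') (E l')) * p ^ card (E k \<union> E l \<union> E k' \<union> E l')))"
  proof (intro sum_mono)
    fix k l k' l' assume K: "k \<in> K" "l \<in> K" "k' \<in> K" "l' \<in> K"
    show "\<bar>joint_cumulant p (E k) (E l) (E k') (E l')\<bar> \<le> 52 * real e * (1 - p) * (of_bool (linked (E k) (E l) (E k') (E l')) * p ^ card (E k \<union> E l \<union> E k' \<union> E l'))"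
    proof (cases "linked (E k) (E l) (E k') (E l')")
      case True
      then show ?thesis using four_sets.abs_joint_cumulant_le[OF four_sets[OF K]] by simp
    next
      case False
      then show ?thesis using joint_cumulant_0[OF K] by simp
    qed
  qed
  also have "\<dots> = 52 * real e * (1 - p) * Q" unfolding Q_eq sum_distrib_left ..
  finally show ?thesis .
qed

lemma fourth_cumulant_ge_small_p: "(1 - 13 * p) * Q \<le> Ex (\<lambda>\<omega>. (N \<omega> - mu) ^ 4) - 3 * s2\<^sup>2"
  unfolding fourth_cumulant Q_eq sum_distrib_left
proof (intro sum_mono)
  fix k l k' l' assume K: "k \<in> K" "l \<in> K" "k' \<in> K" "l' \<in> K"
  show "(1 - 13 * p) * (of_bool (linked (E k) (E l) (E k') (E l')) * p ^ card (E k \<union> E l \<union> E k' \<union> E l')) \<le> joint_cumulant p (E k) (E l) (E k') (E l')"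
  proof (cases "linked (E k) (E l) (E k') (E l')")
    case True
    then show ?thesis using four_sets.joint_cumulant_ge_small_p[OF four_sets[OF K]] by simp
  next
    case False
    then show ?thesis using joint_cumulant_0[OF K] by simp
  qed
qed

text \<open>The factor \<open>2 ^ (4 * e)\<close> compensates the powers of \<open>p \<ge> 1 / 2\<close> in \<open>Q\<close>, which here only counts the linked quadruples.\<close>

lemma fourth_cumulant_ge_large_p:
  assumes "1 / 2 \<le> p"
  shows "(1 - p) * (\<Sum>k\<in>K. \<Sum>l\<in>K. \<Sum>k'\<in>K. \<Sum>l'\<in>K. real (card (E k \<inter> E l \<inter> E k' \<inter> E l'))) - 208 * real e ^ 2 * 2 ^ (4 * e) * (1 - p)\<^sup>2 * Q
    \<le> Ex (\<lambda>\<omega>. (N \<omega> - mu) ^ 4) - 3 * s2\<^sup>2"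
  unfolding fourth_cumulant Q_eq sum_distrib_left sum_subtractf[symmetric]
proof (intro sum_mono)
  fix k l k' l' assume K: "k \<in> K" "l \<in> K" "k' \<in> K" "l' \<in> K"
  let ?u = "card (E k \<union> E l \<union> E k' \<union> E l')"
  show "(1 - p) * real (card (E k \<inter> E l \<inter> E k' \<inter> E l')) - 208 * real e ^ 2 * 2 ^ (4 * e) * (1 - p)\<^sup>2 * (of_bool (linked (E k) (E l) (E k') (E l')) * p ^ ?u)
      \<le> joint_cumulant p (E k) (E l) (E k') (E l')"
  proof (cases "linked (E k) (E l) (E k') (E l')")
    case True
    have "?u \<le> 4 * e" using card_Un4_le[of "E k" "E l" "E k'" "E l'"] card_E K by simp
    then have "(1/2) ^ (4 * e) \<le> p ^ ?u"
      using assms p_bounds power_decreasing[of ?u "4 * e" p] power_mono[of "1/2" p "4 * e"] by linarith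
    then have "2 ^ (4 * e) * (1/2 :: real) ^ (4 * e) \<le> 2 ^ (4 * e) * p ^ ?u" by (intro mult_left_mono) auto
    then have "1 \<le> 2 ^ (4 * e) * p ^ ?u" by (simp add: power_divide)
    then have "208 * real e ^ 2 * (1 - p)\<^sup>2 * 1 \<le> 208 * real e ^ 2 * (1 - p)\<^sup>2 * (2 ^ (4 * e) * p ^ ?u)"
      by (intro mult_left_mono) auto
    moreover have "13 * (real (4 * e) * (1 - p))\<^sup>2 = 208 * real e ^ 2 * (1 - p)\<^sup>2 * 1"
      by (simp add: power_mult_distrib)
    moreover have "208 * real e ^ 2 * (1 - p)\<^sup>2 * (2 ^ (4 * e) * p ^ ?u) = 208 * real e ^ 2 * 2 ^ (4 * e) * (1 - p)\<^sup>2 * (of_bool (linked (E k) (E l) (E k') (E l')) * p ^ ?u)"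
      using True by simp
    ultimately have "13 * (real (4 * e) * (1 - p))\<^sup>2 \<le> 208 * real e ^ 2 * 2 ^ (4 * e) * (1 - p)\<^sup>2 * (of_bool (linked (E k) (E l) (E k') (E l')) * p ^ ?u)"
      by (simp only:)
    then show ?thesis using four_sets.joint_cumulant_ge_large_p[OF four_sets[OF K]]
      by (meson diff_left_mono order_trans)
  next
    case False
    then have "E k \<inter> E l \<inter> E k' \<inter> E l' = {}" unfolding linked_def by blast
    then show ?thesis using joint_cumulant_0[OF K False] False by simp
  qed
qed

end

section \<open>Estimates for sums over linked quadruples\<close>

text \<open>Each set meets the union of its predecessors. A linked quadruple is a chain in some order that starts with its first set.\<close>

definition chain :: "'s set \<Rightarrow> 's set \<Rightarrow> 's set \<Rightarrow> 's set \<Rightarrow> bool" where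
  "chain A B C D \<longleftrightarrow> B \<inter> A \<noteq> {} \<and> C \<inter> (A \<union> B) \<noteq> {} \<and> D \<inter> (A \<union> B \<union> C) \<noteq> {}"

lemma linked_imp_chain:
  assumes "linked A B C D"
  shows "chain A B C D \<or> chain A B D C \<or> chain A C B D \<or> chain A C D B \<or> chain A D B C \<or> chain A D C B"
proof -
  have comm: "B \<inter> A = A \<inter> B" "C \<inter> A = A \<inter> C" "D \<inter> A = A \<inter> D" "C \<inter> B = B \<inter> C" "D \<inter> B = B \<inter> D" "D \<inter> C = C \<inter> D"
    by blast+
  show ?thesis
    using assms unfolding linked_def chain_def Int_Un_distrib Int_Un_distrib2 Un_empty comm by argo
qed

lemma triple_sum_permute:
  fixes f :: "'k \<Rightarrow> 'k \<Rightarrow> 'k \<Rightarrow> real"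
  shows "(\<Sum>b\<in>K. \<Sum>c\<in>K. \<Sum>d\<in>K. f b d c) = (\<Sum>b\<in>K. \<Sum>c\<in>K. \<Sum>d\<in>K. f b c d)"
    and "(\<Sum>b\<in>K. \<Sum>c\<in>K. \<Sum>d\<in>K. f c b d) = (\<Sum>b\<in>K. \<Sum>c\<in>K. \<Sum>d\<in>K. f b c d)"
    and "(\<Sum>b\<in>K. \<Sum>c\<in>K. \<Sum>d\<in>K. f c d b) = (\<Sum>b\<in>K. \<Sum>c\<in>K. \<Sum>d\<in>K. f b c d)"
    and "(\<Sum>b\<in>K. \<Sum>c\<in>K. \<Sum>d\<in>K. f d b c) = (\<Sum>b\<in>K. \<Sum>c\<in>K. \<Sum>d\<in>K. f b c d)"
    and "(\<Sum>b\<in>K. \<Sum>c\<in>K. \<Sum>d\<in>K. f d c b) = (\<Sum>b\<in>K. \<Sum>c\<in>K. \<Sum>d\<in>K. f b c d)"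
proof -
  have 1: "(\<Sum>b\<in>K. \<Sum>c\<in>K. \<Sum>d\<in>K. f b d c) = (\<Sum>b\<in>K. \<Sum>c\<in>K. \<Sum>d\<in>K. f b c d)" for f :: "'k \<Rightarrow> 'k \<Rightarrow> 'k \<Rightarrow> real"
    by (rule sum.cong[OF refl]) (rule sum.swap)
  have 2: "(\<Sum>b\<in>K. \<Sum>c\<in>K. \<Sum>d\<in>K. f c b d) = (\<Sum>b\<in>K. \<Sum>c\<in>K. \<Sum>d\<in>K. f b c d)" for f :: "'k \<Rightarrow> 'k \<Rightarrow> 'k \<Rightarrow> real"
    by (rule sum.swap)
  show "(\<Sum>b\<in>K. \<Sum>c\<in>K. \<Sum>d\<in>K. f b d c) = (\<Sum>b\<in>K. \<Sum>c\<in>K. \<Sum>d\<in>K. f b c d)"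
    by (rule 1[of f])
  show "(\<Sum>b\<in>K. \<Sum>c\<in>K. \<Sum>d\<in>K. f c b d) = (\<Sum>b\<in>K. \<Sum>c\<in>K. \<Sum>d\<in>K. f b c d)"
    by (rule 2[of f])
  show 3: "(\<Sum>b\<in>K. \<Sum>c\<in>K. \<Sum>d\<in>K. f c d b) = (\<Sum>b\<in>K. \<Sum>c\<in>K. \<Sum>d\<in>K. f b c d)"
    using 2[of "\<lambda>b c d. f b d c"] 1[of f] by (rule trans)
  show 4: "(\<Sum>b\<in>K. \<Sum>c\<in>K. \<Sum>d\<in>K. f d b c) = (\<Sum>b\<in>K. \<Sum>c\<in>K. \<Sum>d\<in>K. f b c d)"
    using 1[of "\<lambda>b c d. f c b d"] 2[of f] by (rule trans)
  show "(\<Sum>b\<in>K. \<Sum>c\<in>K. \<Sum>d\<in>K. f d c b) = (\<Sum>b\<in>K. \<Sum>c\<in>K. \<Sum>d\<in>K. f b c d)"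
    using 2[of "\<lambda>b c d. f d b c"] 4 by (rule trans)
qed

text \<open>Apply the Cauchy-Schwarz inequality to the fibre sizes \<open>n x\<close> and to their squares. The sums on the right count the pairs and the quadruples in a common fibre.\<close>

lemma fibre_power_sums:
  fixes D :: "'k \<Rightarrow> 'd"
  assumes fin: "finite K" and M: "card (D ` K) \<le> M"
  defines "n \<equiv> \<lambda>x. real (card {k \<in> K. D k = x})"
  shows "(real (card K))\<^sup>2 \<le> real M * (\<Sum>k\<in>K. n (D k))"
    and "real (card K) ^ 4 \<le> real M ^ 3 * (\<Sum>k\<in>K. n (D k) ^ 3)"
proof -
  have n0: "n x \<ge> 0" for x by (simp add: n_def)
  have gen: "(\<Sum>k\<in>K. h (D k)) = (\<Sum>x\<in>D ` K. n x * h x)" for h :: "_ \<Rightarrow> real"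
  proof -
    have "(\<Sum>k\<in>K. h (D k)) = (\<Sum>x\<in>D ` K. \<Sum>k\<in>{k\<in>K. D k = x}. h (D k))"
      by (rule sum.image_gen[OF fin])
    also have "\<dots> = (\<Sum>x\<in>D ` K. n x * h x)"
      by (intro sum.cong refl) (simp add: n_def)
    finally show ?thesis .
  qed
  have card: "real (card K) = (\<Sum>x\<in>D ` K. n x)" using gen[of "\<lambda>_. 1"] by simp
  have CS: "(\<Sum>x\<in>D ` K. a x)\<^sup>2 \<le> real M * (\<Sum>x\<in>D ` K. (a x)\<^sup>2)" for a :: "_ \<Rightarrow> real"
  proof -
    have "(\<Sum>x\<in>D ` K. 1 * a x)\<^sup>2 \<le> (\<Sum>x\<in>D ` K. 1\<^sup>2) * (\<Sum>x\<in>D ` K. (a x)\<^sup>2)" by (rule Cauchy_Schwarz_ineq_sum)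
    also have "\<dots> \<le> real M * (\<Sum>x\<in>D ` K. (a x)\<^sup>2)"
      using M by (intro mult_right_mono sum_nonneg) auto
    finally show ?thesis by simp
  qed
  have sq: "(real (card K))\<^sup>2 \<le> real M * (\<Sum>x\<in>D ` K. (n x)\<^sup>2)"
    unfolding card by (rule CS)
  show "(real (card K))\<^sup>2 \<le> real M * (\<Sum>k\<in>K. n (D k))"
    using sq gen[of n] by (simp add: power2_eq_square)
  have "real (card K) ^ 4 = ((real (card K))\<^sup>2)\<^sup>2" by simp
  also have "\<dots> \<le> (real M * (\<Sum>x\<in>D ` K. (n x)\<^sup>2))\<^sup>2" by (rule power_mono[OF sq]) simp
  also have "\<dots> = real M ^ 2 * (\<Sum>x\<in>D ` K. (n x)\<^sup>2)\<^sup>2" by (rule power_mult_distrib)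
  also have "\<dots> \<le> real M ^ 2 * (real M * (\<Sum>x\<in>D ` K. ((n x)\<^sup>2)\<^sup>2))" by (intro mult_left_mono CS) simp
  also have "\<dots> = real M ^ 3 * (\<Sum>k\<in>K. n (D k) ^ 3)"
    unfolding gen[of "\<lambda>x. n x ^ 3"] by (simp add: power3_eq_cube power2_eq_square mult.assoc)
  finally show "real (card K) ^ 4 \<le> real M ^ 3 * (\<Sum>k\<in>K. n (D k) ^ 3)" .
qed

context indicator_sum
begin

lemma power_card_Un: "k \<in> K \<Longrightarrow> finite U \<Longrightarrow> p ^ card (U \<union> E k) = p ^ card U * p ^ card (E k - U)"
proof -
  assume "k \<in> K" "finite U"
  then have "card (U \<union> (E k - U)) = card U + card (E k - U)"
    using finite_E by (intro card_Un_disjoint) auto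
  then show ?thesis by (simp add: power_add)
qed

lemma s2_le:
  assumes L: "\<And>U. U \<subseteq> S \<Longrightarrow> card U \<le> 3 * e \<Longrightarrow> (\<Sum>k\<in>K. of_bool (E k \<inter> U \<noteq> {}) * p ^ card (E k - U)) \<le> L"
  shows "s2 \<le> real e * (1 - p) * (real (card K) * p ^ e * L)"
proof -
  have "s2 \<le> (\<Sum>k\<in>K. \<Sum>l\<in>K. of_bool (E k \<inter> E l \<noteq> {}) * (real e * (1 - p) * p ^ card (E k \<union> E l)))"
    unfolding s2_eq using covariance_le[OF E_subset E_subset] by (intro sum_mono) (simp add: card_E)
  also have "\<dots> = (\<Sum>k\<in>K. real e * (1 - p) * p ^ e * (\<Sum>l\<in>K. of_bool (E l \<inter> E k \<noteq> {}) * p ^ card (E l - E k)))"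
    unfolding sum_distrib_left
    by (intro sum.cong refl) (simp add: power_card_Un finite_E card_E Int_commute mult_ac)
  also have "\<dots> \<le> (\<Sum>k\<in>K. real e * (1 - p) * p ^ e * L)"
    using p_bounds by (intro sum_mono mult_left_mono L E_subset) (auto simp: card_E)
  finally show ?thesis by (simp add: mult_ac)
qed

text \<open>Sum over the last set of the chain first: each sum over a set that meets the union of its predecessors costs a factor \<open>L\<close>.\<close>

lemma chain_sum_le:
  assumes L: "\<And>U. U \<subseteq> S \<Longrightarrow> card U \<le> 3 * e \<Longrightarrow> (\<Sum>k\<in>K. of_bool (E k \<inter> U \<noteq> {}) * p ^ card (E k - U)) \<le> L"
    and L0: "L \<ge> 0"
  shows "(\<Sum>a\<in>K. \<Sum>b\<in>K. \<Sum>c\<in>K. \<Sum>d\<in>K. of_bool (chain (E a) (E b) (E c) (E d)) * p ^ card (E a \<union> E b \<union> E c \<union> E d))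
    \<le> real (card K) * p ^ e * L ^ 3"
proof -
  define w where "w U k = of_bool (E k \<inter> U \<noteq> {}) * p ^ card (E k - U)" for U k
  have w0: "w U k \<ge> 0" for U k using p_bounds by (simp add: w_def)
  have wL: "(\<Sum>k\<in>K. w U k) \<le> L" if "U \<subseteq> S" "card U \<le> 3 * e" for U
    using L[OF that] by (simp add: w_def)
  have eq: "of_bool (chain (E a) (E b) (E c) (E d)) * p ^ card (E a \<union> E b \<union> E c \<union> E d)
     = p ^ e * (w (E a) b * (w (E a \<union> E b) c * w (E a \<union> E b \<union> E c) d))"
    if "a \<in> K" "b \<in> K" "c \<in> K" "d \<in> K" for a b c d
    using that finite_E by (simp add: chain_def w_def power_card_Un card_E)
  have "(\<Sum>a\<in>K. \<Sum>b\<in>K. \<Sum>c\<in>K. \<Sum>d\<in>K. of_bool (chain (E a) (E b) (E c) (E d)) * p ^ card (E a \<union> E b \<union> E c \<union> E d))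
    = (\<Sum>a\<in>K. p ^ e * (\<Sum>b\<in>K. w (E a) b * (\<Sum>c\<in>K. w (E a \<union> E b) c * (\<Sum>d\<in>K. w (E a \<union> E b \<union> E c) d))))"
    unfolding sum_distrib_left by (intro sum.cong refl eq)
  also have "\<dots> \<le> (\<Sum>a\<in>K. p ^ e * (\<Sum>b\<in>K. w (E a) b * (\<Sum>c\<in>K. w (E a \<union> E b) c * L)))"
  proof (intro sum_mono mult_left_mono w0 wL)
    fix a b c assume K: "a \<in> K" "b \<in> K" "c \<in> K"
    show "E a \<union> E b \<union> E c \<subseteq> S" using K E_subset by auto
    show "card (E a \<union> E b \<union> E c) \<le> 3 * e"
      using card_Un_le[of "E a \<union> E b" "E c"] card_Un_le[of "E a" "E b"] K card_E by simp
  qed (use p_bounds in auto)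
  also have "\<dots> = (\<Sum>a\<in>K. p ^ e * (\<Sum>b\<in>K. w (E a) b * ((\<Sum>c\<in>K. w (E a \<union> E b) c) * L)))"
    by (simp add: sum_distrib_right)
  also have "\<dots> \<le> (\<Sum>a\<in>K. p ^ e * (\<Sum>b\<in>K. w (E a) b * (L * L)))"
  proof (intro sum_mono mult_left_mono mult_right_mono w0 wL L0)
    fix a b assume K: "a \<in> K" "b \<in> K"
    show "E a \<union> E b \<subseteq> S" using K E_subset by auto
    show "card (E a \<union> E b) \<le> 3 * e"
      using card_Un_le[of "E a" "E b"] K card_E by simp
  qed (use p_bounds in auto)
  also have "\<dots> = (\<Sum>a\<in>K. p ^ e * ((\<Sum>b\<in>K. w (E a) b) * (L * L)))"
    by (simp add: sum_distrib_right)
  also have "\<dots> \<le> (\<Sum>a\<in>K. p ^ e * (L * (L * L)))"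
    using L0 p_bounds by (intro sum_mono mult_left_mono mult_right_mono wL E_subset) (auto simp: card_E)
  finally show ?thesis by (simp add: power3_eq_cube mult_ac)
qed

lemma Q_le:
  assumes L: "\<And>U. U \<subseteq> S \<Longrightarrow> card U \<le> 3 * e \<Longrightarrow> (\<Sum>k\<in>K. of_bool (E k \<inter> U \<noteq> {}) * p ^ card (E k - U)) \<le> L"
    and L0: "L \<ge> 0"
  shows "Q \<le> 6 * (real (card K) * p ^ e * L ^ 3)"
proof -
  define f where "f a b c d = of_bool (chain (E a) (E b) (E c) (E d)) * p ^ card (E a \<union> E b \<union> E c \<union> E d)" for a b c d
  have f0: "f a b c d \<ge> 0" for a b c d using p_bounds by (simp add: f_def)
  have le: "of_bool (linked (E a) (E b) (E c) (E d)) * p ^ card (E a \<union> E b \<union> E c \<union> E d)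
      \<le> f a b c d + f a b d c + f a c b d + f a c d b + f a d b c + f a d c b" for a b c d
  proof (cases "linked (E a) (E b) (E c) (E d)")
    case True
    let ?P = "p ^ card (E a \<union> E b \<union> E c \<union> E d)"
    have un: "E a \<union> E b \<union> E d \<union> E c = E a \<union> E b \<union> E c \<union> E d" "E a \<union> E c \<union> E b \<union> E d = E a \<union> E b \<union> E c \<union> E d"
      "E a \<union> E c \<union> E d \<union> E b = E a \<union> E b \<union> E c \<union> E d" "E a \<union> E d \<union> E b \<union> E c = E a \<union> E b \<union> E c \<union> E d"
      "E a \<union> E d \<union> E c \<union> E b = E a \<union> E b \<union> E c \<union> E d" by blast+
    have P: "0 \<le> ?P" using p_bounds by simp
    have "f a b c d = ?P \<or> f a b d c = ?P \<or> f a c b d = ?P \<or> f a c d b = ?P \<or> f a d b c = ?P \<or> f a d c b = ?P"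
      using linked_imp_chain[OF True] unfolding f_def un by fastforce
    then have "?P \<le> f a b c d + f a b d c + f a c b d + f a c d b + f a d b c + f a d c b"
      using f0[of a b c d] f0[of a b d c] f0[of a c b d] f0[of a c d b] f0[of a d b c] f0[of a d c b] P by linarith
    then show ?thesis using True by simp
  qed (use f0 in \<open>simp add: add_nonneg_nonneg\<close>)
  have perm1: "(\<Sum>a\<in>K. \<Sum>b\<in>K. \<Sum>c\<in>K. \<Sum>d\<in>K. f a b d c) = (\<Sum>a\<in>K. \<Sum>b\<in>K. \<Sum>c\<in>K. \<Sum>d\<in>K. f a b c d)"
    by (rule sum.cong[OF refl]) (rule triple_sum_permute(1))
  have perm2: "(\<Sum>a\<in>K. \<Sum>b\<in>K. \<Sum>c\<in>K. \<Sum>d\<in>K. f a c b d) = (\<Sum>a\<in>K. \<Sum>b\<in>K. \<Sum>c\<in>K. \<Sum>d\<in>K. f a b c d)"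
    by (rule sum.cong[OF refl]) (rule triple_sum_permute(2))
  have perm3: "(\<Sum>a\<in>K. \<Sum>b\<in>K. \<Sum>c\<in>K. \<Sum>d\<in>K. f a c d b) = (\<Sum>a\<in>K. \<Sum>b\<in>K. \<Sum>c\<in>K. \<Sum>d\<in>K. f a b c d)"
    by (rule sum.cong[OF refl]) (rule triple_sum_permute(3))
  have perm4: "(\<Sum>a\<in>K. \<Sum>b\<in>K. \<Sum>c\<in>K. \<Sum>d\<in>K. f a d b c) = (\<Sum>a\<in>K. \<Sum>b\<in>K. \<Sum>c\<in>K. \<Sum>d\<in>K. f a b c d)"
    by (rule sum.cong[OF refl]) (rule triple_sum_permute(4))
  have perm5: "(\<Sum>a\<in>K. \<Sum>b\<in>K. \<Sum>c\<in>K. \<Sum>d\<in>K. f a d c b) = (\<Sum>a\<in>K. \<Sum>b\<in>K. \<Sum>c\<in>K. \<Sum>d\<in>K. f a b c d)"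
    by (rule sum.cong[OF refl]) (rule triple_sum_permute(5))
  have "Q \<le> (\<Sum>a\<in>K. \<Sum>b\<in>K. \<Sum>c\<in>K. \<Sum>d\<in>K. f a b c d + f a b d c + f a c b d + f a c d b + f a d b c + f a d c b)"
    unfolding Q_eq by (intro sum_mono le)
  also have "\<dots> = 6 * (\<Sum>a\<in>K. \<Sum>b\<in>K. \<Sum>c\<in>K. \<Sum>d\<in>K. f a b c d)"
    unfolding sum.distrib perm1 perm2 perm3 perm4 perm5 by simp
  also have "\<dots> \<le> 6 * (real (card K) * p ^ e * L ^ 3)"
    using chain_sum_le[OF L L0] unfolding f_def by simp
  finally show ?thesis .
qed

end

text \<open>Each set \<open>E k\<close> contains a distinguished nonempty subset \<open>D k\<close> of fixed size, and few subsets occur. Pairs and quadruples with the same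
distinguished subset overlap at least in this subset; their number gives the lower bounds.\<close>

locale indicator_sum_fibres = indicator_sum S p K E e
  for S :: "'s set" and p and K :: "'k set" and E and e +
  fixes D :: "'k \<Rightarrow> 's set" and f M :: nat
  assumes D_subset: "k \<in> K \<Longrightarrow> D k \<subseteq> E k" and card_D: "k \<in> K \<Longrightarrow> card (D k) = f" and f_pos: "f \<ge> 1"
    and card_image_D: "card (D ` K) \<le> M"
begin

lemma f_le_e: "k \<in> K \<Longrightarrow> f \<le> e"
  using card_mono[OF finite_E D_subset] card_D card_E by metis

lemma finite_D: "k \<in> K \<Longrightarrow> finite (D k)" and D_nonempty: "k \<in> K \<Longrightarrow> D k \<noteq> {}"
  using finite_subset[OF D_subset finite_E] card_D f_pos by fastforce+

lemma fibre_card: "(\<Sum>l\<in>K. of_bool (D k = D l)) = real (card {l \<in> K. D l = D k})"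
  using finite_K by (simp add: sum_of_bool_eq Int_def eq_commute)

lemma pair_count: "(real (card K))\<^sup>2 \<le> real M * (\<Sum>k\<in>K. \<Sum>l\<in>K. of_bool (D k = D l))"
  unfolding fibre_card using fibre_power_sums(1)[OF finite_K card_image_D] .

lemma quad_count: "real (card K) ^ 4 \<le> real M ^ 3 * (\<Sum>k\<in>K. \<Sum>l\<in>K. \<Sum>k'\<in>K. \<Sum>l'\<in>K. of_bool (D k = D l \<and> D k = D k' \<and> D k = D l'))"
proof -
  have "(\<Sum>k\<in>K. \<Sum>l\<in>K. \<Sum>k'\<in>K. \<Sum>l'\<in>K. of_bool (D k = D l \<and> D k = D k' \<and> D k = D l'))
    = (\<Sum>k\<in>K. (\<Sum>l\<in>K. of_bool (D k = D l) * (\<Sum>k'\<in>K. of_bool (D k = D k') * (\<Sum>l'\<in>K. of_bool (D k = D l') :: real))))"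
    unfolding sum_distrib_left by (intro sum.cong refl) (simp only: of_bool_conj)
  also have "\<dots> = (\<Sum>k\<in>K. real (card {l \<in> K. D l = D k}) ^ 3)"
    unfolding fibre_card sum_distrib_right[symmetric] by (simp add: power3_eq_cube mult.assoc)
  finally show ?thesis using fibre_power_sums(2)[OF finite_K card_image_D] by simp
qed

lemma s2_ge: "(1 - p) * p ^ (2 * e - f) * (real (card K))\<^sup>2 \<le> real M * s2"
proof -
  have cov: "(1 - p) * p ^ (2 * e - f) * of_bool (D k = D l) \<le> p ^ card (E k \<union> E l) - p ^ (card (E k) + card (E l))"
    if K: "k \<in> K" "l \<in> K" for k l
  proof -
    have c: "card (E k) + card (E l) = card (E k \<union> E l) + card (E k \<inter> E l)"
      using card_Un_Int[OF finite_E finite_E] K by blast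
    show ?thesis
    proof (cases "D k = D l")
      case True
      then have "D k \<subseteq> E k \<inter> E l" using D_subset K by blast
      then have i: "f \<le> card (E k \<inter> E l)" using card_mono[of "E k \<inter> E l" "D k"] finite_E K card_D by auto
      have "p ^ (2 * e - f) \<le> p ^ card (E k \<union> E l)"
        using c i card_E K p_bounds by (intro power_decreasing) auto
      moreover have "p ^ card (E k \<inter> E l) \<le> p"
        using i f_pos p_bounds power_decreasing[of 1 "card (E k \<inter> E l)" p] by simp
      ultimately have "p ^ (2 * e - f) * (1 - p) \<le> p ^ card (E k \<union> E l) * (1 - p ^ card (E k \<inter> E l))"
        using p_bounds by (intro mult_mono) auto
      then show ?thesis using True c by (simp add: power_add right_diff_distrib mult_ac)
    next
      case False
      have "p ^ (card (E k) + card (E l)) \<le> p ^ card (E k \<union> E l)"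
        using c p_bounds by (intro power_decreasing) auto
      then show ?thesis using False by simp
    qed
  qed
  have "(1 - p) * p ^ (2 * e - f) * (\<Sum>k\<in>K. \<Sum>l\<in>K. of_bool (D k = D l)) \<le> s2"
    unfolding s2_eq sum_distrib_left by (intro sum_mono cov)
  then have "real M * ((1 - p) * p ^ (2 * e - f) * (\<Sum>k\<in>K. \<Sum>l\<in>K. of_bool (D k = D l))) \<le> real M * s2"
    by (rule mult_left_mono) simp
  moreover have "(1 - p) * p ^ (2 * e - f) * (real (card K))\<^sup>2 \<le> (1 - p) * p ^ (2 * e - f) * (real M * (\<Sum>k\<in>K. \<Sum>l\<in>K. of_bool (D k = D l)))"
    using pair_count p_bounds by (intro mult_left_mono) auto
  ultimately show ?thesis by (simp add: mult_ac)
qed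

lemma common_D:
  assumes K: "k \<in> K" "l \<in> K" "k' \<in> K" "l' \<in> K" and eq: "D k = D l" "D k = D k'" "D k = D l'"
  shows "linked (E k) (E l) (E k') (E l')" "card (E k \<union> E l \<union> E k' \<union> E l') \<le> 4 * e - 3 * f" "1 \<le> card (E k \<inter> E l \<inter> E k' \<inter> E l')"
proof -
  have sub: "D k \<subseteq> E k" "D k \<subseteq> E l" "D k \<subseteq> E k'" "D k \<subseteq> E l'" using D_subset[OF K(1)] D_subset[OF K(2)] D_subset[OF K(3)] D_subset[OF K(4)] eq by simp_all
  obtain x where x: "x \<in> D k" using D_nonempty[OF K(1)] by blast
  show "linked (E k) (E l) (E k') (E l')" unfolding linked_def using x sub by blast
  have "x \<in> E k \<inter> E l \<inter> E k' \<inter> E l'" using x sub by blast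
  then show "1 \<le> card (E k \<inter> E l \<inter> E k' \<inter> E l')"
    using finite_E[OF K(1)] by (metis One_nat_def Suc_leI card_gt_0_iff empty_iff finite_Int)
  have cd: "card (E j - D k) = e - f" if "j \<in> K" "D k \<subseteq> E j" for j
    using card_Diff_subset[OF finite_D[OF K(1)] that(2)] card_E[OF that(1)] card_D[OF K(1)] by simp
  have "E k \<union> E l \<union> E k' \<union> E l' \<subseteq> D k \<union> ((E k - D k) \<union> (E l - D k) \<union> (E k' - D k) \<union> (E l' - D k))" by blast
  then have "card (E k \<union> E l \<union> E k' \<union> E l') \<le> card (D k \<union> ((E k - D k) \<union> (E l - D k) \<union> (E k' - D k) \<union> (E l' - D k)))"
    using finite_E K finite_D by (intro card_mono) auto
  also have "\<dots> \<le> card (D k) + (card (E k - D k) + card (E l - D k) + card (E k' - D k) + card (E l' - D k))"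
    using card_Un_le[of "D k" "(E k - D k) \<union> (E l - D k) \<union> (E k' - D k) \<union> (E l' - D k)"]
      card_Un4_le[of "E k - D k" "E l - D k" "E k' - D k" "E l' - D k"] by linarith
  also have "\<dots> = 4 * e - 3 * f"
    using cd[OF K(1) sub(1)] cd[OF K(2) sub(2)] cd[OF K(3) sub(3)] cd[OF K(4) sub(4)] card_D[OF K(1)] f_le_e[OF K(1)] by simp
  finally show "card (E k \<union> E l \<union> E k' \<union> E l') \<le> 4 * e - 3 * f" .
qed

lemma Q_ge: "p ^ (4 * e - 3 * f) * real (card K) ^ 4 \<le> real M ^ 3 * Q"
proof -
  have le: "p ^ (4 * e - 3 * f) * of_bool (D k = D l \<and> D k = D k' \<and> D k = D l') \<le>
      of_bool (linked (E k) (E l) (E k') (E l')) * p ^ card (E k \<union> E l \<union> E k' \<union> E l')"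
    if K: "k \<in> K" "l \<in> K" "k' \<in> K" "l' \<in> K" for k l k' l'
  proof (cases "D k = D l \<and> D k = D k' \<and> D k = D l'")
    case True
    then have "p ^ (4 * e - 3 * f) \<le> p ^ card (E k \<union> E l \<union> E k' \<union> E l')"
      using common_D(2)[OF K] p_bounds by (intro power_decreasing) auto
    moreover have "linked (E k) (E l) (E k') (E l')"
      using True by (intro common_D(1)[OF K]) blast+
    moreover have "of_bool (D k = D l \<and> D k = D k' \<and> D k = D l') = (1 :: real)" unfolding of_bool_eq_1_iff by (rule True)
    ultimately show ?thesis by (simp only:) simp
  next
    case False
    then have "p ^ (4 * e - 3 * f) * of_bool (D k = D l \<and> D k = D k' \<and> D k = D l') = 0" by simp
    then show ?thesis using p_bounds by (simp only:) simp
  qed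
  have "p ^ (4 * e - 3 * f) * (\<Sum>k\<in>K. \<Sum>l\<in>K. \<Sum>k'\<in>K. \<Sum>l'\<in>K. of_bool (D k = D l \<and> D k = D k' \<and> D k = D l')) \<le> Q"
    unfolding Q_eq sum_distrib_left by (intro sum_mono le)
  then have "real M ^ 3 * (p ^ (4 * e - 3 * f) * (\<Sum>k\<in>K. \<Sum>l\<in>K. \<Sum>k'\<in>K. \<Sum>l'\<in>K. of_bool (D k = D l \<and> D k = D k' \<and> D k = D l'))) \<le> real M ^ 3 * Q"
    by (rule mult_left_mono) simp
  moreover have "p ^ (4 * e - 3 * f) * real (card K) ^ 4 \<le> p ^ (4 * e - 3 * f) * (real M ^ 3 * (\<Sum>k\<in>K. \<Sum>l\<in>K. \<Sum>k'\<in>K. \<Sum>l'\<in>K. of_bool (D k = D l \<and> D k = D k' \<and> D k = D l')))"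
    using quad_count p_bounds by (intro mult_left_mono) auto
  ultimately show ?thesis by (simp only: mult_ac)
qed

lemma intersections_ge: "real (card K) ^ 4 \<le> real M ^ 3 * (\<Sum>k\<in>K. \<Sum>l\<in>K. \<Sum>k'\<in>K. \<Sum>l'\<in>K. real (card (E k \<inter> E l \<inter> E k' \<inter> E l')))"
proof -
  have le: "of_bool (D k = D l \<and> D k = D k' \<and> D k = D l') \<le> real (card (E k \<inter> E l \<inter> E k' \<inter> E l'))"
    if K: "k \<in> K" "l \<in> K" "k' \<in> K" "l' \<in> K" for k l k' l'
    using common_D(3)[OF K] by (cases "D k = D l \<and> D k = D k' \<and> D k = D l'") auto
  have "(\<Sum>k\<in>K. \<Sum>l\<in>K. \<Sum>k'\<in>K. \<Sum>l'\<in>K. of_bool (D k = D l \<and> D k = D k' \<and> D k = D l'))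
    \<le> (\<Sum>k\<in>K. \<Sum>l\<in>K. \<Sum>k'\<in>K. \<Sum>l'\<in>K. real (card (E k \<inter> E l \<inter> E k' \<inter> E l')))"
    by (intro sum_mono le)
  from order_trans[OF quad_count mult_left_mono[OF this]] show ?thesis by simp
qed

end

section \<open>Copies of a hypergraph\<close>

definition copy_set :: "'a hypergraph \<Rightarrow> nat \<Rightarrow> nat hypergraph set" where
  "copy_set H n = {H'. subhypergraph H' (complete_hypergraph n) \<and> isomorphic H' H}"

lemma wf_complete_hypergraph: "wf_hypergraph (complete_hypergraph n)"
  by (auto simp: wf_hypergraph_def complete_hypergraph_def)

lemma finite_copy_set: "finite (copy_set H n)"
  by (rule finite_subset[OF _ finite_subhypergraphs[of "complete_hypergraph n"]]) (auto simp: copy_set_def)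

lemma copy_setD:
  assumes "k \<in> copy_set H n"
  shows "wf_hypergraph k" "verts k \<subseteq> {1..n}" "edges k \<subseteq> Pow {1..n} - {{}}" "isomorphic k H"
    "finite (verts k)" "finite (edges k)" "edges k \<subseteq> Pow (verts k)"
proof -
  show "wf_hypergraph k" "verts k \<subseteq> {1..n}" "edges k \<subseteq> Pow {1..n} - {{}}" "isomorphic k H"
    using assms by (auto simp: copy_set_def subhypergraph_def complete_hypergraph_def)
  then show f: "finite (verts k)" and s: "edges k \<subseteq> Pow (verts k)"
    by (auto simp: wf_hypergraph_def)
  show "finite (edges k)" using finite_subset[OF s] f by simp
qed

lemma isomorphicD:
  assumes k: "wf_hypergraph k" and H: "wf_hypergraph H" and "isomorphic k H"
  obtains f where "bij_betw f (verts k) (verts H)" "(`) f ` edges k = edges H" "inj_on ((`) f) (Pow (verts k))"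
proof -
  obtain f where f: "bij_betw f (verts k) (verts H)" and e: "\<And>e. e \<subseteq> verts k \<Longrightarrow> e \<in> edges k \<longleftrightarrow> f ` e \<in> edges H"
    using assms(3) unfolding isomorphic_def by blast
  have inj: "inj_on ((`) f) (Pow (verts k))"
    using f by (simp add: bij_betw_def inj_on_image_Pow)
  have "(`) f ` edges k = edges H"
  proof
    have "edges k \<subseteq> Pow (verts k)" using k by (auto simp: wf_hypergraph_def)
    then show "(`) f ` edges k \<subseteq> edges H" using e by auto
    show "edges H \<subseteq> (`) f ` edges k"
    proof
      fix x assume x: "x \<in> edges H"
      then have "x \<subseteq> f ` verts k" using H f by (auto simp: wf_hypergraph_def bij_betw_def)
      then obtain y where "y \<subseteq> verts k" "x = f ` y" by (meson subset_imageE)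
      then show "x \<in> (`) f ` edges k" using e x by blast
    qed
  qed
  then show ?thesis using that[OF f _ inj] by blast
qed

lemma copy_cards:
  assumes H: "wf_hypergraph H" and k: "k \<in> copy_set H n"
  shows "card (verts k) = card (verts H)" "card (edges k) = card (edges H)"
proof -
  note kD = copy_setD[OF k]
  obtain f where f: "bij_betw f (verts k) (verts H)" "(`) f ` edges k = edges H" "inj_on ((`) f) (Pow (verts k))"
    by (rule isomorphicD[OF kD(1) H kD(4)])
  show "card (verts k) = card (verts H)" using bij_betw_same_card[OF f(1)] .
  show "card (edges k) = card (edges H)"
    using card_image[OF inj_on_subset[OF f(3) kD(7)]] f(2) by simp
qed

lemma min_sub_le:
  assumes "subhypergraph F H" "card (edges F) \<ge> 1"
  shows "min_sub H n p \<le> p ^ card (edges F) * real n ^ card (verts F)"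
proof -
  have "finite {F. subhypergraph F H \<and> card (edges F) \<ge> 1}"
    by (rule finite_subset[OF _ finite_subhypergraphs[of H]]) auto
  then show ?thesis unfolding min_sub_def using assms by (intro Min_le) auto
qed

lemma min_sub_attained:
  assumes "wf_hypergraph H" "edges H \<noteq> {}"
  obtains F where "subhypergraph F H" "card (edges F) \<ge> 1" "min_sub H n p = p ^ card (edges F) * real n ^ card (verts F)"
proof -
  let ?A = "{F. subhypergraph F H \<and> card (edges F) \<ge> 1}"
  have "finite ?A" by (rule finite_subset[OF _ finite_subhypergraphs[of H]]) auto
  moreover have "finite (edges H)" using assms by (auto simp: wf_hypergraph_def intro: finite_subset[of _ "Pow (verts H)"])
  then have "H \<in> ?A" using assms by (auto simp: subhypergraph_def card_gt_0_iff Suc_le_eq)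
  ultimately have "min_sub H n p \<in> (\<lambda>F. p ^ card (edges F) * real n ^ card (verts F)) ` ?A"
    unfolding min_sub_def by (intro Min_in) auto
  then show ?thesis using that by auto
qed

text \<open>An isomorphism carries \<open>D\<close>, with the vertices that it covers, to a subhypergraph of \<open>H\<close>.\<close>

lemma min_sub_le_copy_part:
  assumes H: "wf_hypergraph H" and k: "k \<in> copy_set H n" and D: "D \<subseteq> edges k" "D \<noteq> {}"
  shows "min_sub H n p \<le> p ^ card D * real n ^ card (\<Union>D)"
proof -
  note kD = copy_setD[OF k]
  obtain f where f: "bij_betw f (verts k) (verts H)" "(`) f ` edges k = edges H" "inj_on ((`) f) (Pow (verts k))"
    by (rule isomorphicD[OF kD(1) H kD(4)])
  have U: "\<Union>D \<subseteq> verts k" using D kD(7) by blast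
  have c1: "card (f ` \<Union>D) = card (\<Union>D)"
    using f(1) U by (intro card_image) (auto simp: bij_betw_def intro: inj_on_subset)
  have c2: "card ((`) f ` D) = card D"
    using D kD(7) by (intro card_image inj_on_subset[OF f(3)]) auto
  have finD: "finite D" using finite_subset[OF D(1) kD(6)] .
  define F where "F = Hypergraph (f ` \<Union>D) ((`) f ` D)"
  have sub: "verts F \<subseteq> verts H" "edges F \<subseteq> edges H"
    using image_mono[OF U, of f] image_mono[OF D(1), of "(`) f"] f(1,2) by (simp_all add: F_def bij_betw_def)
  have "wf_hypergraph F"
    unfolding wf_hypergraph_def
  proof (intro conjI subsetI)
    show "finite (verts F)" unfolding F_def using finite_subset[OF U kD(5)] by simp
    fix x assume "x \<in> edges F"
    then obtain y where "y \<in> D" "x = f ` y" by (auto simp: F_def)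
    moreover have "y \<noteq> {}" using \<open>y \<in> D\<close> D kD(3) by blast
    ultimately show "x \<in> Pow (verts F) - {{}}" by (auto simp: F_def)
  qed
  then have "subhypergraph F H" using sub H by (simp add: subhypergraph_def)
  moreover have "card (edges F) \<ge> 1"
    using c2 finD D(2) by (simp add: F_def Suc_le_eq card_gt_0_iff)
  ultimately show ?thesis using min_sub_le[of F H n p] c1 c2 by (simp add: F_def)
qed

lemma copy_contains_copy_of_subhypergraph:
  assumes k: "k \<in> copy_set H n" and F: "subhypergraph F H"
  shows "\<exists>D\<subseteq>edges k. card D = card (edges F) \<and> (\<exists>X\<subseteq>{1..n}. card X = card (verts F) \<and> D \<subseteq> Pow X)"
proof -
  note kD = copy_setD[OF k]
  have H: "wf_hypergraph H" and FH: "verts F \<subseteq> verts H" "edges F \<subseteq> edges H" "edges F \<subseteq> Pow (verts F)"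
    using F by (auto simp: subhypergraph_def wf_hypergraph_def)
  obtain f where f: "bij_betw f (verts k) (verts H)" "(`) f ` edges k = edges H" "inj_on ((`) f) (Pow (verts k))"
    by (rule isomorphicD[OF kD(1) H kD(4)])
  define X where "X = {x \<in> verts k. f x \<in> verts F}"
  define D where "D = {e \<in> edges k. f ` e \<in> edges F}"
  have "f ` X = verts F" using f(1) FH(1) by (auto simp: X_def bij_betw_def)
  moreover have "inj_on f X" using f(1) by (auto simp: X_def bij_betw_def inj_on_def)
  ultimately have cX: "card X = card (verts F)" by (metis card_image)
  have "(`) f ` D = edges F"
  proof
    show "(`) f ` D \<subseteq> edges F" by (auto simp: D_def)
    show "edges F \<subseteq> (`) f ` D"
    proof
      fix x assume x: "x \<in> edges F"
      then have "x \<in> (`) f ` edges k" using f(2) FH(2) by auto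
      then obtain y where "y \<in> edges k" "x = f ` y" by (rule imageE)
      then show "x \<in> (`) f ` D" using x by (simp add: D_def image_iff) blast
    qed
  qed
  moreover have "inj_on ((`) f) D"
    using kD(7) by (intro inj_on_subset[OF f(3)]) (auto simp: D_def)
  ultimately have cD: "card D = card (edges F)" by (metis card_image)
  have "D \<subseteq> Pow X"
  proof
    fix e assume "e \<in> D"
    then have "e \<subseteq> verts k" "f ` e \<subseteq> verts F" using kD(7) FH(3) by (fastforce simp: D_def)+
    then show "e \<in> Pow X" by (auto simp: X_def)
  qed
  moreover have "X \<subseteq> {1..n}" using kD(2) by (auto simp: X_def)
  moreover have "D \<subseteq> edges k" by (auto simp: D_def)
  ultimately show ?thesis using cX cD by blast
qed

lemma copy_on_vertex_set:
  assumes H: "wf_hypergraph H" and A: "A \<subseteq> {1..n}" "card A = card (verts H)"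
  shows "\<exists>k\<in>copy_set H n. verts k = A"
proof -
  have finA: "finite A" using finite_subset[OF A(1)] by simp
  have "finite (verts H)" using H by (simp add: wf_hypergraph_def)
  then obtain h where h: "bij_betw h A (verts H)"
    using finite_same_card_bij[OF finA, of "verts H"] A(2) by blast
  define k where "k = Hypergraph A {e. e \<subseteq> A \<and> h ` e \<in> edges H}"
  have ne: "{} \<notin> edges H" using H by (auto simp: wf_hypergraph_def)
  have "wf_hypergraph k" using finA ne by (auto simp: wf_hypergraph_def k_def)
  moreover have "subhypergraph k (complete_hypergraph n)"
    using \<open>wf_hypergraph k\<close> wf_complete_hypergraph[of n] A(1) ne
    by (auto simp: subhypergraph_def k_def complete_hypergraph_def)
  moreover have "isomorphic k H"
    unfolding isomorphic_def by (rule exI[of _ h]) (use h in \<open>auto simp: k_def\<close>)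
  ultimately show ?thesis by (intro bexI[of _ k]) (auto simp: copy_set_def k_def)
qed

lemma card_copy_set_ge:
  assumes H: "wf_hypergraph H"
  shows "n choose card (verts H) \<le> card (copy_set H n)"
proof -
  have "{A. A \<subseteq> {1..n} \<and> card A = card (verts H)} \<subseteq> verts ` copy_set H n"
    using copy_on_vertex_set[OF H] by blast
  then have "card {A. A \<subseteq> {1..n} \<and> card A = card (verts H)} \<le> card (verts ` copy_set H n)"
    by (intro card_mono finite_imageI finite_copy_set)
  also have "\<dots> \<le> card (copy_set H n)" by (rule card_image_le[OF finite_copy_set])
  finally show ?thesis using n_subsets[of "{1..n}" "card (verts H)"] by simp
qed

lemma binomial_le_power: "n choose k \<le> n ^ k"
  using binomial_le_pow[of k n] by (cases "k \<le> n") (auto simp: binomial_eq_0)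

lemma card_edge_sets_on_subsets:
  shows "finite {D. \<exists>X\<subseteq>{1..n::nat}. card X = j \<and> D \<subseteq> Pow X}"
    and "card {D. \<exists>X\<subseteq>{1..n::nat}. card X = j \<and> D \<subseteq> Pow X} \<le> 2 ^ (2 ^ j) * n ^ j"
proof -
  let ?A = "{X. X \<subseteq> {1..n} \<and> card X = j}"
  have finA: "finite ?A" by (rule finite_subset[of _ "Pow {1..n}"]) auto
  have eq: "{D. \<exists>X\<subseteq>{1..n}. card X = j \<and> D \<subseteq> Pow X} = (\<Union>X\<in>?A. Pow (Pow X))" by blast
  have finX: "finite X" if "X \<in> ?A" for X
    by (rule finite_subset[of X "{1..n}"]) (use that in simp_all)
  show "finite {D. \<exists>X\<subseteq>{1..n}. card X = j \<and> D \<subseteq> Pow X}" unfolding eq using finX finA by (intro finite_UN_I) simp_all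
  have "card (\<Union>X\<in>?A. Pow (Pow X)) \<le> (\<Sum>X\<in>?A. card (Pow (Pow X)))"
    by (rule card_UN_le) (rule finA)
  also have "\<dots> = (\<Sum>X\<in>?A. 2 ^ (2 ^ j))"
  proof (rule sum.cong[OF refl])
    fix X assume X: "X \<in> ?A"
    then show "card (Pow (Pow X)) = 2 ^ (2 ^ j)" using finX[OF X] by (simp add: card_Pow)
  qed
  also have "\<dots> = card ?A * 2 ^ (2 ^ j)" by (simp only: sum_constant of_nat_id)
  also have "card ?A = n choose j" using n_subsets[of "{1..n}" j] by simp
  also have "(n choose j) * 2 ^ (2 ^ j) \<le> n ^ j * 2 ^ (2 ^ j)" by (rule mult_le_mono1[OF binomial_le_power])
  also have "\<dots> = 2 ^ (2 ^ j) * n ^ j" by (rule mult.commute)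
  finally show "card {D. \<exists>X\<subseteq>{1..n}. card X = j \<and> D \<subseteq> Pow X} \<le> 2 ^ (2 ^ j) * n ^ j"
    unfolding eq .
qed

text \<open>The vertices outside \<open>X\<close> can be chosen in at most \<open>n ^ (card (verts H) - card X)\<close> ways, and the number of possible edge sets
on a given vertex set is bounded.\<close>

lemma card_copies_containing:
  assumes H: "wf_hypergraph H" and X: "X \<subseteq> {1..n}" "card X \<le> card (verts H)"
  shows "card {k \<in> copy_set H n. X \<subseteq> verts k} \<le> 2 ^ (2 ^ card (verts H)) * n ^ (card (verts H) - card X)"
proof -
  define v where "v = card (verts H)"
  define \<A> where "\<A> = {Y. Y \<subseteq> {1..n} \<and> card Y = v - card X}"
  define G where "G Y = Hypergraph (X \<union> Y) ` Pow (Pow (X \<union> Y))" for Y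
  have finX: "finite X" by (rule finite_subset[OF X(1)]) simp
  have finA: "finite \<A>" unfolding \<A>_def by (rule finite_subset[of _ "Pow {1..n}"]) auto
  have cardA: "card \<A> = n choose (v - card X)"
    unfolding \<A>_def using n_subsets[of "{1..n}" "v - card X"] by simp
  have finY: "finite Y" if "Y \<in> \<A>" for Y
    by (rule finite_subset[of Y "{1..n}"]) (use that in \<open>simp_all add: \<A>_def\<close>)
  have finG: "finite (G Y)" if "Y \<in> \<A>" for Y
    unfolding G_def by (intro finite_imageI) (simp only: finite_Pow_iff finite_UnI[OF finX finY[OF that]])
  have cardG: "card (G Y) \<le> 2 ^ (2 ^ v)" if "Y \<in> \<A>" for Y
  proof -
    have "card Y = v - card X" using that by (simp add: \<A>_def)
    then have c: "card (X \<union> Y) \<le> v" using card_Un_le[of X Y] X(2) by (simp add: v_def)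
    have fin: "finite (X \<union> Y)" by (rule finite_UnI[OF finX finY[OF that]])
    have 1: "card (G Y) \<le> card (Pow (Pow (X \<union> Y)))"
      unfolding G_def by (rule card_image_le) (simp only: finite_Pow_iff fin)
    have 2: "card (Pow (Pow (X \<union> Y))) = 2 ^ (2 ^ card (X \<union> Y))" using fin by (simp add: card_Pow)
    have 3: "(2 :: nat) ^ (2 ^ card (X \<union> Y)) \<le> 2 ^ (2 ^ v)"
      by (rule power_increasing[OF power_increasing[OF c]]) simp_all
    show ?thesis by (rule order_trans[OF 1[unfolded 2] 3])
  qed
  have sub: "{k \<in> copy_set H n. X \<subseteq> verts k} \<subseteq> (\<Union>Y\<in>\<A>. G Y)"
  proof
    fix k assume "k \<in> {k \<in> copy_set H n. X \<subseteq> verts k}"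
    then have k: "k \<in> copy_set H n" and Xk: "X \<subseteq> verts k" by auto
    have un: "X \<union> (verts k - X) = verts k" using Xk by blast
    have "verts k - X \<subseteq> {1..n}" using copy_setD(2)[OF k] by blast
    then have "verts k - X \<in> \<A>"
      using copy_cards(1)[OF H k] card_Diff_subset[OF finX Xk] by (simp add: \<A>_def v_def)
    moreover have "k \<in> G (verts k - X)"
      unfolding G_def un using copy_setD(7)[OF k] by (intro image_eqI[of _ _ "edges k"]) simp_all
    ultimately show "k \<in> (\<Union>Y\<in>\<A>. G Y)" by (rule UN_I)
  qed
  have "finite (\<Union>Y\<in>\<A>. G Y)" using finA finG by (rule finite_UN_I)
  then have 1: "card {k \<in> copy_set H n. X \<subseteq> verts k} \<le> card (\<Union>Y\<in>\<A>. G Y)" using sub by (rule card_mono)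
  have 2: "card (\<Union>Y\<in>\<A>. G Y) \<le> (\<Sum>Y\<in>\<A>. card (G Y))" by (rule card_UN_le[OF finA])
  have 3: "(\<Sum>Y\<in>\<A>. card (G Y)) \<le> card \<A> * 2 ^ (2 ^ v)"
    using sum_mono[OF cardG, of \<A>] by (simp only: sum_constant of_nat_id)
  have 4: "card \<A> * 2 ^ (2 ^ v) \<le> 2 ^ (2 ^ v) * n ^ (v - card X)"
    unfolding cardA mult.commute[of "2 ^ (2 ^ v)"] by (rule mult_le_mono1[OF binomial_le_power])
  show ?thesis
    unfolding v_def[symmetric] by (rule order_trans[OF 1 order_trans[OF 2 order_trans[OF 3 4]]])
qed

lemma min_sub_pos:
  assumes "wf_hypergraph H" "edges H \<noteq> {}" "0 < p" "n \<ge> 1"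
  shows "min_sub H n p > 0"
proof -
  obtain F where "subhypergraph F H" "card (edges F) \<ge> 1" "min_sub H n p = p ^ card (edges F) * real n ^ card (verts F)"
    by (rule min_sub_attained[OF assms(1,2)])
  then show ?thesis using assms(3,4) by simp
qed

text \<open>Group the copies by the set \<open>D\<close> of the edges that they share with \<open>U\<close>. If \<open>D\<close> occurs at all, it spans a copy of a subhypergraph of \<open>H\<close>, which compares
\<open>min_sub H n p\<close> with \<open>p ^ card D * n ^ card (\<Union>D)\<close>, exactly what is saved against choosing a copy freely.\<close>

lemma copies_meeting_edges:
  assumes H: "wf_hypergraph H" "edges H \<noteq> {}" and p: "0 < p" "p < 1" and n: "n \<ge> 1"
    and U: "finite U" "card U \<le> u"
  shows "(\<Sum>k\<in>copy_set H n. of_bool (edges k \<inter> U \<noteq> {}) * p ^ card (edges k - U))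
    \<le> 2 ^ u * 2 ^ (2 ^ card (verts H)) * (real n ^ card (verts H) * p ^ card (edges H) / min_sub H n p)"
proof -
  let ?v = "card (verts H)" and ?e = "card (edges H)" and ?K = "copy_set H n"
  define B where "B = 2 ^ (2 ^ ?v) * (real n ^ ?v * p ^ ?e / min_sub H n p)"
  have psi: "min_sub H n p > 0" using min_sub_pos[OF H p(1) n] .
  have B0: "B \<ge> 0" using psi p by (simp add: B_def)
  have eq: "of_bool (edges k \<inter> U \<noteq> {}) * p ^ card (edges k - U) = (\<Sum>D\<in>Pow U - {{}}. of_bool (edges k \<inter> U = D) * p ^ (?e - card D))"
    if k: "k \<in> ?K" for k
  proof (cases "edges k \<inter> U = {}")
    case True
    then show ?thesis by (simp add: sum.neutral)
  next
    case False
    have "card (edges k - U) = ?e - card (edges k \<inter> U)"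
      using card_Diff_subset_Int[of "edges k" U] U(1) copy_cards(2)[OF H(1) k] by simp
    moreover have "(\<Sum>D\<in>Pow U - {{}}. of_bool (edges k \<inter> U = D) * p ^ (?e - card D)) = (\<Sum>D\<in>{edges k \<inter> U}. p ^ (?e - card D))"
      using U(1) False by (intro sum.mono_neutral_cong_right) auto
    ultimately show ?thesis using False by simp
  qed
  have each: "(\<Sum>k\<in>?K. of_bool (edges k \<inter> U = D) * p ^ (?e - card D)) \<le> B" if D: "D \<in> Pow U - {{}}" for D
  proof (cases "\<exists>k\<in>?K. edges k \<inter> U = D")
    case False
    then have "(\<Sum>k\<in>?K. of_bool (edges k \<inter> U = D) * p ^ (?e - card D)) = 0" by (intro sum.neutral) auto
    then show ?thesis using B0 by simp
  next
    case True
    then obtain k0 where k0: "k0 \<in> ?K" "edges k0 \<inter> U = D" by blast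
    have Dk: "D \<subseteq> edges k0" "D \<noteq> {}" using k0 D by auto
    have UD: "\<Union>D \<subseteq> verts k0" using Dk copy_setD(7)[OF k0(1)] by blast
    have UDn: "\<Union>D \<subseteq> {1..n}" using UD copy_setD(2)[OF k0(1)] by blast
    have cU: "card (\<Union>D) \<le> ?v" using card_mono[OF copy_setD(5)[OF k0(1)] UD] copy_cards(1)[OF H(1) k0(1)] by simp
    have cD: "card D \<le> ?e" using card_mono[OF copy_setD(6)[OF k0(1)] Dk(1)] copy_cards(2)[OF H(1) k0(1)] by simp
    have "(\<Sum>k\<in>?K. of_bool (edges k \<inter> U = D) * p ^ (?e - card D)) = real (card {k \<in> ?K. edges k \<inter> U = D}) * p ^ (?e - card D)"
      using finite_copy_set[of H n] by (simp add: sum_distrib_right[symmetric] sum_of_bool_eq Int_def)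
    also have "\<dots> \<le> (2 ^ (2 ^ ?v) * real n ^ (?v - card (\<Union>D))) * p ^ (?e - card D)"
    proof (rule mult_right_mono)
      have "card {k \<in> ?K. edges k \<inter> U = D} \<le> card {k \<in> ?K. \<Union>D \<subseteq> verts k}"
      proof (rule card_mono)
        show "{k \<in> ?K. edges k \<inter> U = D} \<subseteq> {k \<in> ?K. \<Union>D \<subseteq> verts k}"
        proof
          fix k assume "k \<in> {k \<in> ?K. edges k \<inter> U = D}"
          then have "k \<in> ?K" "D \<subseteq> edges k" by auto
          then show "k \<in> {k \<in> ?K. \<Union>D \<subseteq> verts k}" using copy_setD(7)[of k H n] by blast
        qed
      qed (simp add: finite_copy_set)
      also have "\<dots> \<le> 2 ^ (2 ^ ?v) * n ^ (?v - card (\<Union>D))"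
        by (rule card_copies_containing[OF H(1) UDn cU])
      finally have "real (card {k \<in> ?K. edges k \<inter> U = D}) \<le> real (2 ^ (2 ^ ?v) * n ^ (?v - card (\<Union>D)))"
        by (rule of_nat_mono)
      then show "real (card {k \<in> ?K. edges k \<inter> U = D}) \<le> 2 ^ (2 ^ ?v) * real n ^ (?v - card (\<Union>D))" by simp
    qed (use p in simp)
    also have "\<dots> \<le> B"
    proof -
      have psi_le: "min_sub H n p \<le> p ^ card D * real n ^ card (\<Union>D)"
        by (rule min_sub_le_copy_part[OF H(1) k0(1) Dk])
      have "real n ^ (?v - card (\<Union>D)) * p ^ (?e - card D) * min_sub H n p
         \<le> real n ^ (?v - card (\<Union>D)) * p ^ (?e - card D) * (p ^ card D * real n ^ card (\<Union>D))"
        using psi_le p by (intro mult_left_mono) auto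
      also have "\<dots> = (real n ^ (?v - card (\<Union>D)) * real n ^ card (\<Union>D)) * (p ^ (?e - card D) * p ^ card D)" by simp
      also have "\<dots> = real n ^ ?v * p ^ ?e" using cU cD by (simp add: power_add[symmetric])
      finally have "real n ^ (?v - card (\<Union>D)) * p ^ (?e - card D) \<le> real n ^ ?v * p ^ ?e / min_sub H n p"
        by (simp only: pos_le_divide_eq[OF psi])
      then have "2 ^ (2 ^ ?v) * (real n ^ (?v - card (\<Union>D)) * p ^ (?e - card D)) \<le> B"
        unfolding B_def by (rule mult_left_mono) simp
      then show ?thesis by (simp only: mult.assoc)
    qed
    finally show ?thesis .
  qed
  have "(\<Sum>k\<in>?K. of_bool (edges k \<inter> U \<noteq> {}) * p ^ card (edges k - U)) = (\<Sum>D\<in>Pow U - {{}}. \<Sum>k\<in>?K. of_bool (edges k \<inter> U = D) * p ^ (?e - card D))"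
    by (subst sum.swap) (rule sum.cong[OF refl eq])
  also have "\<dots> \<le> (\<Sum>D\<in>Pow U - {{}}. B)" by (rule sum_mono[OF each])
  also have "\<dots> = real (card (Pow U - {{}})) * B" by simp
  also have "\<dots> \<le> 2 ^ u * B"
  proof (rule mult_right_mono[OF _ B0])
    have "card (Pow U - {{}}) \<le> card (Pow U)" using U(1) by (intro card_mono) auto
    also have "\<dots> = 2 ^ card U" using U(1) by (rule card_Pow)
    also have "\<dots> \<le> 2 ^ u" using U(2) by (intro power_increasing) auto
    finally have "real (card (Pow U - {{}})) \<le> real (2 ^ u)" by (rule of_nat_mono)
    then show "real (card (Pow U - {{}})) \<le> 2 ^ u" by simp
  qed
  finally show ?thesis by (simp add: B_def mult.assoc)
qed

section \<open>Distance to the normal distribution\<close>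

context indicator_sum
begin

definition W where "W \<omega> = (N \<omega> - mu) / sqrt s2"

lemma W_moments:
  assumes "s2 > 0"
  shows "Ex (\<lambda>\<omega>. (W \<omega>)\<^sup>2) = 1" "Ex (\<lambda>\<omega>. W \<omega> ^ 4) = Ex (\<lambda>\<omega>. (N \<omega> - mu) ^ 4) / s2\<^sup>2"
proof -
  have 1: "(W \<omega>)\<^sup>2 = (1 / s2) * (N \<omega> - mu)\<^sup>2" for \<omega>
    using assms by (simp add: W_def power_divide)
  have 2: "W \<omega> ^ 4 = (1 / s2\<^sup>2) * (N \<omega> - mu) ^ 4" for \<omega>
  proof -
    have "W \<omega> ^ 4 = ((W \<omega>)\<^sup>2)\<^sup>2" by simp
    also have "\<dots> = (1 / s2\<^sup>2) * (N \<omega> - mu) ^ 4" unfolding 1 by (simp add: power_mult_distrib power_divide)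
    finally show ?thesis .
  qed
  show "Ex (\<lambda>\<omega>. (W \<omega>)\<^sup>2) = 1" unfolding 1 bexp_cmult using assms by (simp add: s2_def)
  show "Ex (\<lambda>\<omega>. W \<omega> ^ 4) = Ex (\<lambda>\<omega>. (N \<omega> - mu) ^ 4) / s2\<^sup>2" unfolding 2 bexp_cmult by simp
qed

lemma Stein_error_bound:
  assumes s: "s2 > 0" and ctrl: "controls_increments G f f'" and f': "\<And>w. \<bar>f' w\<bar> \<le> 2"
    and G: "Ex (\<lambda>\<omega>. (G (W \<omega>))\<^sup>2) \<le> c"
  shows "\<bar>Ex (\<lambda>\<omega>. f' (W \<omega>) - W \<omega> * f (W \<omega>))\<bar> \<le>
    (2 * sqrt (Ex (\<lambda>\<omega>. (V \<omega> - s2)\<^sup>2)) + sqrt (Ex (\<lambda>\<omega>. (T \<omega>)\<^sup>2)) * sqrt c) / s2"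
proof -
  have 1: "Ex (\<lambda>\<omega>. \<bar>f' (W \<omega>) * (V \<omega> - s2)\<bar>) \<le> 2 * sqrt (Ex (\<lambda>\<omega>. (V \<omega> - s2)\<^sup>2))"
  proof -
    have "Ex (\<lambda>\<omega>. \<bar>f' (W \<omega>) * (V \<omega> - s2)\<bar>) \<le> sqrt (Ex (\<lambda>\<omega>. (f' (W \<omega>))\<^sup>2)) * sqrt (Ex (\<lambda>\<omega>. (V \<omega> - s2)\<^sup>2))"
      by (rule bexp_abs_mult_le[OF p_bounds(1,2)])
    also have "\<dots> \<le> 2 * sqrt (Ex (\<lambda>\<omega>. (V \<omega> - s2)\<^sup>2))"
    proof (rule mult_right_mono)
      have "Ex (\<lambda>\<omega>. (f' (W \<omega>))\<^sup>2) \<le> Ex (\<lambda>\<omega>. 4)"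
      proof (rule bexp_mono[OF p_bounds(1,2)])
        fix \<omega>
        show "(f' (W \<omega>))\<^sup>2 \<le> 4" using power_mono[OF f'[of "W \<omega>"], of 2] by simp
      qed
      then have "Ex (\<lambda>\<omega>. (f' (W \<omega>))\<^sup>2) \<le> 2\<^sup>2" by (simp add: bexp_const[OF finite_S])
      then show "sqrt (Ex (\<lambda>\<omega>. (f' (W \<omega>))\<^sup>2)) \<le> 2" by (rule real_le_lsqrt[rotated]) simp
    qed (simp add: bexp_nonneg p_bounds)
    finally show ?thesis .
  qed
  have 2: "Ex (\<lambda>\<omega>. T \<omega> * G (W \<omega>)) \<le> sqrt (Ex (\<lambda>\<omega>. (T \<omega>)\<^sup>2)) * sqrt c"
  proof -
    have "Ex (\<lambda>\<omega>. T \<omega> * G (W \<omega>)) \<le> Ex (\<lambda>\<omega>. \<bar>T \<omega> * G (W \<omega>)\<bar>)"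
      by (rule bexp_mono[OF p_bounds(1,2)]) simp
    also have "\<dots> \<le> sqrt (Ex (\<lambda>\<omega>. (T \<omega>)\<^sup>2)) * sqrt (Ex (\<lambda>\<omega>. (G (W \<omega>))\<^sup>2))"
      by (rule bexp_abs_mult_le[OF p_bounds(1,2)])
    also have "\<dots> \<le> sqrt (Ex (\<lambda>\<omega>. (T \<omega>)\<^sup>2)) * sqrt c"
      using G by (intro mult_left_mono) (simp_all add: bexp_nonneg p_bounds)
    finally show ?thesis .
  qed
  have "\<bar>Ex (\<lambda>\<omega>. f' (W \<omega>) - W \<omega> * f (W \<omega>))\<bar> \<le>
    (Ex (\<lambda>\<omega>. \<bar>f' (W \<omega>) * (V \<omega> - s2)\<bar>) + Ex (\<lambda>\<omega>. T \<omega> * G (W \<omega>))) / s2"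
    using Stein_bound[OF s ctrl] unfolding W_def .
  moreover have "(Ex (\<lambda>\<omega>. \<bar>f' (W \<omega>) * (V \<omega> - s2)\<bar>) + Ex (\<lambda>\<omega>. T \<omega> * G (W \<omega>))) / s2 \<le>
    (2 * sqrt (Ex (\<lambda>\<omega>. (V \<omega> - s2)\<^sup>2)) + sqrt (Ex (\<lambda>\<omega>. (T \<omega>)\<^sup>2)) * sqrt c) / s2"
    using 1 2 s by (intro divide_right_mono add_mono) auto
  ultimately show ?thesis by (rule order_trans)
qed

lemma Kolmogorov_bound:
  assumes s: "s2 > 0"
  shows "\<bar>Ex (\<lambda>\<omega>. of_bool (W \<omega> \<le> z)) - gPhi z\<bar> \<le>
    (2 * sqrt (Ex (\<lambda>\<omega>. (V \<omega> - s2)\<^sup>2)) + sqrt (Ex (\<lambda>\<omega>. (T \<omega>)\<^sup>2)) * sqrt 4) / s2"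
proof -
  obtain f f' G where
    eq: "\<And>w. f' w - w * f w = of_bool (w \<le> z) - gPhi z" and c: "controls_increments G f f'"
    and f': "\<And>w. \<bar>f' w\<bar> \<le> 2" and G: "\<And>w. \<bar>G w\<bar> \<le> 2"
    by (rule Stein_solution_indicator[of z], rule that)
  have "Ex (\<lambda>\<omega>. (G (W \<omega>))\<^sup>2) \<le> Ex (\<lambda>\<omega>. 4)"
  proof (rule bexp_mono[OF p_bounds(1,2)])
    fix \<omega>
    show "(G (W \<omega>))\<^sup>2 \<le> 4" using power_mono[OF G[of "W \<omega>"], of 2] by simp
  qed
  then have G2: "Ex (\<lambda>\<omega>. (G (W \<omega>))\<^sup>2) \<le> 4" by (simp only: bexp_const[OF finite_S])
  have "Ex (\<lambda>\<omega>. f' (W \<omega>) - W \<omega> * f (W \<omega>)) = Ex (\<lambda>\<omega>. of_bool (W \<omega> \<le> z)) - gPhi z"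
    by (simp only: eq bexp_diff bexp_const[OF finite_S])
  then show ?thesis using Stein_error_bound[OF s c f' G2] by simp
qed

lemma Wasserstein_bound:
  assumes s: "s2 > 0" and h: "1-lipschitz_on UNIV h"
  shows "\<bar>Ex (\<lambda>\<omega>. h (W \<omega>)) - (\<integral>x. h x \<partial>std_normal_distribution)\<bar> \<le>
    (2 * sqrt (Ex (\<lambda>\<omega>. (V \<omega> - s2)\<^sup>2)) + sqrt (Ex (\<lambda>\<omega>. (T \<omega>)\<^sup>2)) * sqrt (18 + 18 * Ex (\<lambda>\<omega>. W \<omega> ^ 4))) / s2"
proof -
  obtain f f' G where
    eq: "\<And>w. f' w - w * f w = h w - (\<integral>x. h x \<partial>std_normal_distribution)" and c: "controls_increments G f f'"
    and f': "\<And>w. \<bar>f' w\<bar> \<le> 2" and G: "\<And>w. \<bar>G w\<bar> \<le> 3 * (1 + w\<^sup>2)"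
    by (rule Stein_solution_Lipschitz[OF h], rule that)
  have "Ex (\<lambda>\<omega>. (G (W \<omega>))\<^sup>2) \<le> Ex (\<lambda>\<omega>. 18 + 18 * W \<omega> ^ 4)"
  proof (rule bexp_mono[OF p_bounds(1,2)])
    fix \<omega>
    define x where "x = (W \<omega>)\<^sup>2"
    have "(G (W \<omega>))\<^sup>2 \<le> (3 * (1 + x))\<^sup>2"
      using power_mono[OF G[of "W \<omega>"], of 2] by (simp add: x_def)
    also have "\<dots> \<le> 18 + 18 * x\<^sup>2"
      using zero_le_power2[of "x - 1"] by (simp add: power2_eq_square algebra_simps)
    also have "x\<^sup>2 = W \<omega> ^ 4" by (simp add: x_def)
    finally show "(G (W \<omega>))\<^sup>2 \<le> 18 + 18 * W \<omega> ^ 4" .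
  qed
  then have G2: "Ex (\<lambda>\<omega>. (G (W \<omega>))\<^sup>2) \<le> 18 + 18 * Ex (\<lambda>\<omega>. W \<omega> ^ 4)"
    by (simp only: bexp_const[OF finite_S] bexp_add bexp_cmult)
  have "Ex (\<lambda>\<omega>. f' (W \<omega>) - W \<omega> * f (W \<omega>)) = Ex (\<lambda>\<omega>. h (W \<omega>)) - (\<integral>x. h x \<partial>std_normal_distribution)"
    by (simp only: eq bexp_diff bexp_const[OF finite_S])
  then show ?thesis using Stein_error_bound[OF s c f' G2] by simp
qed

text \<open>Both sides are at distance at most 1 from \<open>h 0\<close>, as the first absolute moments are at most 1.\<close>

lemma Wasserstein_trivial:
  assumes s: "s2 > 0" and h: "1-lipschitz_on UNIV h"
  shows "\<bar>Ex (\<lambda>\<omega>. h (W \<omega>)) - (\<integral>x. h x \<partial>std_normal_distribution)\<bar> \<le> 2"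
proof -
  have lip: "\<bar>h x - h 0\<bar> \<le> \<bar>x\<bar>" for x
    using lipschitz_onD[OF h, of x 0] by (simp add: dist_real_def)
  have "\<bar>Ex (\<lambda>\<omega>. h (W \<omega>)) - h 0\<bar> = \<bar>Ex (\<lambda>\<omega>. h (W \<omega>) - h 0)\<bar>"
    by (simp add: bexp_diff bexp_const[OF finite_S])
  also have "\<dots> \<le> Ex (\<lambda>\<omega>. \<bar>h (W \<omega>) - h 0\<bar>)" by (rule bexp_abs[OF p_bounds(1,2)])
  also have "\<dots> \<le> Ex (\<lambda>\<omega>. \<bar>1 * W \<omega>\<bar>)" by (rule bexp_mono[OF p_bounds(1,2)]) (simp add: lip)
  also have "\<dots> \<le> sqrt (Ex (\<lambda>\<omega>. 1\<^sup>2)) * sqrt (Ex (\<lambda>\<omega>. (W \<omega>)\<^sup>2))" by (rule bexp_abs_mult_le[OF p_bounds(1,2)])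
  also have "\<dots> = 1" by (simp add: bexp_const[OF finite_S] W_moments[OF s])
  finally have "\<bar>Ex (\<lambda>\<omega>. h (W \<omega>)) - h 0\<bar> \<le> 1" .
  then show ?thesis using Lipschitz_gphi_integrable(3,4)[OF h] by linarith
qed

end

section \<open>The random hypergraph as a random set of edges\<close>

lemma finite_edges_complete: "finite (edges (complete_hypergraph n))"
  by (simp add: complete_hypergraph_def)

lemma expectation_random_hypergraph:
  assumes p: "0 \<le> p" "p \<le> 1"
  shows "measure_pmf.expectation (homogeneous_random_hypergraph n p) g =
    bexp (edges (complete_hypergraph n)) p (\<lambda>\<omega>. g (Hypergraph {1..n} \<omega>))"
proof -
  define S where "S = edges (complete_hypergraph n)"
  have finS: "finite S" by (simp add: S_def finite_edges_complete)
  define M where "M = Pi_pmf S False (\<lambda>_. bernoulli_pmf p)"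
  define F where "F \<omega> = Hypergraph {1..n} {e \<in> S. \<omega> e}" for \<omega>
  define c :: "nat set set \<Rightarrow> nat set \<Rightarrow> bool" where "c \<omega> = (\<lambda>x. x \<in> \<omega>)" for \<omega>
  have inj: "inj_on c (Pow S)" by (rule inj_onI) (auto simp: c_def fun_eq_iff)
  have "measure_pmf.expectation (homogeneous_random_hypergraph n p) g = measure_pmf.expectation M (\<lambda>\<omega>. g (F \<omega>))"
    unfolding homogeneous_random_hypergraph_def S_def[symmetric] M_def[symmetric] F_def[symmetric] by simp
  also have "\<dots> = (\<Sum>\<omega>\<in>c ` Pow S. pmf M \<omega> *\<^sub>R g (F \<omega>))"
  proof (rule integral_measure_pmf)
    show "finite (c ` Pow S)" using finS by simp
    fix \<omega> assume "\<omega> \<in> set_pmf M"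
    then have "\<forall>x. x \<notin> S \<longrightarrow> \<omega> x = False"
      using set_Pi_pmf_subset[OF finS, of False "\<lambda>_. bernoulli_pmf p"] by (auto simp: M_def)
    then have "{x. \<omega> x} \<subseteq> S" by auto
    moreover have "\<omega> = c {x. \<omega> x}" by (simp add: c_def)
    ultimately show "\<omega> \<in> c ` Pow S" by blast
  qed
  also have "\<dots> = (\<Sum>\<omega>\<in>Pow S. pmf M (c \<omega>) *\<^sub>R g (F (c \<omega>)))"
    by (simp add: sum.reindex[OF inj])
  also have "\<dots> = bexp S p (\<lambda>\<omega>. g (Hypergraph {1..n} \<omega>))"
    unfolding bexp_def
  proof (rule sum.cong[OF refl])
    fix \<omega> assume w: "\<omega> \<in> Pow S"
    have "pmf M (c \<omega>) = (\<Prod>x\<in>S. pmf (bernoulli_pmf p) (c \<omega> x))"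
      unfolding M_def using finS w by (intro pmf_Pi') (auto simp: c_def)
    also have "\<dots> = (\<Prod>x\<in>S. if x \<in> \<omega> then p else 1 - p)"
      using p by (intro prod.cong refl) (auto simp: c_def)
    also have "\<dots> = p ^ card (S \<inter> \<omega>) * (1 - p) ^ card (S - \<omega>)"
      using finS by (simp add: prod.If_cases Diff_eq Collect_mem_eq)
    also have "S \<inter> \<omega> = \<omega>" using w by blast
    finally have "pmf M (c \<omega>) = p ^ card \<omega> * (1 - p) ^ card (S - \<omega>)" .
    moreover have "{x \<in> S. c \<omega> x} = \<omega>" using w by (auto simp: c_def)
    ultimately show "pmf M (c \<omega>) *\<^sub>R g (F (c \<omega>)) = p ^ card \<omega> * (1 - p) ^ card (S - \<omega>) * g (Hypergraph {1..n} \<omega>)"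
      by (simp add: F_def)
  qed
  finally show ?thesis by (simp add: S_def)
qed

lemma edges_complete: "edges (complete_hypergraph n) = Pow {1..n} - {{}}"
  by (simp add: complete_hypergraph_def)

lemma copies_eq_indicator_sum:
  assumes w: "\<omega> \<subseteq> edges (complete_hypergraph n)"
  shows "copies H n (Hypergraph {1..n} \<omega>) = (\<Sum>k\<in>copy_set H n. incl (edges k) \<omega>)"
proof -
  let ?G = "Hypergraph {1..n} \<omega>"
  have wf: "wf_hypergraph ?G" using w by (auto simp: wf_hypergraph_def edges_complete)
  have "{H'. subhypergraph H' (complete_hypergraph n) \<and> isomorphic H' H \<and> subhypergraph H' ?G} = copy_set H n \<inter> {k. edges k \<subseteq> \<omega>}"
    using wf by (auto simp: copy_set_def subhypergraph_def complete_hypergraph_def)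
  then show ?thesis
    unfolding copies_def incl_def by (simp add: sum_of_bool_eq finite_copy_set)
qed

section \<open>Orders of the variance and of the sum over linked quadruples\<close>

text \<open>The number of families of subsets of the vertex set, a bound for the number of edge sets on it.\<close>

definition edge_set_const :: "'a hypergraph \<Rightarrow> nat" where "edge_set_const H = 2 ^ (2 ^ card (verts H))"
text \<open>For \<open>n \<ge> v = card (verts H)\<close> there are at least this multiple of \<open>n ^ v\<close> possible vertex sets of a copy.\<close>

definition placement_const :: "'a hypergraph \<Rightarrow> real" where "placement_const H = (1 / real (card (verts H))) ^ card (verts H)"

locale copy_counts =
  fixes H :: "'a hypergraph" and n :: nat and p :: real
  assumes wf: "wf_hypergraph H" and nonempty: "edges H \<noteq> {}" and n_ge: "card (verts H) \<le> n"
    and p: "0 < p" "p < 1"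
begin

abbreviation "v \<equiv> card (verts H)"
abbreviation "B \<equiv> real (edge_set_const H)"
abbreviation "c \<equiv> placement_const H"
abbreviation "Psi \<equiv> min_sub H n p"

sublocale indicator_sum "edges (complete_hypergraph n)" p "copy_set H n" edges "card (edges H)"
proof
  show "finite (edges (complete_hypergraph n))" by (rule finite_edges_complete)
  show "0 < p" "p < 1" by (rule p)+
  show "finite (copy_set H n)" by (rule finite_copy_set)
  show "edges k \<subseteq> edges (complete_hypergraph n)" if "k \<in> copy_set H n" for k
    using copy_setD(3)[OF that] by (simp add: edges_complete)
  show "card (edges k) = card (edges H)" if "k \<in> copy_set H n" for k
    using copy_cards(2)[OF wf that] .
qed

lemma finite_H: "finite (verts H)" "finite (edges H)" "edges H \<subseteq> Pow (verts H)"
proof -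
  show 1: "finite (verts H)" and 2: "edges H \<subseteq> Pow (verts H)" using wf by (auto simp: wf_hypergraph_def)
  show "finite (edges H)" by (rule finite_subset[OF 2]) (simp add: 1)
qed

lemma v_pos: "v \<ge> 1"
proof -
  obtain x where x: "x \<in> edges H" using nonempty by blast
  then have "x \<noteq> {}" "x \<subseteq> verts H" using wf by (auto simp: wf_hypergraph_def)
  then have "verts H \<noteq> {}" by blast
  then show ?thesis using finite_H(1) by (simp add: Suc_le_eq card_gt_0_iff)
qed

lemma e_pos: "card (edges H) \<ge> 1"
  using nonempty finite_H(2) by (simp add: Suc_le_eq card_gt_0_iff)

lemma n_pos: "n \<ge> 1" using v_pos n_ge by linarith

lemma B_pos: "B > 0" by (simp add: edge_set_const_def)

lemma c_pos: "c > 0" using v_pos by (simp add: placement_const_def)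

lemma Psi_pos: "Psi > 0" by (rule min_sub_pos[OF wf nonempty p(1) n_pos])

lemma card_copy_set_bounds: "c * real n ^ v \<le> real (card (copy_set H n))" "real (card (copy_set H n)) \<le> B * real n ^ v"
proof -
  have "c * real n ^ v = (real n / real v) ^ v" by (simp add: placement_const_def power_divide)
  also have "\<dots> \<le> real (n choose v)" by (rule binomial_ge_n_over_k_pow_k[OF n_ge])
  also have "\<dots> \<le> real (card (copy_set H n))" using card_copy_set_ge[OF wf, of n] by (rule of_nat_mono)
  finally show "c * real n ^ v \<le> real (card (copy_set H n))" .
  have "card (copy_set H n) \<le> edge_set_const H * n ^ v"
    using card_copies_containing[OF wf, of "{}" n] by (simp add: edge_set_const_def)
  then have "real (card (copy_set H n)) \<le> real (edge_set_const H * n ^ v)" by (rule of_nat_mono)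
  then show "real (card (copy_set H n)) \<le> B * real n ^ v" by simp
qed

definition X where "X = real n ^ v * p ^ card (edges H)"

lemma X_pos: "X > 0" using n_pos p by (simp add: X_def)

lemma sum_copies_meeting_le:
  assumes "U \<subseteq> edges (complete_hypergraph n)" "card U \<le> 3 * card (edges H)"
  shows "(\<Sum>k\<in>copy_set H n. of_bool (edges k \<inter> U \<noteq> {}) * p ^ card (edges k - U)) \<le> 2 ^ (3 * card (edges H)) * B * (X / Psi)"
  using copies_meeting_edges[OF wf nonempty p n_pos finite_subset[OF assms(1) finite_edges_complete] assms(2)]
  by (simp add: edge_set_const_def X_def)

lemma card_times_power_le: "real (card (copy_set H n)) * p ^ card (edges H) \<le> B * X"
  using mult_right_mono[OF card_copy_set_bounds(2), of "p ^ card (edges H)"] p by (simp add: X_def mult.assoc)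

lemma s2_upper: "s2 \<le> (real (card (edges H)) * 2 ^ (3 * card (edges H)) * B\<^sup>2) * ((1 - p) * X\<^sup>2 / Psi)"
proof -
  let ?e = "card (edges H)" and ?L = "2 ^ (3 * card (edges H)) * B * (X / Psi)"
  have "s2 \<le> real ?e * (1 - p) * (real (card (copy_set H n)) * p ^ ?e * ?L)"
    by (rule s2_le[OF sum_copies_meeting_le])
  also have "\<dots> \<le> real ?e * (1 - p) * (B * X * ?L)"
    using card_times_power_le p X_pos Psi_pos B_pos by (intro mult_left_mono mult_right_mono) auto
  also have "\<dots> = (real ?e * 2 ^ (3 * ?e) * B\<^sup>2) * ((1 - p) * X\<^sup>2 / Psi)"
    by (simp add: power2_eq_square)
  finally show ?thesis .
qed

lemma Q_upper: "Q \<le> (6 * 2 ^ (9 * card (edges H)) * B ^ 4) * (X ^ 4 / Psi ^ 3)"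
proof -
  let ?e = "card (edges H)" and ?L = "2 ^ (3 * card (edges H)) * B * (X / Psi)"
  have L0: "?L \<ge> 0" using X_pos Psi_pos B_pos by simp
  have "Q \<le> 6 * (real (card (copy_set H n)) * p ^ ?e * ?L ^ 3)"
    by (rule Q_le[OF sum_copies_meeting_le L0])
  also have "\<dots> \<le> 6 * (B * X * ?L ^ 3)"
    using card_times_power_le L0 by (intro mult_left_mono mult_right_mono) auto
  also have "\<dots> = (6 * 2 ^ (9 * ?e) * B ^ 4) * (X ^ 4 / Psi ^ 3)"
  proof -
    have "(2 :: real) ^ (9 * ?e) = (2 ^ (3 * ?e)) ^ 3" by (simp add: power_mult[symmetric])
    then show ?thesis by (simp add: power_mult_distrib power_divide power4_eq_xxxx power3_eq_cube)
  qed
  finally show ?thesis .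
qed

text \<open>The distinguished subset of a copy is a copy of \<open>F\<close> inside it; it is an edge set on one of at most \<open>n ^ card (verts F)\<close> vertex sets.\<close>

lemma fibres_exist:
  assumes F: "subhypergraph F H" "card (edges F) \<ge> 1"
  obtains D where "indicator_sum_fibres (edges (complete_hypergraph n)) p (copy_set H n) edges (card (edges H)) D
      (card (edges F)) (edge_set_const H * n ^ card (verts F))"
proof -
  have "\<forall>k\<in>copy_set H n. \<exists>D. D \<subseteq> edges k \<and> card D = card (edges F) \<and> (\<exists>X\<subseteq>{1..n}. card X = card (verts F) \<and> D \<subseteq> Pow X)"
    using copy_contains_copy_of_subhypergraph[OF _ F(1)] by blast
  from bchoice[OF this] obtain D where
    D: "\<forall>k\<in>copy_set H n. D k \<subseteq> edges k \<and> card (D k) = card (edges F) \<and> (\<exists>X\<subseteq>{1..n}. card X = card (verts F) \<and> D k \<subseteq> Pow X)"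
    by (rule exE)
  let ?\<D> = "{D. \<exists>X\<subseteq>{1..n}. card X = card (verts F) \<and> D \<subseteq> Pow X}"
  have "D ` copy_set H n \<subseteq> ?\<D>" using D by blast
  then have 1: "card (D ` copy_set H n) \<le> card ?\<D>"
    by (rule card_mono[OF card_edge_sets_on_subsets(1)])
  have "card (verts F) \<le> v" using F(1) finite_H(1) by (auto simp: subhypergraph_def intro: card_mono)
  then have 2: "(2 :: nat) ^ (2 ^ card (verts F)) \<le> edge_set_const H"
    unfolding edge_set_const_def by (intro power_increasing) auto
  have 3: "card (D ` copy_set H n) \<le> edge_set_const H * n ^ card (verts F)"
    by (rule order_trans[OF 1 order_trans[OF card_edge_sets_on_subsets(2) mult_le_mono1[OF 2]]])
  have "indicator_sum_fibres (edges (complete_hypergraph n)) p (copy_set H n) edges (card (edges H)) D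
      (card (edges F)) (edge_set_const H * n ^ card (verts F))"
  proof
    show "D k \<subseteq> edges k" "card (D k) = card (edges F)" if "k \<in> copy_set H n" for k using D that by simp_all
    show "1 \<le> card (edges F)" by (rule F(2))
    show "card (D ` copy_set H n) \<le> edge_set_const H * n ^ card (verts F)" by (rule 3)
  qed
  then show ?thesis by (rule that)
qed

lemma card_edges_sub: "subhypergraph F H \<Longrightarrow> card (edges F) \<le> card (edges H)"
  using finite_H(2) by (auto simp: subhypergraph_def intro: card_mono)

text \<open>Take the fibres for a subhypergraph that attains the minimum \<open>Psi\<close>.\<close>

lemma s2_lower: "(c\<^sup>2 / B) * ((1 - p) * X\<^sup>2 / Psi) \<le> s2"
  and Q_lower: "(c ^ 4 / B ^ 3) * (X ^ 4 / Psi ^ 3) \<le> Q"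
proof -
  obtain F where F: "subhypergraph F H" "card (edges F) \<ge> 1" and PsiF: "Psi = p ^ card (edges F) * real n ^ card (verts F)"
    by (rule min_sub_attained[OF wf nonempty])
  obtain D where D: "indicator_sum_fibres (edges (complete_hypergraph n)) p (copy_set H n) edges (card (edges H)) D
      (card (edges F)) (edge_set_const H * n ^ card (verts F))"
    by (rule fibres_exist[OF F])
  let ?e = "card (edges H)" and ?f = "card (edges F)" and ?j = "card (verts F)" and ?K = "real (card (copy_set H n))"
  have f: "?f \<le> ?e" by (rule card_edges_sub[OF F(1)])
  have nj: "real n ^ ?j > 0" using n_pos by simp
  have pw: "p ^ ?f > 0" "B > 0" using p B_pos by auto
  have alg2: "(k\<^sup>2 / b) * (q * (u\<^sup>2 * (P * R)) / (R * m)) = q * P * (k * u)\<^sup>2 / (b * m)"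
    if "R \<noteq> 0" "m \<noteq> 0" "b \<noteq> 0" for k b q u P R m :: real
    using that by (simp add: power_mult_distrib field_simps)
  have alg4: "(k ^ 4 / b ^ 3) * (u ^ 4 * (P * R ^ 3) / (R * m) ^ 3) = P * (k * u) ^ 4 / (b * m) ^ 3"
    if "R \<noteq> 0" "m \<noteq> 0" "b \<noteq> 0" for k b u P R m :: real
    using that by (simp add: power_mult_distrib field_simps)
  have M: "real (edge_set_const H * n ^ ?j) = B * real n ^ ?j" by simp
  have c0: "c * real n ^ v \<ge> 0" using c_pos by simp
  have "(1 - p) * p ^ (2 * ?e - ?f) * (c * real n ^ v)\<^sup>2 \<le> (1 - p) * p ^ (2 * ?e - ?f) * ?K\<^sup>2"
    using card_copy_set_bounds(1) c0 p by (intro mult_left_mono power_mono) auto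
  also have "\<dots> \<le> B * real n ^ ?j * s2"
    using indicator_sum_fibres.s2_ge[OF D] unfolding M .
  finally have 1: "(1 - p) * p ^ (2 * ?e - ?f) * (c * real n ^ v)\<^sup>2 / (B * real n ^ ?j) \<le> s2"
    using nj pw by (simp add: divide_le_eq mult.commute)
  have p2: "p ^ (2 * ?e) = p ^ (2 * ?e - ?f) * p ^ ?f" using f by (simp add: power_add[symmetric])
  have X2: "X\<^sup>2 = (real n ^ v)\<^sup>2 * (p ^ (2 * ?e - ?f) * p ^ ?f)"
    unfolding X_def power_mult_distrib p2[symmetric] by (simp add: power_mult[symmetric] mult.commute)
  have "(c\<^sup>2 / B) * ((1 - p) * X\<^sup>2 / Psi) = (1 - p) * p ^ (2 * ?e - ?f) * (c * real n ^ v)\<^sup>2 / (B * real n ^ ?j)"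
    unfolding X2 PsiF by (rule alg2) (use nj pw p in simp_all)
  with 1 show "(c\<^sup>2 / B) * ((1 - p) * X\<^sup>2 / Psi) \<le> s2" by simp
  have "p ^ (4 * ?e - 3 * ?f) * (c * real n ^ v) ^ 4 \<le> p ^ (4 * ?e - 3 * ?f) * ?K ^ 4"
    using card_copy_set_bounds(1) c0 p by (intro mult_left_mono power_mono) auto
  also have "\<dots> \<le> (B * real n ^ ?j) ^ 3 * Q"
    using indicator_sum_fibres.Q_ge[OF D] unfolding M .
  finally have 2: "p ^ (4 * ?e - 3 * ?f) * (c * real n ^ v) ^ 4 / (B * real n ^ ?j) ^ 3 \<le> Q"
    using nj pw by (simp add: divide_le_eq mult.commute)
  have p4: "p ^ (4 * ?e) = p ^ (4 * ?e - 3 * ?f) * (p ^ ?f) ^ 3" using f by (simp add: power_add[symmetric] power_mult[symmetric] mult.commute)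
  have X4: "X ^ 4 = (real n ^ v) ^ 4 * (p ^ (4 * ?e - 3 * ?f) * (p ^ ?f) ^ 3)"
    unfolding X_def power_mult_distrib p4[symmetric] by (simp add: power_mult[symmetric] mult.commute)
  have "(c ^ 4 / B ^ 3) * (X ^ 4 / Psi ^ 3) = p ^ (4 * ?e - 3 * ?f) * (c * real n ^ v) ^ 4 / (B * real n ^ ?j) ^ 3"
    unfolding X4 PsiF by (rule alg4) (use nj pw p in simp_all)
  with 2 show "(c ^ 4 / B ^ 3) * (X ^ 4 / Psi ^ 3) \<le> Q" by simp
qed

lemma minimal_edge:
  obtains F where "subhypergraph F H" "card (edges F) = 1" "card (verts F) = min_edge_size H"
proof -
  have "min_edge_size H \<in> card ` edges H"
    unfolding min_edge_size_def using finite_H(2) nonempty by (intro Min_in) auto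
  then obtain x where x: "x \<in> edges H" "card x = min_edge_size H" by auto
  have "x \<noteq> {}" "x \<subseteq> verts H" using x(1) wf by (auto simp: wf_hypergraph_def)
  then have "subhypergraph (Hypergraph x {x}) H"
    using x(1) wf finite_subset[OF _ finite_H(1)] by (auto simp: subhypergraph_def wf_hypergraph_def)
  then show ?thesis using x(2) by (intro that) auto
qed

lemma Psi_le: "Psi \<le> p * real n ^ min_edge_size H"
proof -
  obtain F where "subhypergraph F H" "card (edges F) = 1" "card (verts F) = min_edge_size H" by (rule minimal_edge)
  then show ?thesis using min_sub_le[of F H n p] by simp
qed

text \<open>A subhypergraph with an edge has at least \<open>min_edge_size H\<close> vertices.\<close>

lemma Psi_ge: "p ^ card (edges H) * real n ^ min_edge_size H \<le> Psi"
proof -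
  obtain F where F: "subhypergraph F H" "card (edges F) \<ge> 1" and PsiF: "Psi = p ^ card (edges F) * real n ^ card (verts F)"
    by (rule min_sub_attained[OF wf nonempty])
  obtain x where x: "x \<in> edges F" using F(2) by fastforce
  have "edges F \<subseteq> edges H" and finF: "finite (verts F)" and "edges F \<subseteq> Pow (verts F)"
    using F(1) by (auto simp: subhypergraph_def wf_hypergraph_def)
  then have xs: "x \<in> edges H" "x \<subseteq> verts F" using x by auto
  have "min_edge_size H \<le> card x" unfolding min_edge_size_def using xs(1) finite_H(2) by (intro Min_le) auto
  also have "\<dots> \<le> card (verts F)" using card_mono[OF finF xs(2)] .
  finally have j: "min_edge_size H \<le> card (verts F)" .
  have "p ^ card (edges H) \<le> p ^ card (edges F)"
    using card_edges_sub[OF F(1)] p by (intro power_decreasing) auto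
  moreover have "real n ^ min_edge_size H \<le> real n ^ card (verts F)" using j n_pos by (intro power_increasing) auto
  ultimately show ?thesis unfolding PsiF using p by (intro mult_mono) auto
qed

text \<open>Take the fibres for a single edge of minimal size.\<close>

lemma intersections_lower:
  "(c ^ 4 / B ^ 3) * ((real n ^ v) ^ 4 / (real n ^ min_edge_size H) ^ 3) \<le>
    (\<Sum>k\<in>copy_set H n. \<Sum>l\<in>copy_set H n. \<Sum>k'\<in>copy_set H n. \<Sum>l'\<in>copy_set H n. real (card (edges k \<inter> edges l \<inter> edges k' \<inter> edges l')))"
    (is "_ \<le> ?I")
proof -
  obtain F where F: "subhypergraph F H" "card (edges F) = 1" "card (verts F) = min_edge_size H" by (rule minimal_edge)
  obtain D where D: "indicator_sum_fibres (edges (complete_hypergraph n)) p (copy_set H n) edges (card (edges H)) D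
      (card (edges F)) (edge_set_const H * n ^ card (verts F))"
    by (rule fibres_exist[OF F(1)]) (use F(2) in auto)
  let ?K = "real (card (copy_set H n))"
  have nj: "real n ^ min_edge_size H > 0" using n_pos by simp
  have M: "real (edge_set_const H * n ^ card (verts F)) = B * real n ^ min_edge_size H" by (simp add: F(3))
  have "(c * real n ^ v) ^ 4 \<le> ?K ^ 4"
    using card_copy_set_bounds(1) c_pos by (intro power_mono) auto
  also have "\<dots> \<le> (B * real n ^ min_edge_size H) ^ 3 * ?I"
    using indicator_sum_fibres.intersections_ge[OF D] unfolding M .
  finally have "(c * real n ^ v) ^ 4 / (B * real n ^ min_edge_size H) ^ 3 \<le> ?I"
    using nj B_pos by (simp add: divide_le_eq mult.commute)
  then show ?thesis by (simp add: power_mult_distrib)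
qed

lemma s2_pos: "s2 > 0"
proof -
  have "0 < (c\<^sup>2 / B) * ((1 - p) * X\<^sup>2 / Psi)" using c_pos B_pos X_pos Psi_pos p by simp
  then show ?thesis using s2_lower by linarith
qed

lemma expectation_eq:
  "measure_pmf.expectation (homogeneous_random_hypergraph n p) h = Ex (\<lambda>\<omega>. h (Hypergraph {1..n} \<omega>))"
  using expectation_random_hypergraph p by simp

lemma copies_eq: "\<omega> \<subseteq> edges (complete_hypergraph n) \<Longrightarrow> copies H n (Hypergraph {1..n} \<omega>) = N \<omega>"
  unfolding N_def by (rule copies_eq_indicator_sum)

lemma std_copies_eq:
  assumes "\<omega> \<subseteq> edges (complete_hypergraph n)"
  shows "std_copies H n p (Hypergraph {1..n} \<omega>) = W \<omega>"
proof -
  have mean: "measure_pmf.expectation (homogeneous_random_hypergraph n p) (copies H n) = mu"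
    unfolding expectation_eq Ex_N[symmetric] by (rule bexp_cong) (rule copies_eq)
  have "measure_pmf.variance (homogeneous_random_hypergraph n p) (copies H n) = s2"
    unfolding mean unfolding expectation_eq s2_def by (rule bexp_cong) (simp only: copies_eq)
  then show ?thesis using mean copies_eq[OF assms] by (simp add: std_copies_def W_def)
qed

lemma expectation_std_copies:
  "measure_pmf.expectation (homogeneous_random_hypergraph n p) (\<lambda>G. h (std_copies H n p G)) = Ex (\<lambda>\<omega>. h (W \<omega>))"
  unfolding expectation_eq by (rule bexp_cong) (simp only: std_copies_eq)

lemma fourth_moment_eq: "fourth_moment H n p - 3 = (Ex (\<lambda>\<omega>. (N \<omega> - mu) ^ 4) - 3 * s2\<^sup>2) / s2\<^sup>2"
proof -
  have "fourth_moment H n p = Ex (\<lambda>\<omega>. W \<omega> ^ 4)"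
    unfolding fourth_moment_def by (rule expectation_std_copies)
  then show ?thesis using W_moments(2)[OF s2_pos] s2_pos by (simp add: diff_divide_distrib)
qed

lemma integral_std_copies_distr:
  assumes "h \<in> borel_measurable borel"
  shows "(\<integral>x. h x \<partial>std_copies_distr H n p) = Ex (\<lambda>\<omega>. h (W \<omega>))"
  unfolding std_copies_distr_def expectation_std_copies[symmetric]
  by (rule integral_distr) (simp_all add: assms)

lemma cdf_std_copies_distr: "cdf (std_copies_distr H n p) z = Ex (\<lambda>\<omega>. of_bool (W \<omega> \<le> z))"
proof -
  have "space (std_copies_distr H n p) = UNIV" "sets (std_copies_distr H n p) = sets borel"
    by (simp_all add: std_copies_distr_def)
  then have "cdf (std_copies_distr H n p) z = (\<integral>x. indicator {..z} x \<partial>std_copies_distr H n p)"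
    by (simp add: cdf_def)
  also have "\<dots> = Ex (\<lambda>\<omega>. indicator {..z} (W \<omega>))" by (rule integral_std_copies_distr) simp
  finally show ?thesis by (simp add: indicator_def)
qed

end

section \<open>Fourth moment and rate of convergence\<close>

text \<open>If \<open>s\<close> has the order \<open>Y = q * X\<^sup>2 / Psi\<close> and \<open>Q\<close> the order \<open>X ^ 4 / Psi ^ 3\<close>, then \<open>q * Q\<close> has the order \<open>Y\<^sup>2 / (q * Psi)\<close>.\<close>

lemma ratio_bounds:
  fixes q X Psi s Q l1 l2 l3 l4 :: real
  assumes pos: "q > 0" "X > 0" "Psi > 0" "l1 > 0" "l2 > 0" "l3 > 0" "l4 > 0"
    and s: "l1 * (q * X\<^sup>2 / Psi) \<le> s" "s \<le> l2 * (q * X\<^sup>2 / Psi)"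
    and Q: "l3 * (X ^ 4 / Psi ^ 3) \<le> Q" "Q \<le> l4 * (X ^ 4 / Psi ^ 3)"
  shows "q * Q / s\<^sup>2 \<le> (l4 / l1\<^sup>2) * (1 / (q * Psi))" "(l3 / l2\<^sup>2) * (1 / (q * Psi)) \<le> q * Q / s\<^sup>2"
proof -
  define Y where "Y = q * X\<^sup>2 / Psi"
  define r where "r = 1 / (q * Psi)"
  have Y: "Y > 0" and r: "r > 0" using pos by (simp_all add: Y_def r_def)
  have key: "q * (X ^ 4 / Psi ^ 3) = Y\<^sup>2 * r"
    using pos by (simp add: Y_def r_def field_simps power2_eq_square power3_eq_cube power4_eq_xxxx)
  have s': "0 < l1 * Y" "l1 * Y \<le> s" "s \<le> l2 * Y" using s pos Y by (simp_all add: Y_def)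
  have s0: "0 < s" using s' by linarith
  have Q': "l3 * (Y\<^sup>2 * r) \<le> q * Q" "q * Q \<le> l4 * (Y\<^sup>2 * r)"
    using mult_left_mono[OF Q(1), of q] mult_left_mono[OF Q(2), of q] pos
    by (simp_all add: key[symmetric] mult.left_commute)
  have "q * Q / s\<^sup>2 \<le> (l4 * (Y\<^sup>2 * r)) / (l1 * Y)\<^sup>2"
    using Q' s' s0 pos Y r by (intro frac_le power_mono) simp_all
  also have "\<dots> = (l4 / l1\<^sup>2) * r" using Y by (simp add: power_mult_distrib)
  finally show "q * Q / s\<^sup>2 \<le> (l4 / l1\<^sup>2) * (1 / (q * Psi))" by (simp add: r_def)
  have "(l3 / l2\<^sup>2) * r = (l3 * (Y\<^sup>2 * r)) / (l2 * Y)\<^sup>2" using Y by (simp add: power_mult_distrib)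
  also have "\<dots> \<le> q * Q / s\<^sup>2"
  proof (rule frac_le)
    show "0 \<le> q * Q" by (rule order_trans[OF _ Q'(1)]) (use pos Y r in simp)
    show "l3 * (Y\<^sup>2 * r) \<le> q * Q" by (rule Q'(1))
    show "0 < s\<^sup>2" using s0 by simp
    show "s\<^sup>2 \<le> (l2 * Y)\<^sup>2" using s' s0 by (intro power_mono) simp_all
  qed
  finally show "(l3 / l2\<^sup>2) * (1 / (q * Psi)) \<le> q * Q / s\<^sup>2" by (simp add: r_def)
qed

text \<open>Constants in the bounds for \<open>s2\<close>, for \<open>Q\<close> and for their ratio; they depend on \<open>H\<close> only.\<close>

definition var_lower where "var_lower H = (placement_const H)\<^sup>2 / real (edge_set_const H)"
definition var_upper where "var_upper H = real (card (edges H)) * 2 ^ (3 * card (edges H)) * (real (edge_set_const H))\<^sup>2"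
definition quad_lower where "quad_lower H = placement_const H ^ 4 / real (edge_set_const H) ^ 3"
definition quad_upper where "quad_upper H = 6 * 2 ^ (9 * card (edges H)) * real (edge_set_const H) ^ 4"
definition ratio_upper where "ratio_upper H = quad_upper H / (var_lower H)\<^sup>2"
definition ratio_lower where "ratio_lower H = quad_lower H / (var_upper H)\<^sup>2"
text \<open>The square root with 72 and 936 comes from \<open>18 + 18 * E W ^ 4\<close>, the bound for the second moment of \<open>G W\<close>, when \<open>E W ^ 4\<close> is at most
\<open>3 + 52 * e * ratio_upper H\<close>. The summand 2 covers the range where the rate exceeds 1.\<close>

definition distance_const where
  "distance_const H = 2 * sqrt (2 * real (card (edges H)) ^ 3 * ratio_upper H)
     + sqrt (real (card (edges H)) ^ 2 * ratio_upper H) * sqrt (72 + 936 * real (card (edges H)) * ratio_upper H) + 2"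

context copy_counts
begin

lemma const_pos: "var_lower H > 0" "var_upper H > 0" "quad_lower H > 0" "quad_upper H > 0" "ratio_upper H > 0" "ratio_lower H > 0"
proof -
  show 1: "var_lower H > 0" "var_upper H > 0" "quad_lower H > 0" "quad_upper H > 0"
    using B_pos c_pos e_pos by (simp_all add: var_lower_def var_upper_def quad_lower_def quad_upper_def)
  show "ratio_upper H > 0" "ratio_lower H > 0" using 1 by (simp_all add: ratio_upper_def ratio_lower_def)
qed

text \<open>The square of the rate.\<close>

definition r where "r = 1 / ((1 - p) * Psi)"

lemma r_pos: "r > 0" using p Psi_pos by (simp add: r_def)

lemma Q_ratio: "(1 - p) * Q / s2\<^sup>2 \<le> ratio_upper H * r" "ratio_lower H * r \<le> (1 - p) * Q / s2\<^sup>2"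
proof -
  have "1 - p > 0" using p by simp
  note * = ratio_bounds[OF this X_pos Psi_pos const_pos(1-4)
    s2_lower[folded var_lower_def] s2_upper[folded var_upper_def] Q_lower[folded quad_lower_def] Q_upper[folded quad_upper_def]]
  show "(1 - p) * Q / s2\<^sup>2 \<le> ratio_upper H * r" "ratio_lower H * r \<le> (1 - p) * Q / s2\<^sup>2"
    using * by (simp_all add: ratio_upper_def ratio_lower_def r_def)
qed

lemma Q_nonneg: "Q \<ge> 0"
  unfolding Q_eq using p by (intro sum_nonneg) auto

lemma fourth_moment_upper: "\<bar>fourth_moment H n p - 3\<bar> \<le> 52 * real (card (edges H)) * ratio_upper H * r"
proof -
  have "\<bar>fourth_moment H n p - 3\<bar> = \<bar>Ex (\<lambda>\<omega>. (N \<omega> - mu) ^ 4) - 3 * s2\<^sup>2\<bar> / s2\<^sup>2"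
    unfolding fourth_moment_eq by (simp add: abs_divide)
  also have "\<dots> \<le> (52 * real (card (edges H)) * (1 - p) * Q) / s2\<^sup>2"
    by (rule divide_right_mono[OF abs_fourth_cumulant_le]) simp
  also have "\<dots> = 52 * real (card (edges H)) * ((1 - p) * Q / s2\<^sup>2)" by simp
  also have "\<dots> \<le> 52 * real (card (edges H)) * (ratio_upper H * r)"
    by (rule mult_left_mono[OF Q_ratio(1)]) simp
  finally show ?thesis by simp
qed

lemma fourth_moment_lower_small_p:
  assumes "26 * p \<le> 1"
  shows "ratio_lower H / 2 * r \<le> fourth_moment H n p - 3"
proof -
  have "ratio_lower H / 2 * r \<le> (1 - p) * Q / s2\<^sup>2 / 2" using Q_ratio(2) by simp
  also have "\<dots> = ((1 - p) * Q / 2) / s2\<^sup>2" by simp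
  also have "\<dots> \<le> ((1 - 13 * p) * Q) / s2\<^sup>2"
  proof (rule divide_right_mono)
    have "(1 - p) / 2 \<le> 1 - 13 * p" using assms p by simp
    from mult_right_mono[OF this Q_nonneg] show "(1 - p) * Q / 2 \<le> (1 - 13 * p) * Q" by simp
  qed simp
  also have "\<dots> \<le> (Ex (\<lambda>\<omega>. (N \<omega> - mu) ^ 4) - 3 * s2\<^sup>2) / s2\<^sup>2"
    by (rule divide_right_mono[OF fourth_cumulant_ge_small_p]) simp
  finally show ?thesis unfolding fourth_moment_eq .
qed

text \<open>The main term is the sum of the sizes of the fourfold intersections, bounded below by the quadruples that share an edge of minimal size. Since \<open>Psi\<close> has the order
\<open>n ^ min_edge_size H\<close> for \<open>p \<ge> 1 / 2\<close>, it is of the order \<open>r\<close>; the error term carries an extra factor \<open>1 - p\<close>.\<close>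

lemma fourth_moment_lower_large_p:
  assumes half: "1 / 2 \<le> p"
    and q: "(1 - p) * (208 * real (card (edges H)) ^ 2 * 2 ^ (4 * card (edges H)) * ratio_upper H) \<le> quad_lower H / (var_upper H)\<^sup>2 * (1 / 2) ^ (3 * card (edges H)) / 2"
  shows "(quad_lower H / (var_upper H)\<^sup>2 * (1 / 2) ^ (3 * card (edges H)) / 2) * r \<le> fourth_moment H n p - 3"
proof -
  let ?e = "card (edges H)"
  define I where "I = (\<Sum>k\<in>copy_set H n. \<Sum>l\<in>copy_set H n. \<Sum>k'\<in>copy_set H n. \<Sum>l'\<in>copy_set H n. real (card (edges k \<inter> edges l \<inter> edges k' \<inter> edges l')))"
  define a where "a = quad_lower H / (var_upper H)\<^sup>2"
  define h where "h = (1 / 2 :: real) ^ (3 * ?e)"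
  define c6 where "c6 = 208 * real ?e ^ 2 * 2 ^ (4 * ?e)"
  define m where "m = real n ^ min_edge_size H"
  have m: "m > 0" using n_pos by (simp add: m_def)
  have u: "real n ^ v > 0" using n_pos by simp
  have q0: "1 - p > 0" using p by simp
  have I: "quad_lower H * ((real n ^ v) ^ 4 / m ^ 3) \<le> I"
    using intersections_lower unfolding I_def m_def quad_lower_def .
  have Psi_m: "h * m ^ 3 \<le> Psi ^ 3"
  proof -
    have "(1 / 2) ^ ?e * m \<le> p ^ ?e * m" using half m by (intro mult_right_mono power_mono) auto
    also have "\<dots> \<le> Psi" using Psi_ge by (simp add: m_def)
    finally have "((1 / 2) ^ ?e * m) ^ 3 \<le> Psi ^ 3" using m by (intro power_mono) auto
    moreover have "h = ((1 / 2) ^ ?e) ^ 3" by (simp add: h_def power_mult[symmetric] mult.commute)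
    ultimately show ?thesis by (simp add: power_mult_distrib)
  qed
  have s2_up: "s2 \<le> var_upper H * ((1 - p) * (real n ^ v)\<^sup>2 / Psi)"
  proof -
    have "X \<le> real n ^ v" using p power_le_one[of p ?e] u by (simp add: X_def mult_left_le)
    then have "X\<^sup>2 \<le> (real n ^ v)\<^sup>2" using X_pos by (intro power_mono) auto
    then have "var_upper H * ((1 - p) * X\<^sup>2 / Psi) \<le> var_upper H * ((1 - p) * (real n ^ v)\<^sup>2 / Psi)"
      using const_pos(2) Psi_pos q0 by (intro mult_left_mono divide_right_mono) auto
    then show ?thesis using s2_upper[folded var_upper_def] by linarith
  qed
  have first: "a * h * r \<le> (1 - p) * I / s2\<^sup>2"
  proof -
    have "a * h * r \<le> a * (Psi ^ 3 / m ^ 3) * r"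
      using Psi_m m const_pos r_pos by (intro mult_right_mono mult_left_mono) (auto simp: a_def pos_le_divide_eq)
    also have "\<dots> = ((1 - p) * (quad_lower H * ((real n ^ v) ^ 4 / m ^ 3))) / (var_upper H * ((1 - p) * (real n ^ v)\<^sup>2 / Psi))\<^sup>2"
    proof -
      have alg: "ql / vu\<^sup>2 * (P ^ 3 / mm) * (1 / (qq * P)) = (qq * (ql * (uu ^ 4 / mm))) / (vu * (qq * uu\<^sup>2 / P))\<^sup>2"
        if "vu \<noteq> 0" "P \<noteq> 0" "mm \<noteq> 0" "qq \<noteq> 0" "uu \<noteq> 0" for ql vu P mm qq uu :: real
        using that by (simp add: field_simps power2_eq_square power3_eq_cube power4_eq_xxxx)
      show ?thesis unfolding a_def r_def
        by (rule alg) (use const_pos(2) Psi_pos m q0 u in auto)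
    qed
    also have "\<dots> \<le> ((1 - p) * I) / s2\<^sup>2"
    proof (rule frac_le)
      show "0 \<le> (1 - p) * I" unfolding I_def using q0 by (intro mult_nonneg_nonneg sum_nonneg) auto
      show "(1 - p) * (quad_lower H * ((real n ^ v) ^ 4 / m ^ 3)) \<le> (1 - p) * I" using I q0 by (intro mult_left_mono) auto
      show "0 < s2\<^sup>2" using s2_pos by simp
      show "s2\<^sup>2 \<le> (var_upper H * ((1 - p) * (real n ^ v)\<^sup>2 / Psi))\<^sup>2" using s2_up s2_pos by (intro power_mono) auto
    qed
    finally show ?thesis .
  qed
  have second: "c6 * (1 - p)\<^sup>2 * Q / s2\<^sup>2 \<le> a * h / 2 * r"
  proof -
    have "c6 * (1 - p)\<^sup>2 * Q / s2\<^sup>2 = (c6 * (1 - p)) * ((1 - p) * Q / s2\<^sup>2)" by (simp add: power2_eq_square)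
    also have "\<dots> \<le> (c6 * (1 - p)) * (ratio_upper H * r)"
      using q0 by (intro mult_left_mono Q_ratio(1)) (simp add: c6_def)
    also have "\<dots> = ((1 - p) * (c6 * ratio_upper H)) * r" by simp
    also have "\<dots> \<le> a * h / 2 * r"
      using q r_pos by (intro mult_right_mono) (auto simp: a_def h_def c6_def)
    finally show ?thesis .
  qed
  have "(1 - p) * I / s2\<^sup>2 - c6 * (1 - p)\<^sup>2 * Q / s2\<^sup>2 \<le> fourth_moment H n p - 3"
    unfolding fourth_moment_eq diff_divide_distrib[symmetric]
    using fourth_cumulant_ge_large_p[OF half] unfolding I_def c6_def by (intro divide_right_mono) auto
  with first second have "a * h * r - a * h / 2 * r \<le> fourth_moment H n p - 3" by linarith
  then have "a * h / 2 * r \<le> fourth_moment H n p - 3" by simp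
  then show ?thesis by (simp only: a_def h_def)
qed

lemma Stein_error_le:
  assumes y: "0 \<le> y" "y \<le> 72 + 936 * real (card (edges H)) * ratio_upper H"
  shows "(2 * sqrt (Ex (\<lambda>\<omega>. (V \<omega> - s2)\<^sup>2)) + sqrt (Ex (\<lambda>\<omega>. (T \<omega>)\<^sup>2)) * sqrt y) / s2 \<le> distance_const H * sqrt r"
proof -
  let ?e = "real (card (edges H))"
  define A where "A = 2 * sqrt (2 * ?e ^ 3 * ratio_upper H)"
  define D where "D = sqrt (?e ^ 2 * ratio_upper H)"
  define G where "G = 72 + 936 * ?e * ratio_upper H"
  have nn: "A \<ge> 0" "D \<ge> 0" "G \<ge> 72" using const_pos(5) by (simp_all add: A_def D_def G_def)
  have const: "distance_const H = A + D * sqrt G + 2" by (simp add: distance_const_def A_def D_def G_def)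
  have root: "sqrt x / s2 \<le> sqrt (k * ratio_upper H) * sqrt r" if "x \<le> k * ((1 - p) * Q)" "0 \<le> k" for x k
  proof -
    have "sqrt x / s2 = sqrt (x / s2\<^sup>2)" using s2_pos by (simp add: real_sqrt_divide)
    also have "\<dots> \<le> sqrt (k * ratio_upper H * r)"
    proof (rule real_sqrt_le_mono)
      have "x / s2\<^sup>2 \<le> k * ((1 - p) * Q) / s2\<^sup>2" using that(1) by (rule divide_right_mono) simp
      also have "\<dots> = k * ((1 - p) * Q / s2\<^sup>2)" by simp
      also have "\<dots> \<le> k * (ratio_upper H * r)" by (rule mult_left_mono[OF Q_ratio(1) that(2)])
      finally show "x / s2\<^sup>2 \<le> k * ratio_upper H * r" by simp
    qed
    finally show ?thesis by (simp add: real_sqrt_mult)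
  qed
  have V: "2 * sqrt (Ex (\<lambda>\<omega>. (V \<omega> - s2)\<^sup>2)) / s2 \<le> A * sqrt r"
  proof -
    have "(1 - p) ^ 3 \<le> (1 - p) ^ 1" using p by (intro power_decreasing) auto
    then have "2 * ?e ^ 3 * (1 - p) ^ 3 * Q \<le> 2 * ?e ^ 3 * (1 - p) * Q"
      using Q_nonneg by (intro mult_right_mono mult_left_mono) auto
    then have "Ex (\<lambda>\<omega>. (V \<omega> - s2)\<^sup>2) \<le> 2 * ?e ^ 3 * ((1 - p) * Q)" using Var_V by simp
    from root[OF this] show ?thesis by (simp add: A_def)
  qed
  have T: "sqrt (Ex (\<lambda>\<omega>. (T \<omega>)\<^sup>2)) / s2 \<le> D * sqrt r"
  proof -
    have "Ex (\<lambda>\<omega>. (T \<omega>)\<^sup>2) \<le> ?e ^ 2 * ((1 - p) * Q)" using second_moment_T by (simp add: mult_ac)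
    from root[OF this] show ?thesis by (simp add: D_def)
  qed
  have "(2 * sqrt (Ex (\<lambda>\<omega>. (V \<omega> - s2)\<^sup>2)) + sqrt (Ex (\<lambda>\<omega>. (T \<omega>)\<^sup>2)) * sqrt y) / s2
    = 2 * sqrt (Ex (\<lambda>\<omega>. (V \<omega> - s2)\<^sup>2)) / s2 + (sqrt (Ex (\<lambda>\<omega>. (T \<omega>)\<^sup>2)) / s2) * sqrt y"
    by (simp add: add_divide_distrib)
  also have "\<dots> \<le> A * sqrt r + (D * sqrt r) * sqrt G"
    using V T nn r_pos y[folded G_def] by (intro add_mono mult_mono) auto
  also have "\<dots> \<le> distance_const H * sqrt r" using r_pos by (simp add: const algebra_simps)
  finally show ?thesis .
qed

lemma Kolmogorov_rate: "\<bar>Ex (\<lambda>\<omega>. of_bool (W \<omega> \<le> z)) - gPhi z\<bar> \<le> distance_const H * sqrt r"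
  by (rule order_trans[OF Kolmogorov_bound[OF s2_pos] Stein_error_le]) (use const_pos(5) in auto)

text \<open>The Stein bound involves the fourth moment, which is bounded only as long as the rate is; otherwise the trivial bound suffices.\<close>

lemma Wasserstein_rate:
  assumes h: "1-lipschitz_on UNIV h"
  shows "\<bar>Ex (\<lambda>\<omega>. h (W \<omega>)) - (\<integral>x. h x \<partial>std_normal_distribution)\<bar> \<le> distance_const H * sqrt r"
proof (cases "r \<le> 1")
  case True
  let ?e = "real (card (edges H))"
  have "Ex (\<lambda>\<omega>. W \<omega> ^ 4) = fourth_moment H n p"
    unfolding fourth_moment_def by (rule expectation_std_copies[symmetric])
  also have "\<dots> \<le> 3 + 52 * ?e * ratio_upper H * r" using fourth_moment_upper by linarith
  also have "\<dots> \<le> 3 + 52 * ?e * ratio_upper H * 1"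
    using True const_pos(5) by (intro add_left_mono mult_left_mono) auto
  finally have "18 + 18 * Ex (\<lambda>\<omega>. W \<omega> ^ 4) \<le> 72 + 936 * ?e * ratio_upper H" by simp
  moreover have "0 \<le> Ex (\<lambda>\<omega>. W \<omega> ^ 4)" by (rule bexp_nonneg[OF p_bounds(1,2)]) simp
  ultimately show ?thesis
    using order_trans[OF Wasserstein_bound[OF s2_pos h] Stein_error_le] by simp
next
  case False
  have const: "distance_const H \<ge> 2" using const_pos(5) by (simp add: distance_const_def)
  have "\<bar>Ex (\<lambda>\<omega>. h (W \<omega>)) - (\<integral>x. h x \<partial>std_normal_distribution)\<bar> \<le> 2"
    by (rule Wasserstein_trivial[OF s2_pos h])
  also have "\<dots> \<le> distance_const H * 1" using const by simp
  also have "\<dots> \<le> distance_const H * sqrt r" using False const by (intro mult_left_mono) auto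
  finally show ?thesis .
qed

lemma dist_WK_le: "dist_WK (std_copies_distr H n p) std_normal_distribution \<le> ereal (distance_const H * sqrt r)"
  unfolding dist_WK_def
proof (rule max.boundedI)
  show "dist_K (std_copies_distr H n p) std_normal_distribution \<le> ereal (distance_const H * sqrt r)"
    unfolding dist_K_def cdf_std_copies_distr using Kolmogorov_rate by (intro SUP_least) simp
  show "dist_W (std_copies_distr H n p) std_normal_distribution \<le> ereal (distance_const H * sqrt r)"
    unfolding dist_W_def
  proof (rule SUP_least)
    fix h :: "real \<Rightarrow> real" assume "h \<in> {h. 1-lipschitz_on UNIV h}"
    then have h: "1-lipschitz_on UNIV h" by simp
    have "h \<in> borel_measurable borel"
      by (rule borel_measurable_continuous_onI[OF lipschitz_on_continuous_on[OF h]])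
    then show "ereal \<bar>(\<integral>x. h x \<partial>std_copies_distr H n p) - (\<integral>x. h x \<partial>std_normal_distribution)\<bar> \<le> ereal (distance_const H * sqrt r)"
      using Wasserstein_rate[OF h] by (simp add: integral_std_copies_distr)
  qed
qed

lemma rate_eq: "((1 - p) * Psi) powr (- 1 / 2) = sqrt r"
proof -
  have "(1 - p) * Psi > 0" using p Psi_pos by simp
  then show ?thesis by (simp add: r_def powr_minus_divide powr_half_sqrt real_sqrt_divide)
qed

lemma inverse_eq_r: "inverse ((1 - p) * Psi) = r"
  unfolding r_def by (rule inverse_eq_divide)

lemma min_edge_rate_eq: "real n powr (- real (min_edge_size H) / 2) = sqrt (1 / real n ^ min_edge_size H)"
proof -
  have n: "real n > 0" using n_pos by simp
  have "real n powr (- real (min_edge_size H) / 2) = (real n powr real (min_edge_size H)) powr (- 1 / 2)"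
    by (simp add: powr_powr)
  also have "\<dots> = (real n ^ min_edge_size H) powr (- 1 / 2)" using n by (simp add: powr_realpow)
  also have "\<dots> = sqrt (1 / real n ^ min_edge_size H)"
    using n by (simp add: powr_minus_divide powr_half_sqrt real_sqrt_divide)
  finally show ?thesis .
qed

lemma min_edge_rate_le: "real n powr (- real (min_edge_size H) / 2) \<le> sqrt r"
  unfolding min_edge_rate_eq
proof (rule real_sqrt_le_mono)
  have m: "real n ^ min_edge_size H > 0" using n_pos by simp
  have "(1 - p) * Psi \<le> 1 * Psi" using p Psi_pos by (intro mult_right_mono) auto
  also have "\<dots> \<le> 1 * real n ^ min_edge_size H"
    using order_trans[OF Psi_le mult_right_mono[of p 1]] p m by simp
  finally show "1 / real n ^ min_edge_size H \<le> r"
    unfolding r_def using p Psi_pos by (intro frac_le) auto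
qed

text \<open>Away from 0 and 1, \<open>(1 - p) * Psi\<close> has the order \<open>n ^ min_edge_size H\<close>.\<close>

lemma rate_le_middle_p:
  assumes "0 < \<delta>" "\<delta> \<le> p" "p \<le> 1 - \<delta>"
  shows "sqrt r \<le> sqrt (1 / \<delta> ^ (card (edges H) + 1)) * real n powr (- real (min_edge_size H) / 2)"
proof -
  have m: "real n ^ min_edge_size H > 0" using n_pos by simp
  have "\<delta> ^ card (edges H) * real n ^ min_edge_size H \<le> p ^ card (edges H) * real n ^ min_edge_size H"
    using assms m by (intro mult_right_mono power_mono) auto
  then have "\<delta> ^ card (edges H) * real n ^ min_edge_size H \<le> Psi" using Psi_ge by linarith
  then have "\<delta> * (\<delta> ^ card (edges H) * real n ^ min_edge_size H) \<le> (1 - p) * Psi"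
    using assms m by (intro mult_mono) auto
  then have "r \<le> 1 / (\<delta> * (\<delta> ^ card (edges H) * real n ^ min_edge_size H))"
    unfolding r_def using assms m by (intro frac_le) auto
  also have "\<dots> = (1 / \<delta> ^ (card (edges H) + 1)) * (1 / real n ^ min_edge_size H)" by simp
  finally show ?thesis
    unfolding min_edge_rate_eq real_sqrt_mult[symmetric] by (rule real_sqrt_le_mono)
qed

end

theorem theorem3p6:
  fixes H :: "'a hypergraph"
  assumes "wf_hypergraph H" and "edges H \<noteq> {}"
  shows "(\<exists>C C1 C2 :: real. \<exists>n0 :: nat. C > 0 \<and> C1 > 0 \<and> C2 > 0 \<and>
            (\<forall>n \<ge> n0. \<forall>p \<in> {0<..<1}.
               let rate = ((1 - p) * min_sub H n p) powr (- 1 / 2);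
                   R = sqrt \<bar>fourth_moment H n p - 3\<bar> + real n powr (- real (min_edge_size H) / 2)
               in dist_WK (std_copies_distr H n p) std_normal_distribution \<le> ereal (C * rate) \<and>
                  C1 * R \<le> rate \<and> rate \<le> C2 * R)) \<and>
         (\<exists>\<delta> C3 C4 :: real. \<exists>n1 :: nat. 0 < \<delta> \<and> \<delta> < 1 / 2 \<and> C3 > 0 \<and> C4 > 0 \<and>
            (\<forall>n \<ge> n1. \<forall>p \<in> {0<..<\<delta>} \<union> {1 - \<delta><..<1}.
               let rate = inverse ((1 - p) * min_sub H n p)
               in C3 * (fourth_moment H n p - 3) \<le> rate \<and>
                  rate \<le> C4 * (fourth_moment H n p - 3)))"
proof -
  define e where "e = card (edges H)"
  have cc: "copy_counts H n p" if "card (verts H) \<le> n" "0 < p" "p < 1" for n p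
    using assms that by (intro copy_counts.intro)
  have half: "copy_counts H (card (verts H)) (1 / 2)" by (rule cc) auto
  note pos = copy_counts.const_pos[OF half]
  have e: "real e \<ge> 1" using copy_counts.e_pos[OF half] by (simp add: e_def)
  define A1 where "A1 = 52 * real e * ratio_upper H"
  have A1: "A1 > 0" using pos(5) e by (simp add: A1_def)
  define a4 where "a4 = quad_lower H / (var_upper H)\<^sup>2 * (1 / 2) ^ (3 * e) / 2"
  define c6 where "c6 = 208 * real e ^ 2 * 2 ^ (4 * e) * ratio_upper H"
  have a4: "a4 > 0" and c6: "c6 > 0" using pos e by (simp_all add: a4_def c6_def)
  \<comment> \<open>Below 1/26 the leading term of the cumulants for small p dominates; the second bound lets the main term win for p near 1.\<close>
  define \<delta> where "\<delta> = min (1 / 26) (a4 / c6)"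
  have \<delta>: "0 < \<delta>" "\<delta> < 1 / 2" "26 * \<delta> \<le> 1" "\<delta> * c6 \<le> a4"
  proof -
    show "0 < \<delta>" "\<delta> < 1 / 2" "26 * \<delta> \<le> 1" using a4 c6 by (auto simp: \<delta>_def)
    have "\<delta> \<le> a4 / c6" by (simp add: \<delta>_def)
    then show "\<delta> * c6 \<le> a4" using c6 by (simp add: pos_le_divide_eq)
  qed
  define b where "b = min (ratio_lower H / 2) a4"
  have b: "b > 0" using pos(6) a4 by (simp add: b_def)
  have upper: "\<bar>fourth_moment H n p - 3\<bar> \<le> A1 * copy_counts.r H n p"
    if "card (verts H) \<le> n" "0 < p" "p < 1" for n p
    using copy_counts.fourth_moment_upper[OF cc[OF that]] by (simp add: A1_def e_def)
  have lower: "b * copy_counts.r H n p \<le> fourth_moment H n p - 3"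
    if n: "card (verts H) \<le> n" and p: "p \<in> {0<..<\<delta>} \<union> {1 - \<delta><..<1}" for n p
  proof -
    have p01: "0 < p" "p < 1" using p \<delta> by auto
    note C = cc[OF n p01]
    have r: "copy_counts.r H n p \<ge> 0" using copy_counts.r_pos[OF C] by simp
    show ?thesis
    proof (cases "p < \<delta>")
      case True
      have "b * copy_counts.r H n p \<le> ratio_lower H / 2 * copy_counts.r H n p"
        using r by (intro mult_right_mono) (simp_all add: b_def)
      also have "\<dots> \<le> fourth_moment H n p - 3"
        using True \<delta>(3) by (intro copy_counts.fourth_moment_lower_small_p[OF C]) linarith
      finally show ?thesis .
    next
      case False
      then have q: "1 - p \<le> \<delta>" using p by auto
      have "b * copy_counts.r H n p \<le> a4 * copy_counts.r H n p"
        using r by (intro mult_right_mono) (simp_all add: b_def)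
      also have "\<dots> \<le> fourth_moment H n p - 3"
        unfolding a4_def e_def
      proof (rule copy_counts.fourth_moment_lower_large_p[OF C])
        show "1 / 2 \<le> p" using q \<delta>(2) by linarith
        have "(1 - p) * c6 \<le> \<delta> * c6" using q c6 by (intro mult_right_mono) auto
        then show "(1 - p) * (208 * real (card (edges H)) ^ 2 * 2 ^ (4 * card (edges H)) * ratio_upper H)
          \<le> quad_lower H / (var_upper H)\<^sup>2 * (1 / 2) ^ (3 * card (edges H)) / 2"
          using \<delta>(4) unfolding c6_def a4_def e_def by (rule order_trans)
      qed
      finally show ?thesis .
    qed
  qed
  define C1 where "C1 = 1 / (sqrt A1 + 1)"
  define C2 where "C2 = sqrt (1 / b) + sqrt (1 / \<delta> ^ (e + 1))"
  have C1: "C1 > 0" using A1 by (simp add: C1_def add_pos_pos)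
  have C2: "C2 > 0" using b \<delta>(1) by (simp add: C2_def add_pos_pos)
  have C: "distance_const H > 0" using pos(5) by (simp add: distance_const_def add_nonneg_pos)
  have part1: "let rate = ((1 - p) * min_sub H n p) powr (- 1 / 2);
             R = sqrt \<bar>fourth_moment H n p - 3\<bar> + real n powr (- real (min_edge_size H) / 2)
         in dist_WK (std_copies_distr H n p) std_normal_distribution \<le> ereal (distance_const H * rate) \<and>
            C1 * R \<le> rate \<and> rate \<le> C2 * R"
    if n: "card (verts H) \<le> n" and p: "p \<in> {0<..<1}" for n p
  proof -
    have p01: "0 < p" "p < 1" using p by auto
    note C = cc[OF n p01]
    define r where "r = copy_counts.r H n p"
    define M where "M = sqrt \<bar>fourth_moment H n p - 3\<bar>"
    define E where "E = real n powr (- real (min_edge_size H) / 2)"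
    have r: "r > 0" using copy_counts.r_pos[OF C] by (simp add: r_def)
    have M0: "M \<ge> 0" and E0: "E \<ge> 0" by (simp_all add: M_def E_def)
    have M: "M \<le> sqrt A1 * sqrt r"
      unfolding M_def real_sqrt_mult[symmetric] r_def by (rule real_sqrt_le_mono[OF upper[OF n p01]])
    have E: "E \<le> sqrt r" using copy_counts.min_edge_rate_le[OF C] by (simp add: E_def r_def)
    have "M + E \<le> (sqrt A1 + 1) * sqrt r" using M E by (simp add: distrib_right)
    moreover have "sqrt A1 + 1 > 0" using A1 by (simp add: add_pos_pos)
    ultimately have c1: "C1 * (M + E) \<le> sqrt r" by (simp add: C1_def divide_le_eq mult.commute)
    \<comment> \<open>Near 0 and 1 the fourth moment controls the rate, in between the smallest edges do.\<close>
    have c2: "sqrt r \<le> C2 * (M + E)"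
    proof (cases "p \<in> {0<..<\<delta>} \<union> {1 - \<delta><..<1}")
      case True
      have "r \<le> (1 / b) * \<bar>fourth_moment H n p - 3\<bar>"
        using lower[OF n True] b by (simp add: r_def field_simps)
      then have "sqrt r \<le> sqrt (1 / b) * M"
        unfolding M_def real_sqrt_mult[symmetric] by (rule real_sqrt_le_mono)
      also have "\<dots> \<le> C2 * (M + E)"
        using M0 E0 b \<delta>(1) by (intro mult_mono) (simp_all add: C2_def)
      finally show ?thesis .
    next
      case False
      have "sqrt r \<le> sqrt (1 / \<delta> ^ (e + 1)) * E"
        unfolding r_def E_def e_def
        by (rule copy_counts.rate_le_middle_p[OF C \<delta>(1)]) (use False p01 in auto)
      also have "\<dots> \<le> C2 * (M + E)"
        using M0 E0 b \<delta>(1) by (intro mult_mono) (simp_all add: C2_def)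
      finally show ?thesis .
    qed
    show ?thesis
      unfolding Let_def copy_counts.rate_eq[OF C]
      using copy_counts.dist_WK_le[OF C] c1 c2 by (simp add: M_def E_def r_def)
  qed
  have part2: "let rate = inverse ((1 - p) * min_sub H n p)
         in 1 / A1 * (fourth_moment H n p - 3) \<le> rate \<and> rate \<le> 1 / b * (fourth_moment H n p - 3)"
    if n: "card (verts H) \<le> n" and p: "p \<in> {0<..<\<delta>} \<union> {1 - \<delta><..<1}" for n p
  proof -
    have p01: "0 < p" "p < 1" using p \<delta> by auto
    note C = cc[OF n p01]
    have "fourth_moment H n p - 3 \<le> A1 * copy_counts.r H n p" using upper[OF n p01] by linarith
    then show ?thesis
      unfolding Let_def copy_counts.inverse_eq_r[OF C]
      using lower[OF n p] A1 b by (simp add: divide_le_eq pos_le_divide_eq mult.commute)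
  qed
  have "1 / A1 > 0" "1 / b > 0" using A1 b by simp_all
  then show ?thesis
    using C C1 C2 part1 \<delta>(1,2) part2 by (intro conjI) blast+
qed

end
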